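(* Let $p$ be a prime number and let $P$ be a finite $p$-group. Then $$P\cong\bigoplus_{N\trianglelefteq P}\partial (P/N)$$ in the Roquette category $\mathcal{R}_p$, where $N$ runs through all normal subgroups of $P$.
   Context: Roquette category. For finite groups $G,H$, let $B(H,G)$ be the Grothendieck group (for disjoint union) of finite $(H,G)$-bisets, i.e. the Burnside group of $H\times G^{op}$. Composition $B(K,H)\times B(H,G)\to B(K,G)$ is the bilinear map induced by $(V,U)\mapsto V\times_H U$, and $\mathrm{Id}_G\in B(G,G)$ is the class of $G$ with left and right multiplication. Write $\mathbf{1}$ for the trivial group and $B(G)=B(G,\mathbf{1})$. Let $X$ be a Sylow $p$-subgroup of $\mathrm{PGL}(3,\mathbb{F}_p)$, and let $\delta=\mathbb{L}-\mathbb{P}\in B(X)$, where $\mathbb{L}$ and $\mathbb{P}$ are the $X$-sets of lines and points of the projective plane over $\mathbb{F}_p$; equivalently $\delta=(X/I-X/IZ)-(X/J-X/JZ)$, where $I,J$ are non-conjugate non-central subgroups of order $p$ of $X$ and $Z=Z(X)$. Let $B_\delta$ be the subfunctor of $B$ (on finite $p$-groups) generated by $\delta$, i.e. $B_\delta(P)=\{\varphi\circ\delta\mid\varphi\in B(P,X)\}\subseteq B(P)$ (this does not depend on the choices), and let $B_\delta(Q,P)\subseteq B(Q,P)$ correspond to $B_\delta(Q\times P^{op})\subseteq B(Q\times P^{op})$. The category $\mathcal{R}_p^\sharp$ has the finite $p$-groups as objects, $\mathrm{Hom}(P,Q)=B(Q,P)/B_\delta(Q,P)$, composition induced by that of bisets,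 and identities the images of $\mathrm{Id}_P$. The Roquette category $\mathcal{R}_p$ is its idempotent additive completion: objects are formal finite direct sums of pairs $(P,e)$ with $P$ a finite $p$-group and $e$ an idempotent of $\mathrm{End}_{\mathcal{R}_p^\sharp}(P)$; morphisms are matrices whose entry from $(P,e)$ to $(Q,f)$ lies in $f\,\mathrm{Hom}_{\mathcal{R}_p^\sharp}(P,Q)\,e$, composed by matrix multiplication. A finite $p$-group $P$ is viewed as the object $(P,\mathrm{Id}_P)$. Edge. For a finite $p$-group $P$, let $f_{\mathbf 1}^P=\sum_{M\trianglelefteq P}\mu(\mathbf{1},M)\,[P/M]\in B(P,P)$, where $\mu$ is the Möbius function of the poset of normal subgroups of $P$ and $P/M$ is the $(P,P)$-biset with left and right multiplication. It is an idempotent, and the edge of $P$ is the object $\partial P=(P,f_{\mathbf 1}^P)$ of $\mathcal{R}_p$. *)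

theory Defs
  imports
    "HOL-Algebra.Algebra"
    "HOL-Number_Theory.Residues"
    "HOL-Library.Countable_Set"
begin

section \<open>Finite groups\<close>

definition finite_p_group :: "nat \<Rightarrow> ('a, 'm) monoid_scheme \<Rightarrow> bool" where
  "finite_p_group p P \<longleftrightarrow> group P \<and> finite (carrier P) \<and> (\<exists>n. order P = p ^ n)"

definition sylow_subgroup :: "nat \<Rightarrow> ('a, 'm) monoid_scheme \<Rightarrow> 'a set \<Rightarrow> bool" where
  "sylow_subgroup p G H \<longleftrightarrow> subgroup H G \<and> card H = p ^ multiplicity p (order G)"

definition op_group :: "'a monoid \<Rightarrow> 'a monoid" where
  "op_group G = \<lparr>carrier = carrier G, monoid.mult = (\<lambda>x y. y \<otimes>\<^bsub>G\<^esub> x), one = \<one>\<^bsub>G\<^esub>\<rparr>"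

abbreviation trivial_grp :: "unit monoid" where
  "trivial_grp \<equiv> singleton_group ()"

text \<open>The Moebius function of a finite family \<open>S\<close> of finite sets, ordered by inclusion.\<close>

function moebius :: "'a set set \<Rightarrow> 'a set \<Rightarrow> 'a set \<Rightarrow> int" where
  "moebius S A B =
     (if A = B then 1
      else if A \<subset> B \<and> finite B then - (\<Sum>C \<in> {C \<in> S. A \<subseteq> C \<and> C \<subset> B}. moebius S A C)
      else 0)"
  by pat_completeness auto
termination
  by (relation "measure (\<lambda>(S, A, B). card B)") (auto intro: psubset_card_mono)

declare moebius.simps [simp del]


section \<open>Bisets\<close>

record ('h, 'g, 'x) biset =
  pts :: "'x set"
  lact :: "'h \<Rightarrow> 'x \<Rightarrow> 'x"
  ract :: "'x \<Rightarrow> 'g \<Rightarrow> 'x"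

definition is_biset :: "'h monoid \<Rightarrow> 'g monoid \<Rightarrow> ('h, 'g, 'x) biset \<Rightarrow> bool" where
  "is_biset H G U \<longleftrightarrow>
     (\<forall>h \<in> carrier H. \<forall>x \<in> pts U. lact U h x \<in> pts U) \<and>
     (\<forall>x \<in> pts U. \<forall>g \<in> carrier G. ract U x g \<in> pts U) \<and>
     (\<forall>x \<in> pts U. lact U \<one>\<^bsub>H\<^esub> x = x) \<and>
     (\<forall>x \<in> pts U. ract U x \<one>\<^bsub>G\<^esub> = x) \<and>
     (\<forall>h \<in> carrier H. \<forall>k \<in> carrier H. \<forall>x \<in> pts U.
        lact U (h \<otimes>\<^bsub>H\<^esub> k) x = lact U h (lact U k x)) \<and>
     (\<forall>x \<in> pts U. \<forall>g \<in> carrier G. \<forall>k \<in> carrier G.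
        ract U x (g \<otimes>\<^bsub>G\<^esub> k) = ract U (ract U x g) k) \<and>
     (\<forall>h \<in> carrier H. \<forall>x \<in> pts U. \<forall>g \<in> carrier G.
        ract U (lact U h x) g = lact U h (ract U x g))"

definition biset_iso ::
  "'h monoid \<Rightarrow> 'g monoid \<Rightarrow> ('h, 'g, 'x) biset \<Rightarrow> ('h, 'g, 'y) biset \<Rightarrow> bool" where
  "biset_iso H G U V \<longleftrightarrow> (\<exists>f. bij_betw f (pts U) (pts V) \<and>
     (\<forall>h \<in> carrier H. \<forall>x \<in> pts U. f (lact U h x) = lact V h (f x)) \<and>
     (\<forall>x \<in> pts U. \<forall>g \<in> carrier G. f (ract U x g) = ract V (f x) g))"

definition biset_union ::
  "('h, 'g, 'x) biset \<Rightarrow> ('h, 'g, 'y) biset \<Rightarrow> ('h, 'g, 'x + 'y) biset" where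
  "biset_union U V =
     \<lparr>pts = pts U <+> pts V,
      lact = (\<lambda>h. map_sum (lact U h) (lact V h)),
      ract = (\<lambda>x g. map_sum (\<lambda>u. ract U u g) (\<lambda>v. ract V v g) x)\<rparr>"

text \<open>\<open>biset_tensor H V U\<close> is \<open>V \<times>\<^sub>H U\<close>: the quotient of \<open>V \<times> U\<close> identifying
  \<open>(v, h u)\<close> with \<open>(v h, u)\<close> for \<open>h\<close> in \<open>H\<close>.\<close>

definition biset_tensor ::
  "'h monoid \<Rightarrow> ('k, 'h, 'y) biset \<Rightarrow> ('h, 'g, 'x) biset \<Rightarrow> ('k, 'g, ('y \<times> 'x) set) biset" where
  "biset_tensor H V U =
     \<lparr>pts = (pts V \<times> pts U) //
        {((v, lact U h u), (ract V v h, u)) | v h u. v \<in> pts V \<and> h \<in> carrier H \<and> u \<in> pts U},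
      lact = (\<lambda>k C. (\<lambda>(v, u). (lact V k v, u)) ` C),
      ract = (\<lambda>C g. (\<lambda>(v, u). (v, ract U u g)) ` C)\<rparr>"

definition identity_biset :: "'a monoid \<Rightarrow> ('a, 'a, 'a) biset" where
  "identity_biset G = \<lparr>pts = carrier G, lact = (\<lambda>g x. g \<otimes>\<^bsub>G\<^esub> x), ract = (\<lambda>x g. x \<otimes>\<^bsub>G\<^esub> g)\<rparr>"

definition quotient_biset :: "'a monoid \<Rightarrow> 'a set \<Rightarrow> ('a, 'a, 'a set) biset" where
  "quotient_biset G M =
     \<lparr>pts = rcosets\<^bsub>G\<^esub> M, lact = (\<lambda>g C. g <#\<^bsub>G\<^esub> C), ract = (\<lambda>C g. C #>\<^bsub>G\<^esub> g)\<rparr>"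

text \<open>A \<open>(Q,P)\<close>-biset viewed as a left \<open>Q \<times> P\<^sup>o\<^sup>p\<close>-set.\<close>

definition biset_to_left :: "('q, 'p, 'x) biset \<Rightarrow> ('q \<times> 'p, unit, 'x) biset" where
  "biset_to_left U =
     \<lparr>pts = pts U, lact = (\<lambda>(q, g) x. lact U q (ract U x g)), ract = (\<lambda>x _. x)\<rparr>"


section \<open>The Burnside groups \<open>B(H,G)\<close>\<close>

text \<open>Every finite biset is isomorphic to one whose points are natural numbers, so these
  suffice as generators.\<close>

definition nat_copy :: "('h, 'g, 'x) biset \<Rightarrow> ('h, 'g, nat) biset" where
  "nat_copy U = (let f = to_nat_on (pts U); r = inv_into (pts U) f in
     \<lparr>pts = f ` pts U,
      lact = (\<lambda>h n. f (lact U h (r n))),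
      ract = (\<lambda>n g. f (ract U (r n) g))\<rparr>)"

definition nat_bisets :: "'h monoid \<Rightarrow> 'g monoid \<Rightarrow> ('h, 'g, nat) biset set" where
  "nat_bisets H G = {U. is_biset H G U \<and> finite (pts U)}"

type_synonym ('h, 'g) biset_frag = "('h, 'g, nat) biset \<Rightarrow>\<^sub>0 int"

text \<open>With \<open>V\<close> empty, the relations below also identify isomorphic bisets.\<close>

definition burnside_rels :: "'h monoid \<Rightarrow> 'g monoid \<Rightarrow> ('h, 'g) biset_frag set" where
  "burnside_rels H G = generate (free_Abelian_group (nat_bisets H G))
     {frag_of W - (frag_of U + frag_of V) | W U V.
        W \<in> nat_bisets H G \<and> U \<in> nat_bisets H G \<and> V \<in> nat_bisets H G \<and>
        biset_iso H G W (biset_union U V)}"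

text \<open>All abelian groups below are written multiplicatively, following \<open>HOL-Algebra\<close>.\<close>

definition burnside :: "'h monoid \<Rightarrow> 'g monoid \<Rightarrow> ('h, 'g) biset_frag set monoid" where
  "burnside H G = free_Abelian_group (nat_bisets H G) Mod burnside_rels H G"

definition frag_class ::
  "'h monoid \<Rightarrow> 'g monoid \<Rightarrow> ('h, 'g) biset_frag \<Rightarrow> ('h, 'g) biset_frag set" where
  "frag_class H G x = burnside_rels H G #>\<^bsub>free_Abelian_group (nat_bisets H G)\<^esub> x"

definition biset_class ::
  "'h monoid \<Rightarrow> 'g monoid \<Rightarrow> ('h, 'g, 'x) biset \<Rightarrow> ('h, 'g) biset_frag set" where
  "biset_class H G U = frag_class H G (frag_of (nat_copy U))"

text \<open>\<open>burnside_comp K H G\<close> is the composition \<open>B(K,H) \<times> B(H,G) \<rightarrow> B(K,G)\<close>.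
  As with \<open>rcoset_mult\<close>, an operation on classes is the union over all
  representatives; being independent of the representatives, it is a single class.\<close>

definition burnside_comp ::
  "'k monoid \<Rightarrow> 'h monoid \<Rightarrow> 'g monoid \<Rightarrow>
   ('k, 'h) biset_frag set \<Rightarrow> ('h, 'g) biset_frag set \<Rightarrow> ('k, 'g) biset_frag set" where
  "burnside_comp K H G b a = (\<Union>y \<in> b. \<Union>x \<in> a. frag_class K G
     (frag_extend (\<lambda>V. frag_extend (\<lambda>U. frag_of (nat_copy (biset_tensor H V U))) x) y))"

definition burnside_to_left ::
  "'q monoid \<Rightarrow> 'p monoid \<Rightarrow> ('q, 'p) biset_frag set \<Rightarrow> ('q \<times> 'p, unit) biset_frag set" where
  "burnside_to_left Q P a = (\<Union>x \<in> a. frag_class (Q \<times>\<times> op_group P) trivial_grp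
     (frag_extend (\<lambda>U. frag_of (biset_to_left U)) x))"


section \<open>The projective plane over the prime field and the element \<open>\<delta>\<close>\<close>

type_synonym vec3 = "nat \<Rightarrow> int"

abbreviation Fp :: "nat \<Rightarrow> int ring" where
  "Fp p \<equiv> residue_ring (int p)"

definition vspace :: "nat \<Rightarrow> vec3 set" where
  "vspace p = {..<3} \<rightarrow>\<^sub>E carrier (Fp p)"

definition vzero :: "nat \<Rightarrow> vec3" where
  "vzero p = (\<lambda>i \<in> {..<3}. \<zero>\<^bsub>Fp p\<^esub>)"

definition vadd :: "nat \<Rightarrow> vec3 \<Rightarrow> vec3 \<Rightarrow> vec3" where
  "vadd p v w = (\<lambda>i \<in> {..<3}. v i \<oplus>\<^bsub>Fp p\<^esub> w i)"

definition vscale :: "nat \<Rightarrow> int \<Rightarrow> vec3 \<Rightarrow> vec3" where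
  "vscale p c v = (\<lambda>i \<in> {..<3}. c \<otimes>\<^bsub>Fp p\<^esub> v i)"

definition GL3 :: "nat \<Rightarrow> (vec3 \<Rightarrow> vec3) monoid" where
  "GL3 p = (BijGroup (vspace p))
     \<lparr>carrier := {f \<in> Bij (vspace p).
        (\<forall>v \<in> vspace p. \<forall>w \<in> vspace p. f (vadd p v w) = vadd p (f v) (f w)) \<and>
        (\<forall>c \<in> carrier (Fp p). \<forall>v \<in> vspace p. f (vscale p c v) = vscale p c (f v))}\<rparr>"

definition scalars3 :: "nat \<Rightarrow> (vec3 \<Rightarrow> vec3) set" where
  "scalars3 p = {(\<lambda>v \<in> vspace p. vscale p c v) | c. c \<in> carrier (Fp p) \<and> c \<noteq> \<zero>\<^bsub>Fp p\<^esub>}"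

definition PGL3 :: "nat \<Rightarrow> (vec3 \<Rightarrow> vec3) set monoid" where
  "PGL3 p = GL3 p Mod scalars3 p"

text \<open>Points and lines are the subspaces of dimension 1 and 2.\<close>

definition proj_points :: "nat \<Rightarrow> vec3 set set" where
  "proj_points p =
     {{vscale p a v | a. a \<in> carrier (Fp p)} | v. v \<in> vspace p \<and> v \<noteq> vzero p}"

definition proj_lines :: "nat \<Rightarrow> vec3 set set" where
  "proj_lines p =
     {{vadd p (vscale p a v) (vscale p b w) | a b. a \<in> carrier (Fp p) \<and> b \<in> carrier (Fp p)} | v w.
        v \<in> vspace p \<and> w \<in> vspace p \<and>
        (\<forall>a \<in> carrier (Fp p). \<forall>b \<in> carrier (Fp p).
           vadd p (vscale p a v) (vscale p b w) = vzero p \<longrightarrow> a = \<zero>\<^bsub>Fp p\<^esub> \<and> b = \<zero>\<^bsub>Fp p\<^esub>)}"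

text \<open>An element of \<open>PGL\<close> is a class \<open>A\<close> of linear maps, all of which have the same effect
  on a given subspace \<open>W\<close>.\<close>

definition proj_set :: "vec3 set set \<Rightarrow> ((vec3 \<Rightarrow> vec3) set, unit, vec3 set) biset" where
  "proj_set S = \<lparr>pts = S, lact = (\<lambda>A W. \<Union>f \<in> A. f ` W), ract = (\<lambda>W _. W)\<rparr>"

text \<open>From here on \<open>Xp\<close> is the carrier of a Sylow \<open>p\<close>-subgroup of \<open>PGL3 p\<close>.\<close>

definition sylow_grp :: "nat \<Rightarrow> (vec3 \<Rightarrow> vec3) set set \<Rightarrow> (vec3 \<Rightarrow> vec3) set monoid" where
  "sylow_grp p Xp = (PGL3 p)\<lparr>carrier := Xp\<rparr>"

definition delta ::
  "nat \<Rightarrow> (vec3 \<Rightarrow> vec3) set set \<Rightarrow> ((vec3 \<Rightarrow> vec3) set, unit) biset_frag set" where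
  "delta p Xp =
     biset_class (sylow_grp p Xp) trivial_grp (proj_set (proj_lines p))
     \<otimes>\<^bsub>burnside (sylow_grp p Xp) trivial_grp\<^esub>
     inv\<^bsub>burnside (sylow_grp p Xp) trivial_grp\<^esub>
       biset_class (sylow_grp p Xp) trivial_grp (proj_set (proj_points p))"

definition B_delta ::
  "nat \<Rightarrow> (vec3 \<Rightarrow> vec3) set set \<Rightarrow> 'a monoid \<Rightarrow> ('a, unit) biset_frag set set" where
  "B_delta p Xp G =
     {burnside_comp G (sylow_grp p Xp) trivial_grp \<phi> (delta p Xp) | \<phi>.
        \<phi> \<in> carrier (burnside G (sylow_grp p Xp))}"

text \<open>\<open>B_delta2 p Xp Q P\<close> is \<open>B\<^sub>\<delta>(Q,P)\<close>, the subgroup of \<open>B(Q,P)\<close> that corresponds to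
  \<open>B\<^sub>\<delta>(Q \<times> P\<^sup>o\<^sup>p)\<close>.\<close>

definition B_delta2 ::
  "nat \<Rightarrow> (vec3 \<Rightarrow> vec3) set set \<Rightarrow> 'q monoid \<Rightarrow> 'p monoid \<Rightarrow> ('q, 'p) biset_frag set set" where
  "B_delta2 p Xp Q P =
     {a \<in> carrier (burnside Q P). burnside_to_left Q P a \<in> B_delta p Xp (Q \<times>\<times> op_group P)}"


section \<open>The category \<open>\<R>\<^sub>p\<^sup>\<sharp>\<close>\<close>

type_synonym ('q, 'p) sharp = "('q, 'p) biset_frag set set"

definition sharp_hom ::
  "nat \<Rightarrow> (vec3 \<Rightarrow> vec3) set set \<Rightarrow> 'p monoid \<Rightarrow> 'q monoid \<Rightarrow> ('q, 'p) sharp monoid" where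
  "sharp_hom p Xp P Q = burnside Q P Mod B_delta2 p Xp Q P"

definition sharp_class ::
  "nat \<Rightarrow> (vec3 \<Rightarrow> vec3) set set \<Rightarrow> 'p monoid \<Rightarrow> 'q monoid \<Rightarrow>
   ('q, 'p) biset_frag set \<Rightarrow> ('q, 'p) sharp" where
  "sharp_class p Xp P Q a = B_delta2 p Xp Q P #>\<^bsub>burnside Q P\<^esub> a"

text \<open>\<open>sharp_comp p Xp P Q R \<beta> \<alpha>\<close> is \<open>\<beta> \<circ> \<alpha>\<close> for \<open>\<alpha> : P \<rightarrow> Q\<close> and \<open>\<beta> : Q \<rightarrow> R\<close>.\<close>

definition sharp_comp ::
  "nat \<Rightarrow> (vec3 \<Rightarrow> vec3) set set \<Rightarrow> 'p monoid \<Rightarrow> 'q monoid \<Rightarrow> 'r monoid \<Rightarrow>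
   ('r, 'q) sharp \<Rightarrow> ('q, 'p) sharp \<Rightarrow> ('r, 'p) sharp" where
  "sharp_comp p Xp P Q R \<beta> \<alpha> =
     (\<Union>b \<in> \<beta>. \<Union>a \<in> \<alpha>. sharp_class p Xp P R (burnside_comp R Q P b a))"

definition sharp_id :: "nat \<Rightarrow> (vec3 \<Rightarrow> vec3) set set \<Rightarrow> 'p monoid \<Rightarrow> ('p, 'p) sharp" where
  "sharp_id p Xp P = sharp_class p Xp P P (biset_class P P (identity_biset P))"


section \<open>The Roquette category\<close>

text \<open>An object is a formal direct sum of pairs \<open>(grp A i, idem A i)\<close> over a finite index set.
  Objects whose groups live in different types are compared by polymorphic notions of morphism
  and isomorphism, as for \<open>is_iso\<close> on groups.\<close>

record ('i, 'a) roquette_obj =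
  idx :: "'i set"
  grp :: "'i \<Rightarrow> 'a monoid"
  idem :: "'i \<Rightarrow> ('a, 'a) sharp"

definition is_roquette_obj ::
  "nat \<Rightarrow> (vec3 \<Rightarrow> vec3) set set \<Rightarrow> ('i, 'a) roquette_obj \<Rightarrow> bool" where
  "is_roquette_obj p Xp A \<longleftrightarrow> finite (idx A) \<and>
     (\<forall>i \<in> idx A. finite_p_group p (grp A i) \<and>
        idem A i \<in> carrier (sharp_hom p Xp (grp A i) (grp A i)) \<and>
        sharp_comp p Xp (grp A i) (grp A i) (grp A i) (idem A i) (idem A i) = idem A i)"

text \<open>A morphism \<open>A \<rightarrow> B\<close> is a matrix indexed by \<open>idx B \<times> idx A\<close> (target index first).\<close>

type_synonym ('i, 'a, 'j, 'b) roquette_mor = "'j \<times> 'i \<Rightarrow> ('b, 'a) sharp"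

definition roquette_hom ::
  "nat \<Rightarrow> (vec3 \<Rightarrow> vec3) set set \<Rightarrow> ('i, 'a) roquette_obj \<Rightarrow> ('j, 'b) roquette_obj \<Rightarrow>
   ('i, 'a, 'j, 'b) roquette_mor set" where
  "roquette_hom p Xp A B =
     (\<Pi>\<^sub>E (j, i) \<in> idx B \<times> idx A.
        {sharp_comp p Xp (grp A i) (grp B j) (grp B j) (idem B j)
           (sharp_comp p Xp (grp A i) (grp A i) (grp B j) \<phi> (idem A i)) | \<phi>.
         \<phi> \<in> carrier (sharp_hom p Xp (grp A i) (grp B j))})"

definition roquette_comp ::
  "nat \<Rightarrow> (vec3 \<Rightarrow> vec3) set set \<Rightarrow>
   ('i, 'a) roquette_obj \<Rightarrow> ('j, 'b) roquette_obj \<Rightarrow> ('k, 'c) roquette_obj \<Rightarrow>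
   ('j, 'b, 'k, 'c) roquette_mor \<Rightarrow> ('i, 'a, 'j, 'b) roquette_mor \<Rightarrow>
   ('i, 'a, 'k, 'c) roquette_mor" where
  "roquette_comp p Xp A B C N M =
     (\<lambda>(k, i) \<in> idx C \<times> idx A.
        finprod (sharp_hom p Xp (grp A i) (grp C k))
          (\<lambda>j. sharp_comp p Xp (grp A i) (grp B j) (grp C k) (N (k, j)) (M (j, i))) (idx B))"

definition roquette_id ::
  "nat \<Rightarrow> (vec3 \<Rightarrow> vec3) set set \<Rightarrow> ('i, 'a) roquette_obj \<Rightarrow> ('i, 'a, 'i, 'a) roquette_mor" where
  "roquette_id p Xp A =
     (\<lambda>(j, i) \<in> idx A \<times> idx A.
        if j = i then idem A i else \<one>\<^bsub>sharp_hom p Xp (grp A i) (grp A j)\<^esub>)"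

definition roquette_iso ::
  "nat \<Rightarrow> (vec3 \<Rightarrow> vec3) set set \<Rightarrow> ('i, 'a) roquette_obj \<Rightarrow> ('j, 'b) roquette_obj \<Rightarrow> bool" where
  "roquette_iso p Xp A B \<longleftrightarrow> is_roquette_obj p Xp A \<and> is_roquette_obj p Xp B \<and>
     (\<exists>M \<in> roquette_hom p Xp A B. \<exists>N \<in> roquette_hom p Xp B A.
        roquette_comp p Xp A B A N M = roquette_id p Xp A \<and>
        roquette_comp p Xp B A B M N = roquette_id p Xp B)"

definition roquette_pair :: "'a monoid \<Rightarrow> ('a, 'a) sharp \<Rightarrow> (unit, 'a) roquette_obj" where
  "roquette_pair P e = \<lparr>idx = {()}, grp = (\<lambda>_. P), idem = (\<lambda>_. e)\<rparr>"

definition roquette_grp ::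
  "nat \<Rightarrow> (vec3 \<Rightarrow> vec3) set set \<Rightarrow> 'a monoid \<Rightarrow> (unit, 'a) roquette_obj" where
  "roquette_grp p Xp P = roquette_pair P (sharp_id p Xp P)"

definition roquette_sum ::
  "'s set \<Rightarrow> ('s \<Rightarrow> ('i, 'a) roquette_obj) \<Rightarrow> ('s \<times> 'i, 'a) roquette_obj" where
  "roquette_sum S A =
     \<lparr>idx = (SIGMA s : S. idx (A s)),
      grp = (\<lambda>(s, i). grp (A s) i),
      idem = (\<lambda>(s, i). idem (A s) i)\<rparr>"


section \<open>Edges\<close>

definition f_one :: "'a monoid \<Rightarrow> ('a, 'a) biset_frag set" where
  "f_one P = finprod (burnside P P)
     (\<lambda>M. biset_class P P (quotient_biset P M) [^]\<^bsub>burnside P P\<^esub> moebius {N. N \<lhd> P} {\<one>\<^bsub>P\<^esub>} M)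
     {M. M \<lhd> P}"

definition edge ::
  "nat \<Rightarrow> (vec3 \<Rightarrow> vec3) set set \<Rightarrow> 'a monoid \<Rightarrow> (unit, 'a) roquette_obj" where
  "edge p Xp P = roquette_pair P (sharp_class p Xp P P (f_one P))"

end

theory Submission
  imports Defs
begin

text \<open>
  Already in the Burnside groups, \<open>P\<close> is the sum of the edges of its quotients. The bisets
  \<open>e\<^sub>M = [P/M]\<close> satisfy \<open>e\<^sub>K \<circ> e\<^sub>M = e\<^sub>K\<^sub>M\<close>, so Weisner's theorem gives \<open>f\<^sub>\<one> \<circ> e\<^sub>M = 0 = e\<^sub>M \<circ> f\<^sub>\<one>\<close>
  for \<open>M \<noteq> \<one>\<close>, and hence \<open>f\<^sub>\<one> \<circ> f\<^sub>\<one> = f\<^sub>\<one>\<close>. The isomorphism has the entries \<open>f\<^sub>\<one> \<circ> Def : P \<rightarrow> P/N\<close>, and its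
  inverse the entries \<open>Inf \<circ> f\<^sub>\<one> : P/N \<rightarrow> P\<close>. The products \<open>f\<^sub>\<one> \<circ> Def \<circ> Inf \<circ> f\<^sub>\<one>\<close> from \<open>P/N\<close> to \<open>P/N'\<close> vanish
  for \<open>N \<noteq> N'\<close>: if \<open>N'\<close> is not contained in \<open>N\<close>, then the deflation to \<open>P/N'\<close> absorbs \<open>e\<^sub>N\<^sub>'\<close>, which
  passes through the inflation to a nontrivial \<open>e\<close> of \<open>P/N\<close> and is killed by \<open>f\<^sub>\<one>\<close>; the other case
  is symmetric. In \<open>\<Sum>\<^sub>N Inf \<circ> f\<^sub>\<one> \<circ> Def\<close> the coefficient of \<open>e\<^sub>K\<close> is \<open>\<Sum>\<^sub>N \<mu>(N, K)\<close> over \<open>N \<subseteq> K\<close>, which is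
  nonzero for \<open>K = \<one>\<close> only, so that the sum is \<open>e\<^sub>\<one> = Id\<close>. All this passes to the quotient by
  \<open>B\<^sub>\<delta>\<close>, because \<open>B\<^sub>\<delta>(Q, P)\<close> is a two-sided ideal.
\<close>

section \<open>Bisets and their tensor products\<close>

text \<open>\<open>burnside_comp\<close> and \<open>sharp_comp\<close> are unions over all
  representatives, so no product can be evaluated before its independence of the representatives is
  known. Computations are therefore made with fragments modulo \<open>frag_eq\<close> and carried
  over to the category only at the end. Likewise \<open>tensor_map\<close> characterises
  \<open>V \<times>\<^sub>H U\<close> up to isomorphism, so that any convenient model of a product
  may replace the quotient set. For \<open>e\<^sub>M\<close>, inflation and deflation this model is
  a group on which two groups act through homomorphisms, and one criterion on kernels gives all
  product formulas among them. The ideal property rests on reading \<open>B(Q, P)\<close> as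
  \<open>B(Q \<times> P\<^sup>o\<^sup>p)\<close>: composition from either side becomes composition
  from the left, and the form \<open>\<phi> \<circ> \<delta>\<close> survives that. The recursion
  for \<mu> controls sums over the upper argument, while the final coefficient is a sum over the
  lower one, with terms computed in different quotients \<open>P/N\<close>. The correspondence
  theorem puts these terms into one matrix, and this matrix is a right inverse of the zeta function,
  hence also a left inverse.\<close>

lemma is_bisetI:
  assumes "\<And>h x. h \<in> carrier H \<Longrightarrow> x \<in> pts U \<Longrightarrow> lact U h x \<in> pts U"
    and "\<And>x g. x \<in> pts U \<Longrightarrow> g \<in> carrier G \<Longrightarrow> ract U x g \<in> pts U"
    and "\<And>x. x \<in> pts U \<Longrightarrow> lact U \<one>\<^bsub>H\<^esub> x = x"
    and "\<And>x. x \<in> pts U \<Longrightarrow> ract U x \<one>\<^bsub>G\<^esub> = x"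
    and "\<And>h k x. h \<in> carrier H \<Longrightarrow> k \<in> carrier H \<Longrightarrow> x \<in> pts U \<Longrightarrow>
           lact U (h \<otimes>\<^bsub>H\<^esub> k) x = lact U h (lact U k x)"
    and "\<And>x g k. x \<in> pts U \<Longrightarrow> g \<in> carrier G \<Longrightarrow> k \<in> carrier G \<Longrightarrow>
           ract U x (g \<otimes>\<^bsub>G\<^esub> k) = ract U (ract U x g) k"
    and "\<And>h x g. h \<in> carrier H \<Longrightarrow> x \<in> pts U \<Longrightarrow> g \<in> carrier G \<Longrightarrow>
           ract U (lact U h x) g = lact U h (ract U x g)"
  shows "is_biset H G U"
  using assms by (auto simp: is_biset_def)

lemma
  assumes "is_biset H G U"
  shows lact_closed: "\<And>h x. h \<in> carrier H \<Longrightarrow> x \<in> pts U \<Longrightarrow> lact U h x \<in> pts U"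
    and ract_closed: "\<And>x g. x \<in> pts U \<Longrightarrow> g \<in> carrier G \<Longrightarrow> ract U x g \<in> pts U"
    and lact_one: "\<And>x. x \<in> pts U \<Longrightarrow> lact U \<one>\<^bsub>H\<^esub> x = x"
    and ract_one: "\<And>x. x \<in> pts U \<Longrightarrow> ract U x \<one>\<^bsub>G\<^esub> = x"
    and lact_mult: "\<And>h k x. h \<in> carrier H \<Longrightarrow> k \<in> carrier H \<Longrightarrow> x \<in> pts U \<Longrightarrow>
           lact U (h \<otimes>\<^bsub>H\<^esub> k) x = lact U h (lact U k x)"
    and ract_mult: "\<And>x g k. x \<in> pts U \<Longrightarrow> g \<in> carrier G \<Longrightarrow> k \<in> carrier G \<Longrightarrow>
           ract U x (g \<otimes>\<^bsub>G\<^esub> k) = ract U (ract U x g) k"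
    and ract_lact: "\<And>h x g. h \<in> carrier H \<Longrightarrow> x \<in> pts U \<Longrightarrow> g \<in> carrier G \<Longrightarrow>
           ract U (lact U h x) g = lact U h (ract U x g)"
  using assms by (auto simp: is_biset_def)

text \<open>If two surjections from one set \<open>S\<close> have the same fibres, then
  \<open>f s \<mapsto> g s\<close> is a well-defined bijection. Equivariance is tested on
  parameters: the result of acting must have a common parameter \<open>t\<close> on both sides. This
  gives isomorphisms between quotients without choosing representatives.\<close>

lemma biset_isoI:
  assumes f: "f ` S = pts A" and g: "g ` S = pts B"
    and ker: "\<And>s t. s \<in> S \<Longrightarrow> t \<in> S \<Longrightarrow> f s = f t \<longleftrightarrow> g s = g t"
    and l: "\<And>h s. h \<in> carrier H \<Longrightarrow> s \<in> S \<Longrightarrow>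
              \<exists>t\<in>S. f t = lact A h (f s) \<and> g t = lact B h (g s)"
    and r: "\<And>h s. h \<in> carrier G \<Longrightarrow> s \<in> S \<Longrightarrow>
              \<exists>t\<in>S. f t = ract A (f s) h \<and> g t = ract B (g s) h"
  shows "biset_iso H G A B"
proof -
  define k where "k x = g (inv_into S f x)" for x
  have kf: "k (f s) = g s" if "s \<in> S" for s
    unfolding k_def using ker that
    by (metis f_inv_into_f imageI inv_into_into)
  have "bij_betw k (pts A) (pts B)"
    unfolding bij_betw_def inj_on_def f[symmetric] g[symmetric]
    by (auto simp: kf ker image_iff)
  moreover have "k (lact A h x) = lact B h (k x)" if "h \<in> carrier H" "x \<in> pts A" for h x
    using l[OF that(1)] that(2) kf unfolding f[symmetric] by (metis (no_types, lifting) imageE)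
  moreover have "k (ract A x h) = ract B (k x) h" if "h \<in> carrier G" "x \<in> pts A" for h x
    using r[OF that(1)] that(2) kf unfolding f[symmetric] by (metis (no_types, lifting) imageE)
  ultimately show ?thesis
    unfolding biset_iso_def by blast
qed

lemma biset_iso_refl: "biset_iso H G U U"
  unfolding biset_iso_def by (rule exI[of _ id]) auto

text \<open>The inverse map is equivariant because the actions stay inside \<open>pts U\<close>, and
  that is what \<open>is_biset H G U\<close> supplies.\<close>

lemma biset_iso_sym:
  assumes "is_biset H G U" "biset_iso H G U V"
  shows "biset_iso H G V U"
proof -
  obtain f where f: "bij_betw f (pts U) (pts V)"
    "\<And>h x. h \<in> carrier H \<Longrightarrow> x \<in> pts U \<Longrightarrow> f (lact U h x) = lact V h (f x)"
    "\<And>x g. x \<in> pts U \<Longrightarrow> g \<in> carrier G \<Longrightarrow> f (ract U x g) = ract V (f x) g"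
    using assms(2) unfolding biset_iso_def by blast
  show ?thesis
    by (rule biset_isoI[where f = f and S = "pts U" and g = "\<lambda>x. x"])
      (use f lact_closed[OF assms(1)] ract_closed[OF assms(1)] in \<open>auto simp: bij_betw_def inj_on_def\<close>)
qed

lemma biset_iso_trans:
  assumes "is_biset H G U" "biset_iso H G U V" "biset_iso H G V W"
  shows "biset_iso H G U W"
proof -
  obtain f where f: "bij_betw f (pts U) (pts V)"
    "\<And>h x. h \<in> carrier H \<Longrightarrow> x \<in> pts U \<Longrightarrow> f (lact U h x) = lact V h (f x)"
    "\<And>x g. x \<in> pts U \<Longrightarrow> g \<in> carrier G \<Longrightarrow> f (ract U x g) = ract V (f x) g"
    using assms(2) unfolding biset_iso_def by blast
  obtain f' where f': "bij_betw f' (pts V) (pts W)"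
    "\<And>h x. h \<in> carrier H \<Longrightarrow> x \<in> pts V \<Longrightarrow> f' (lact V h x) = lact W h (f' x)"
    "\<And>x g. x \<in> pts V \<Longrightarrow> g \<in> carrier G \<Longrightarrow> f' (ract V x g) = ract W (f' x) g"
    using assms(3) unfolding biset_iso_def by blast
  show ?thesis
    unfolding biset_iso_def
    by (rule exI[of _ "f' \<circ> f"]) (use f f' bij_betw_trans[OF f(1) f'(1)] bij_betwE[OF f(1)] in auto)
qed

lemma is_biset_iso:
  assumes U: "is_biset H G U" and "biset_iso H G U V" and H: "group H" and G: "group G"
  shows "is_biset H G V"
proof -
  obtain f where f: "bij_betw f (pts U) (pts V)"
    "\<And>h x. h \<in> carrier H \<Longrightarrow> x \<in> pts U \<Longrightarrow> f (lact U h x) = lact V h (f x)"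
    "\<And>x g. x \<in> pts U \<Longrightarrow> g \<in> carrier G \<Longrightarrow> f (ract U x g) = ract V (f x) g"
    using assms(2) unfolding biset_iso_def by blast
  have V: "pts V = f ` pts U" using f(1) by (simp add: bij_betw_def)
  note [simp] = lact_closed[OF U] ract_closed[OF U] f(2,3)[symmetric] lact_mult[OF U]
    ract_mult[OF U] lact_one[OF U] ract_one[OF U] ract_lact[OF U]
    monoid.m_closed[OF group.is_monoid[OF H]] monoid.one_closed[OF group.is_monoid[OF H]]
    monoid.m_closed[OF group.is_monoid[OF G]] monoid.one_closed[OF group.is_monoid[OF G]]
  show ?thesis
    unfolding is_biset_def V by auto
qed

text \<open>\<open>\<phi>\<close> exhibits \<open>W\<close> as \<open>V \<times>\<^sub>H U\<close>
  without mentioning a quotient set. The last clause says that the fibres of \<open>\<phi>\<close>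
  are the orbits of \<open>H\<close> under \<open>(v, u) h = (v h, h\<^sup>-\<^sup>1 u)\<close>,
  written so that no inverse occurs.\<close>

definition tensor_map ::
  "'k monoid \<Rightarrow> 'h monoid \<Rightarrow> 'g monoid \<Rightarrow> ('k, 'h, 'y) biset \<Rightarrow> ('h, 'g, 'x) biset \<Rightarrow>
   ('k, 'g, 'z) biset \<Rightarrow> ('y \<Rightarrow> 'x \<Rightarrow> 'z) \<Rightarrow> bool" where
  "tensor_map K H G V U W \<phi> \<longleftrightarrow>
     (\<forall>v \<in> pts V. \<forall>u \<in> pts U. \<phi> v u \<in> pts W) \<and>
     (\<forall>w \<in> pts W. \<exists>v \<in> pts V. \<exists>u \<in> pts U. w = \<phi> v u) \<and>
     (\<forall>k \<in> carrier K. \<forall>v \<in> pts V. \<forall>u \<in> pts U. \<phi> (lact V k v) u = lact W k (\<phi> v u)) \<and>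
     (\<forall>v \<in> pts V. \<forall>u \<in> pts U. \<forall>g \<in> carrier G. \<phi> v (ract U u g) = ract W (\<phi> v u) g) \<and>
     (\<forall>v \<in> pts V. \<forall>u \<in> pts U. \<forall>v' \<in> pts V. \<forall>u' \<in> pts U.
        \<phi> v u = \<phi> v' u' \<longleftrightarrow> (\<exists>h \<in> carrier H. v' = ract V v h \<and> u = lact U h u'))"

definition is_tensor ::
  "'k monoid \<Rightarrow> 'h monoid \<Rightarrow> 'g monoid \<Rightarrow> ('k, 'h, 'y) biset \<Rightarrow> ('h, 'g, 'x) biset \<Rightarrow>
   ('k, 'g, 'z) biset \<Rightarrow> bool" where
  "is_tensor K H G V U W \<longleftrightarrow> (\<exists>\<phi>. tensor_map K H G V U W \<phi>)"

text \<open>The orbit clause splits: one direction is the same as being balanced, because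
  \<open>\<phi> v (h u') = \<phi> (v h) u'\<close>, and only the other has to be shown for pairs
  with equal image.\<close>

lemma tensor_mapI:
  assumes "\<And>v u. v \<in> pts V \<Longrightarrow> u \<in> pts U \<Longrightarrow> \<phi> v u \<in> pts W"
    and "\<And>w. w \<in> pts W \<Longrightarrow> \<exists>v \<in> pts V. \<exists>u \<in> pts U. w = \<phi> v u"
    and "\<And>k v u. k \<in> carrier K \<Longrightarrow> v \<in> pts V \<Longrightarrow> u \<in> pts U \<Longrightarrow>
           \<phi> (lact V k v) u = lact W k (\<phi> v u)"
    and "\<And>v u g. v \<in> pts V \<Longrightarrow> u \<in> pts U \<Longrightarrow> g \<in> carrier G \<Longrightarrow>
           \<phi> v (ract U u g) = ract W (\<phi> v u) g"
    and "\<And>v u h. v \<in> pts V \<Longrightarrow> u \<in> pts U \<Longrightarrow> h \<in> carrier H \<Longrightarrow>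
           \<phi> v (lact U h u) = \<phi> (ract V v h) u"
    and "\<And>v u v' u'. v \<in> pts V \<Longrightarrow> u \<in> pts U \<Longrightarrow> v' \<in> pts V \<Longrightarrow> u' \<in> pts U \<Longrightarrow>
           \<phi> v u = \<phi> v' u' \<Longrightarrow> \<exists>h \<in> carrier H. v' = ract V v h \<and> u = lact U h u'"
  shows "tensor_map K H G V U W \<phi>"
  unfolding tensor_map_def
  by (intro conjI ballI iffI; (elim bexE conjE)?) (use assms in metis)+

lemma
  assumes "tensor_map K H G V U W \<phi>"
  shows tensor_map_closed: "\<And>v u. v \<in> pts V \<Longrightarrow> u \<in> pts U \<Longrightarrow> \<phi> v u \<in> pts W"
    and tensor_map_surj: "\<And>w. w \<in> pts W \<Longrightarrow> \<exists>v \<in> pts V. \<exists>u \<in> pts U. w = \<phi> v u"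
    and tensor_map_lact: "\<And>k v u. k \<in> carrier K \<Longrightarrow> v \<in> pts V \<Longrightarrow> u \<in> pts U \<Longrightarrow>
           \<phi> (lact V k v) u = lact W k (\<phi> v u)"
    and tensor_map_ract: "\<And>v u g. v \<in> pts V \<Longrightarrow> u \<in> pts U \<Longrightarrow> g \<in> carrier G \<Longrightarrow>
           \<phi> v (ract U u g) = ract W (\<phi> v u) g"
    and tensor_map_eq_iff: "\<And>v u v' u'. v \<in> pts V \<Longrightarrow> u \<in> pts U \<Longrightarrow> v' \<in> pts V \<Longrightarrow> u' \<in> pts U \<Longrightarrow>
           \<phi> v u = \<phi> v' u' \<longleftrightarrow> (\<exists>h \<in> carrier H. v' = ract V v h \<and> u = lact U h u')"
  using assms unfolding tensor_map_def by blast+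

lemma tensor_map_image:
  assumes "tensor_map K H G V U W \<phi>"
  shows "case_prod \<phi> ` (pts V \<times> pts U) = pts W"
  using tensor_map_closed[OF assms] tensor_map_surj[OF assms] by (auto simp: image_iff)

lemma tensor_map_balanced:
  assumes "tensor_map K H G V U W \<phi>" "is_biset K H V" "is_biset H G U"
    "v \<in> pts V" "u \<in> pts U" "h \<in> carrier H"
  shows "\<phi> v (lact U h u) = \<phi> (ract V v h) u"
  using assms by (auto simp: tensor_map_eq_iff[OF assms(1)] lact_closed ract_closed)

lemma is_tensor_is_biset:
  assumes "is_tensor K H G V U W" and V: "is_biset K H V" and U: "is_biset H G U"
    and K: "group K" and G: "group G"
  shows "is_biset K G W"
proof -
  obtain \<phi> where t: "tensor_map K H G V U W \<phi>"
    using assms(1) by (auto simp: is_tensor_def)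
  have W: "pts W = case_prod \<phi> ` (pts V \<times> pts U)" using tensor_map_image[OF t] by simp
  note [simp] = lact_closed[OF U] ract_closed[OF U] lact_closed[OF V] ract_closed[OF V]
    tensor_map_lact[OF t, symmetric] tensor_map_ract[OF t, symmetric] lact_mult[OF V]
    ract_mult[OF U] lact_one[OF V] ract_one[OF U] tensor_map_closed[OF t]
    monoid.m_closed[OF group.is_monoid[OF K]] monoid.one_closed[OF group.is_monoid[OF K]]
    monoid.m_closed[OF group.is_monoid[OF G]] monoid.one_closed[OF group.is_monoid[OF G]]
  show ?thesis
    unfolding is_biset_def W by auto
qed

lemma is_tensor_finite:
  assumes "is_tensor K H G V U W" "finite (pts V)" "finite (pts U)"
  shows "finite (pts W)"
  using assms unfolding is_tensor_def by (metis tensor_map_image finite_imageI finite_cartesian_product)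

lemma is_tensor_iso:
  assumes "is_tensor K H G V U W" "is_biset K H V" "is_biset H G U" "biset_iso K G W W'"
  shows "is_tensor K H G V U W'"
proof -
  obtain \<phi> where t: "tensor_map K H G V U W \<phi>"
    using assms(1) by (auto simp: is_tensor_def)
  obtain f where f: "bij_betw f (pts W) (pts W')"
    "\<And>h x. h \<in> carrier K \<Longrightarrow> x \<in> pts W \<Longrightarrow> f (lact W h x) = lact W' h (f x)"
    "\<And>x g. x \<in> pts W \<Longrightarrow> g \<in> carrier G \<Longrightarrow> f (ract W x g) = ract W' (f x) g"
    using assms(4) unfolding biset_iso_def by blast
  have "tensor_map K H G V U W' (\<lambda>v u. f (\<phi> v u))"
  proof (rule tensor_mapI)
    fix w assume "w \<in> pts W'"
    then obtain w0 where "w0 \<in> pts W" "w = f w0" using f(1) by (auto simp: bij_betw_def)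
    then show "\<exists>v\<in>pts V. \<exists>u\<in>pts U. w = f (\<phi> v u)"
      using tensor_map_surj[OF t] by blast
  next
    fix v u v' u' assume *: "v \<in> pts V" "u \<in> pts U" "v' \<in> pts V" "u' \<in> pts U" "f (\<phi> v u) = f (\<phi> v' u')"
    then have "\<phi> v u = \<phi> v' u'"
      using f(1) tensor_map_closed[OF t] by (auto simp: bij_betw_def inj_on_def)
    then show "\<exists>h\<in>carrier H. v' = ract V v h \<and> u = lact U h u'"
      using * tensor_map_eq_iff[OF t] by simp
  qed (use f bij_betwE[OF f(1)] tensor_map_closed[OF t] tensor_map_lact[OF t] tensor_map_ract[OF t]
      tensor_map_balanced[OF t assms(2,3)] in auto)
  then show ?thesis by (auto simp: is_tensor_def)
qed

text \<open>Both \<open>W\<close> and \<open>W'\<close> are parametrised by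
  \<open>pts V \<times> pts U\<close>, the second one through the given isomorphisms, and in both
  cases the fibres are the orbits of \<open>H\<close>.\<close>

lemma is_tensor_unique:
  assumes "is_tensor K H G V U W" "is_tensor K H G V' U' W'"
    and V: "is_biset K H V" and U: "is_biset H G U"
    and "biset_iso K H V V'" "biset_iso H G U U'"
  shows "biset_iso K G W W'"
proof -
  obtain \<phi> where t: "tensor_map K H G V U W \<phi>"
    using assms(1) by (auto simp: is_tensor_def)
  obtain \<phi>' where t': "tensor_map K H G V' U' W' \<phi>'"
    using assms(2) by (auto simp: is_tensor_def)
  obtain f where f: "bij_betw f (pts V) (pts V')"
    "\<And>h x. h \<in> carrier K \<Longrightarrow> x \<in> pts V \<Longrightarrow> f (lact V h x) = lact V' h (f x)"
    "\<And>x g. x \<in> pts V \<Longrightarrow> g \<in> carrier H \<Longrightarrow> f (ract V x g) = ract V' (f x) g"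
    using assms(5) unfolding biset_iso_def by blast
  obtain f' where f': "bij_betw f' (pts U) (pts U')"
    "\<And>h x. h \<in> carrier H \<Longrightarrow> x \<in> pts U \<Longrightarrow> f' (lact U h x) = lact U' h (f' x)"
    "\<And>x g. x \<in> pts U \<Longrightarrow> g \<in> carrier G \<Longrightarrow> f' (ract U x g) = ract U' (f' x) g"
    using assms(6) unfolding biset_iso_def by blast
  note [simp] = bij_betwE[OF f(1), rule_format] bij_betwE[OF f'(1), rule_format]
    lact_closed[OF U] ract_closed[OF U] lact_closed[OF V] ract_closed[OF V]
  show ?thesis
  proof (rule biset_isoI[where f = "\<lambda>(v, u). \<phi> v u" and S = "pts V \<times> pts U"
        and g = "\<lambda>(v, u). \<phi>' (f v) (f' u)"], goal_cases)
    case 1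
    show ?case by (rule tensor_map_image[OF t])
  next
    case 2
    have "(\<lambda>(v, u). \<phi>' (f v) (f' u)) ` (pts V \<times> pts U) = case_prod \<phi>' ` (f ` pts V \<times> f' ` pts U)"
      by (force simp: image_iff)
    also have "\<dots> = pts W'"
      using f(1) f'(1) tensor_map_image[OF t'] by (simp add: bij_betw_def)
    finally show ?case .
  next
    case (3 s s')
    moreover have "f x = f y \<longleftrightarrow> x = y" if "x \<in> pts V" "y \<in> pts V" for x y
      using f(1) that by (auto simp: bij_betw_def inj_on_def)
    moreover have "f' x = f' y \<longleftrightarrow> x = y" if "x \<in> pts U" "y \<in> pts U" for x y
      using f'(1) that by (auto simp: bij_betw_def inj_on_def)
    ultimately show ?case
      by (auto simp: tensor_map_eq_iff[OF t] tensor_map_eq_iff[OF t'] f(3)[symmetric] f'(2)[symmetric])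
  next
    case (4 h s)
    then show ?case
      by (intro bexI[of _ "(lact V h (fst s), snd s)"])
        (auto simp: tensor_map_lact[OF t] tensor_map_lact[OF t'] f)
  next
    case (5 h s)
    then show ?case
      by (intro bexI[of _ "(fst s, ract U (snd s) h)"])
        (auto simp: tensor_map_ract[OF t] tensor_map_ract[OF t'] f')
  qed
qed

text \<open>Both iterated products are parametrised by triples \<open>(w, v, u)\<close>, and both
  have as fibres the orbits of \<open>K\<close> and \<open>H\<close> acting at the two junctions.
  The inner products \<open>T\<close> and \<open>T'\<close> may be arbitrary models.\<close>

lemma is_tensor_assoc:
  assumes WV: "is_tensor L K H W V T" and VU: "is_tensor K H G V U T'"
    and A: "is_tensor L H G T U A" and B: "is_tensor L K G W T' B"
    and W: "is_biset L K W" and V: "is_biset K H V" and U: "is_biset H G U"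
    and K: "group K" and H: "group H"
  shows "biset_iso L G A B"
proof -
  obtain \<alpha> where a: "tensor_map L K H W V T \<alpha>" using WV by (auto simp: is_tensor_def)
  obtain \<beta> where b: "tensor_map K H G V U T' \<beta>" using VU by (auto simp: is_tensor_def)
  obtain \<phi> where f: "tensor_map L H G T U A \<phi>" using A by (auto simp: is_tensor_def)
  obtain \<psi> where g: "tensor_map L K G W T' B \<psi>" using B by (auto simp: is_tensor_def)
  let ?S = "pts W \<times> pts V \<times> pts U"
  note [simp] = lact_closed[OF U] ract_closed[OF U] lact_closed[OF V] ract_closed[OF V]
    lact_closed[OF W] ract_closed[OF W]
    tensor_map_closed[OF a] tensor_map_closed[OF b] tensor_map_closed[OF f] tensor_map_closed[OF g]
  show ?thesis
  proof (rule biset_isoI[where S = ?S and f = "\<lambda>(w, v, u). \<phi> (\<alpha> w v) u"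
        and g = "\<lambda>(w, v, u). \<psi> w (\<beta> v u)"], goal_cases)
    case 1
    show ?case
      using tensor_map_surj[OF f] tensor_map_surj[OF a] by (auto simp: image_iff) metis
  next
    case 2
    show ?case
      using tensor_map_surj[OF g] tensor_map_surj[OF b] by (auto simp: image_iff) metis
  next
    case (3 s t)
    moreover obtain w v u where s: "s = (w, v, u)" by (cases s)
    moreover obtain w' v' u' where t: "t = (w', v', u')" by (cases t)
    ultimately have mem: "w \<in> pts W" "v \<in> pts V" "u \<in> pts U" "w' \<in> pts W" "v' \<in> pts V" "u' \<in> pts U"
      by auto
    have "\<phi> (\<alpha> w v) u = \<phi> (\<alpha> w' v') u' \<longleftrightarrow>
      (\<exists>h\<in>carrier H. \<alpha> w' v' = \<alpha> w (ract V v h) \<and> u = lact U h u')"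
      using mem by (auto simp: tensor_map_eq_iff[OF f] tensor_map_ract[OF a])
    also have "\<dots> \<longleftrightarrow> (\<exists>h\<in>carrier H. (\<exists>k\<in>carrier K. w' = ract W w k \<and> ract V v h = lact V k v')
      \<and> u = lact U h u')"
      using mem by (metis tensor_map_eq_iff[OF a] ract_closed[OF V])
    \<comment> \<open>Associativity proper: the left bracketing asks for \<open>h\<close> first and
      then for \<open>k\<close>, the right one for \<open>k\<close> first, and the two quantifiers
      commute.\<close>
    also have "\<dots> \<longleftrightarrow> (\<exists>k\<in>carrier K. w' = ract W w k \<and>
        (\<exists>h\<in>carrier H. lact V k v' = ract V v h \<and> u = lact U h u'))"
      by metis
    also have "\<dots> \<longleftrightarrow> (\<exists>k\<in>carrier K. w' = ract W w k \<and> \<beta> v u = \<beta> (lact V k v') u')"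
      using mem tensor_map_eq_iff[OF b] lact_closed[OF V] by (metis (no_types, lifting))
    also have "\<dots> \<longleftrightarrow> \<psi> w (\<beta> v u) = \<psi> w' (\<beta> v' u')"
      using mem by (auto simp: tensor_map_eq_iff[OF g] tensor_map_lact[OF b])
    finally show ?case
      by (simp add: s t)
  next
    case h: (4 h s)
    obtain w v u where s: "s = (w, v, u)" by (cases s)
    show ?case
      by (intro bexI[of _ "(lact W h w, v, u)"])
        (use h s in \<open>auto simp: tensor_map_lact[OF a] tensor_map_lact[OF g] tensor_map_lact[OF f]\<close>)
  next
    case h: (5 h s)
    obtain w v u where s: "s = (w, v, u)" by (cases s)
    show ?case
      by (intro bexI[of _ "(w, v, ract U u h)"])
        (use h s in \<open>auto simp: tensor_map_ract[OF b] tensor_map_ract[OF g] tensor_map_ract[OF f]\<close>)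
  qed
qed

text \<open>The relation in \<open>biset_tensor\<close> links \<open>(v, h u)\<close> to
  \<open>(v h, u)\<close> and is not closed up by definition. As \<open>H\<close> is a group, the
  set of pairs related to a given \<open>(v, u)\<close> is already its full orbit
  (\<open>cl2\<close>), so the quotient consists of the orbits.\<close>

lemma is_tensor_biset_tensor:
  assumes V: "is_biset K H V" and U: "is_biset H G U" and H: "group H"
  shows "is_tensor K H G V U (biset_tensor H V U)"
proof -
  interpret H: group H by fact
  define r where "r = {((v, lact U h u), (ract V v h, u)) | v h u.
    v \<in> pts V \<and> h \<in> carrier H \<and> u \<in> pts U}"
  define cl where "cl v u = r `` {(v, u)}" for v u
  have cl: "cl v u = {(ract V v h, u') | h u'. h \<in> carrier H \<and> u' \<in> pts U \<and> u = lact U h u'}"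
    if "v \<in> pts V" for v u
    using that by (auto simp: cl_def r_def)
  have inv: "u = lact U h u' \<longleftrightarrow> u' = lact U (inv\<^bsub>H\<^esub> h) u"
    if "u \<in> pts U" "u' \<in> pts U" "h \<in> carrier H" for u u' h
    using that lact_mult[OF U, symmetric] lact_one[OF U] by auto
  have cl2: "cl v u = (\<lambda>h. (ract V v h, lact U (inv\<^bsub>H\<^esub> h) u)) ` carrier H"
    if "v \<in> pts V" "u \<in> pts U" for v u
  proof -
    have "(h \<in> carrier H \<and> u' \<in> pts U \<and> u = lact U h u') \<longleftrightarrow>
      (h \<in> carrier H \<and> u' = lact U (inv\<^bsub>H\<^esub> h) u)" for h u'
      using inv[OF that(2)] that(2) lact_closed[OF U, of "inv\<^bsub>H\<^esub> h" u] H.inv_closed by metis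
    then show ?thesis
      unfolding cl[OF that(1)] by auto
  qed
  have self: "(v, u) \<in> cl v u" if "v \<in> pts V" "u \<in> pts U" for v u
    unfolding cl2[OF that] image_iff using that lact_one[OF U] ract_one[OF V]
    by (intro bexI[of _ "\<one>\<^bsub>H\<^esub>"]) auto
  have bal: "cl v (lact U h u) = cl (ract V v h) u"
    if "v \<in> pts V" "u \<in> pts U" "h \<in> carrier H" for v u h
  proof -
    have "cl v (lact U h u) = (\<lambda>x. (ract V v x, lact U (inv\<^bsub>H\<^esub> x) (lact U h u))) ` carrier H"
      using that by (simp add: cl2 lact_closed[OF U])
    \<comment> \<open>The substitution \<open>x = h y\<close> runs through the same orbit and moves
      \<open>h\<close> from the right factor to the left one.\<close>
    also have "carrier H = (\<lambda>y. h \<otimes>\<^bsub>H\<^esub> y) ` carrier H"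
      using H.surj_const_mult that(3) by simp
    also have "(\<lambda>x. (ract V v x, lact U (inv\<^bsub>H\<^esub> x) (lact U h u))) ` \<dots> =
      (\<lambda>x. (ract V (ract V v h) x, lact U (inv\<^bsub>H\<^esub> x) u)) ` carrier H"
      unfolding image_image
      by (rule image_cong[OF refl]) (use that in \<open>simp add: ract_mult[OF V] H.inv_mult_group
        lact_mult[OF U, symmetric] H.m_assoc\<close>)
    also have "\<dots> = cl (ract V v h) u"
      using that by (simp add: cl2 ract_closed[OF V])
    finally show ?thesis .
  qed
  have pts: "pts (biset_tensor H V U) = (pts V \<times> pts U) // r"
    by (simp add: biset_tensor_def r_def)
  have "tensor_map K H G V U (biset_tensor H V U) cl"
  proof (rule tensor_mapI)
    fix v u assume "v \<in> pts V" "u \<in> pts U"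
    then show "cl v u \<in> pts (biset_tensor H V U)"
      unfolding pts cl_def by (auto intro: quotientI)
  next
    fix w assume "w \<in> pts (biset_tensor H V U)"
    then show "\<exists>v\<in>pts V. \<exists>u\<in>pts U. w = cl v u"
      unfolding pts cl_def by (auto elim!: quotientE)
  next
    fix k v u assume "k \<in> carrier K" "v \<in> pts V" "u \<in> pts U"
    then show "cl (lact V k v) u = lact (biset_tensor H V U) k (cl v u)"
      by (simp add: biset_tensor_def cl2 lact_closed[OF V] image_image ract_lact[OF V])
  next
    fix g v u assume "g \<in> carrier G" "v \<in> pts V" "u \<in> pts U"
    then show "cl v (ract U u g) = ract (biset_tensor H V U) (cl v u) g"
      by (simp add: biset_tensor_def cl2 ract_closed[OF U] image_image ract_lact[OF U])
  next
    fix v u v' u' assume *: "v \<in> pts V" "u \<in> pts U" "v' \<in> pts V" "u' \<in> pts U" "cl v u = cl v' u'"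
    then have "(v', u') \<in> cl v u" using self[of v' u'] by simp
    then show "\<exists>h\<in>carrier H. v' = ract V v h \<and> u = lact U h u'"
      unfolding cl[OF \<open>v \<in> pts V\<close>] by blast
  qed (fact bal)
  then show ?thesis by (auto simp: is_tensor_def)
qed

lemma bex_Plus: "(\<exists>x \<in> A <+> B. P x) \<longleftrightarrow> (\<exists>a \<in> A. P (Inl a)) \<or> (\<exists>b \<in> B. P (Inr b))"
  by auto

lemma is_tensor_union_left:
  assumes "is_tensor K H G V\<^sub>1 U T\<^sub>1" "is_tensor K H G V\<^sub>2 U T\<^sub>2"
    and V: "is_biset K H V\<^sub>1" "is_biset K H V\<^sub>2" and U: "is_biset H G U"
  shows "is_tensor K H G (biset_union V\<^sub>1 V\<^sub>2) U (biset_union T\<^sub>1 T\<^sub>2)"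
proof -
  obtain \<alpha> \<beta> where a: "tensor_map K H G V\<^sub>1 U T\<^sub>1 \<alpha>" and b: "tensor_map K H G V\<^sub>2 U T\<^sub>2 \<beta>"
    using assms(1,2) by (auto simp: is_tensor_def)
  have "tensor_map K H G (biset_union V\<^sub>1 V\<^sub>2) U (biset_union T\<^sub>1 T\<^sub>2)
    (\<lambda>v u. map_sum (\<lambda>v. \<alpha> v u) (\<lambda>v. \<beta> v u) v)"
    by (rule tensor_mapI; unfold biset_union_def; simp; elim PlusE)
      (use tensor_map_surj[OF a] tensor_map_surj[OF b] in \<open>auto simp: bex_Plus tensor_map_closed[OF a]
        tensor_map_closed[OF b] tensor_map_lact[OF a] tensor_map_lact[OF b] tensor_map_ract[OF a]
        tensor_map_ract[OF b] tensor_map_balanced[OF a V(1) U] tensor_map_balanced[OF b V(2) U]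
        tensor_map_eq_iff[OF a] tensor_map_eq_iff[OF b]\<close>)
  then show ?thesis by (auto simp: is_tensor_def)
qed

lemma is_tensor_union_right:
  assumes "is_tensor K H G V U\<^sub>1 T\<^sub>1" "is_tensor K H G V U\<^sub>2 T\<^sub>2"
    and V: "is_biset K H V" and U: "is_biset H G U\<^sub>1" "is_biset H G U\<^sub>2"
  shows "is_tensor K H G V (biset_union U\<^sub>1 U\<^sub>2) (biset_union T\<^sub>1 T\<^sub>2)"
proof -
  obtain \<alpha> \<beta> where a: "tensor_map K H G V U\<^sub>1 T\<^sub>1 \<alpha>" and b: "tensor_map K H G V U\<^sub>2 T\<^sub>2 \<beta>"
    using assms(1,2) by (auto simp: is_tensor_def)
  have "tensor_map K H G V (biset_union U\<^sub>1 U\<^sub>2) (biset_union T\<^sub>1 T\<^sub>2) (\<lambda>v. map_sum (\<alpha> v) (\<beta> v))"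
    by (rule tensor_mapI; unfold biset_union_def; simp; elim PlusE)
      (use tensor_map_surj[OF a] tensor_map_surj[OF b] in \<open>auto simp: bex_Plus tensor_map_closed[OF a]
        tensor_map_closed[OF b] tensor_map_lact[OF a] tensor_map_lact[OF b] tensor_map_ract[OF a]
        tensor_map_ract[OF b] tensor_map_balanced[OF a V U(1)] tensor_map_balanced[OF b V U(2)]
        tensor_map_eq_iff[OF a] tensor_map_eq_iff[OF b]\<close>)
  then show ?thesis by (auto simp: is_tensor_def)
qed

section \<open>Burnside groups\<close>

text \<open>Unlike \<open>nat_bisets\<close>, this allows points of any type, so that cosets, group
  elements and pairs can serve as models before they are copied to natural numbers.\<close>

definition finite_biset :: "'h monoid \<Rightarrow> 'g monoid \<Rightarrow> ('h, 'g, 'x) biset \<Rightarrow> bool" where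
  "finite_biset H G U \<longleftrightarrow> is_biset H G U \<and> finite (pts U)"

lemma in_nat_bisets_iff: "U \<in> nat_bisets H G \<longleftrightarrow> finite_biset H G U"
  by (simp add: nat_bisets_def finite_biset_def)

abbreviation biset_frag :: "('h, 'g, 'x) biset \<Rightarrow> ('h, 'g) biset_frag" where
  "biset_frag U \<equiv> frag_of (nat_copy U)"

abbreviation is_frag :: "'h monoid \<Rightarrow> 'g monoid \<Rightarrow> ('h, 'g) biset_frag \<Rightarrow> bool" where
  "is_frag H G x \<equiv> Poly_Mapping.keys x \<subseteq> nat_bisets H G"

lemma biset_iso_nat_copy:
  assumes "finite (pts U)"
  shows "biset_iso H G U (nat_copy U)"
  unfolding biset_iso_def
  by (rule exI[of _ "to_nat_on (pts U)"])
    (use assms in \<open>auto simp: nat_copy_def Let_def bij_betw_def countable_finite inj_on_to_nat_on\<close>)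

lemma finite_biset_iso:
  assumes "finite_biset H G U" "biset_iso H G U V" "group H" "group G"
  shows "finite_biset H G V"
  using assms is_biset_iso[of H G U V] unfolding finite_biset_def
  by (metis biset_iso_def bij_betw_finite)

lemma finite_biset_tensor:
  assumes "is_tensor K H G V U W" "finite_biset K H V" "finite_biset H G U" "group K" "group G"
  shows "finite_biset K G W"
  using assms is_tensor_is_biset is_tensor_finite unfolding finite_biset_def by blast

lemma finite_biset_biset_tensor:
  assumes "finite_biset K H V" "finite_biset H G U" "group K" "group H" "group G"
  shows "finite_biset K G (biset_tensor H V U)"
  using finite_biset_tensor[OF is_tensor_biset_tensor] assms unfolding finite_biset_def by blast

lemma nat_copy_in_nat_bisets:
  assumes "finite_biset H G U" "group H" "group G"
  shows "nat_copy U \<in> nat_bisets H G"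
  using assms finite_biset_iso[OF assms(1) biset_iso_nat_copy]
  by (simp add: in_nat_bisets_iff finite_biset_def)

lemma
  assumes V: "finite_biset K H V" and U: "finite_biset H G U" and grp: "group K" "group H" "group G"
  shows nat_copy_tensor_finite: "finite_biset K G (nat_copy (biset_tensor H V U))"
    and is_tensor_nat_copy: "is_tensor K H G V U (nat_copy (biset_tensor H V U))"
proof -
  have T: "finite_biset K G (biset_tensor H V U)"
    by (intro finite_biset_biset_tensor V U grp)
  show "finite_biset K G (nat_copy (biset_tensor H V U))"
    using nat_copy_in_nat_bisets[OF T grp(1,3)] by (simp add: in_nat_bisets_iff)
  show "is_tensor K H G V U (nat_copy (biset_tensor H V U))"
    using V U T grp by (intro is_tensor_iso[OF is_tensor_biset_tensor] biset_iso_nat_copy)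
      (auto simp: finite_biset_def)
qed

lemma
  shows burnside_rels_zero: "0 \<in> burnside_rels H G"
    and burnside_rels_add: "x \<in> burnside_rels H G \<Longrightarrow> y \<in> burnside_rels H G \<Longrightarrow> x + y \<in> burnside_rels H G"
    and burnside_rels_minus: "x \<in> burnside_rels H G \<Longrightarrow> - x \<in> burnside_rels H G"
    and burnside_rels_keys: "x \<in> burnside_rels H G \<Longrightarrow> is_frag H G x"
    and burnside_rels_subgroup: "subgroup (burnside_rels H G) (free_Abelian_group (nat_bisets H G))"
    and burnside_rels_normal: "burnside_rels H G \<lhd> free_Abelian_group (nat_bisets H G)"
proof -
  let ?F = "free_Abelian_group (nat_bisets H G)"
  interpret F: comm_group ?F by (rule abelian_free_Abelian_group)
  show sub: "subgroup (burnside_rels H G) ?F"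
    unfolding burnside_rels_def
    by (rule F.generate_is_subgroup)
      (auto dest!: subsetD[OF keys_diff] subsetD[OF keys_add] split: if_splits)
  interpret S: subgroup "burnside_rels H G" ?F by (fact sub)
  show "burnside_rels H G \<lhd> ?F" using sub by (rule F.subgroup_imp_normal)
  show "0 \<in> burnside_rels H G" using S.one_closed by simp
  show "x \<in> burnside_rels H G \<Longrightarrow> y \<in> burnside_rels H G \<Longrightarrow> x + y \<in> burnside_rels H G"
    using S.m_closed[of x y] by simp
  show keys: "x \<in> burnside_rels H G \<Longrightarrow> is_frag H G x"
    using S.mem_carrier[of x] by simp
  show "x \<in> burnside_rels H G \<Longrightarrow> - x \<in> burnside_rels H G"
    using S.m_inv_closed[of x] keys by simp
qed

text \<open>Equality in \<open>burnside H G\<close> seen on representatives. As a condition on a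
  difference it makes sense for all fragments; membership in the free group is tracked separately by
  \<open>is_frag\<close>.\<close>

definition frag_eq :: "'h monoid \<Rightarrow> 'g monoid \<Rightarrow> ('h, 'g) biset_frag \<Rightarrow> ('h, 'g) biset_frag \<Rightarrow> bool" where
  "frag_eq H G x y \<longleftrightarrow> x - y \<in> burnside_rels H G"

lemma frag_eq_refl [simp]: "frag_eq H G x x"
  by (simp add: frag_eq_def burnside_rels_zero)

lemma frag_eq_sym: "frag_eq H G x y \<Longrightarrow> frag_eq H G y x"
  using burnside_rels_minus[of "x - y"] by (simp add: frag_eq_def)

lemma frag_eq_trans [trans]: "frag_eq H G x y \<Longrightarrow> frag_eq H G y z \<Longrightarrow> frag_eq H G x z"
  using burnside_rels_add[of "x - y" H G "y - z"] by (simp add: frag_eq_def)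

lemma frag_eq_add: "frag_eq H G x y \<Longrightarrow> frag_eq H G x' y' \<Longrightarrow> frag_eq H G (x + x') (y + y')"
  using burnside_rels_add[of "x - y" H G "x' - y'"] by (simp add: frag_eq_def algebra_simps)

lemma frag_eq_minus: "frag_eq H G x y \<Longrightarrow> frag_eq H G (- x) (- y)"
  using burnside_rels_minus[of "x - y" H G] by (simp add: frag_eq_def)

lemma frag_eq_diff: "frag_eq H G x y \<Longrightarrow> frag_eq H G x' y' \<Longrightarrow> frag_eq H G (x - x') (y - y')"
  using frag_eq_add[OF _ frag_eq_minus] by force

lemma frag_eq_sum: "(\<And>i. i \<in> I \<Longrightarrow> frag_eq H G (f i) (g i)) \<Longrightarrow> frag_eq H G (sum f I) (sum g I)"
  by (induction I rule: infinite_finite_induct) (auto intro: frag_eq_add)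

lemma frag_eq_cmul: "frag_eq H G x y \<Longrightarrow> frag_eq H G (frag_cmul c x) (frag_cmul c y)"
proof -
  assume a: "frag_eq H G x y"
  have nat: "frag_eq H G (frag_cmul (int n) x) (frag_cmul (int n) y)" for n
    by (induction n) (auto simp: frag_cmul_distrib intro: frag_eq_add a)
  show ?thesis
    by (cases c rule: int_cases2) (use nat frag_eq_minus[OF nat] in auto)
qed

lemma frag_eq_union:
  assumes "finite_biset H G W" "finite_biset H G U" "finite_biset H G V"
    and "biset_iso H G W (biset_union U V)"
  shows "frag_eq H G (frag_of W) (frag_of U + frag_of V)"
  using assms unfolding frag_eq_def burnside_rels_def in_nat_bisets_iff[symmetric]
  by (blast intro: generate.incl)

text \<open>The relations speak of unions only. For the empty biset \<open>E\<close>, the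
  isomorphism of \<open>E\<close> with \<open>E + E\<close> makes the class of \<open>E\<close>
  vanish, and \<open>U\<close> is isomorphic to \<open>V + E\<close>.\<close>

lemma frag_eq_iso_nat:
  assumes U: "finite_biset H G U" and V: "finite_biset H G V" and iso: "biset_iso H G U V"
  shows "frag_eq H G (frag_of U) (frag_of V)"
proof -
  define E :: "('a, 'b, nat) biset" where "E = \<lparr>pts = {}, lact = \<lambda>_ x. x, ract = \<lambda>x _. x\<rparr>"
  have E: "finite_biset H G E" by (simp add: E_def finite_biset_def is_biset_def)
  obtain f where f: "bij_betw f (pts U) (pts V)"
    "\<And>h x. h \<in> carrier H \<Longrightarrow> x \<in> pts U \<Longrightarrow> f (lact U h x) = lact V h (f x)"
    "\<And>x g. x \<in> pts U \<Longrightarrow> g \<in> carrier G \<Longrightarrow> f (ract U x g) = ract V (f x) g"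
    using iso unfolding biset_iso_def by blast
  have "biset_iso H G U (biset_union V E)"
    unfolding biset_iso_def
    by (rule exI[of _ "\<lambda>x. Inl (f x)"]) (use f in \<open>auto simp: E_def biset_union_def bij_betw_def inj_on_def\<close>)
  then have 1: "frag_eq H G (frag_of U) (frag_of V + frag_of E)"
    by (intro frag_eq_union U V E)
  have "biset_iso H G E (biset_union E E)"
    unfolding biset_iso_def by (auto simp: E_def biset_union_def bij_betw_def)
  then have 2: "frag_eq H G (frag_of E) (frag_of E + frag_of E)"
    by (intro frag_eq_union E)
  from frag_eq_diff[OF 1 2] show ?thesis
    by (simp add: frag_eq_def algebra_simps)
qed

lemma frag_eq_iso:
  assumes U: "finite_biset H G U" and V: "finite_biset H G V" and iso: "biset_iso H G U V"
    and "group H" "group G"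
  shows "frag_eq H G (biset_frag U) (biset_frag V)"
proof (rule frag_eq_iso_nat)
  show "finite_biset H G (nat_copy U)" "finite_biset H G (nat_copy V)"
    using nat_copy_in_nat_bisets assms by (auto simp: in_nat_bisets_iff)
  then show "biset_iso H G (nat_copy U) (nat_copy V)"
    using U V iso by (metis biset_iso_nat_copy biset_iso_sym biset_iso_trans finite_biset_def)
qed

text \<open>The common source of well-definedness for maps out of a Burnside group: it suffices that
  \<open>\<Phi>\<close> respects differences and sends each generating relation to a
  congruence.\<close>

lemma burnside_rels_hom:
  assumes x: "x \<in> burnside_rels H G"
    and diff: "\<And>a b. \<Phi> (a - b) = \<Phi> a - \<Phi> b"
    and gen: "\<And>W U V. finite_biset H G W \<Longrightarrow> finite_biset H G U \<Longrightarrow> finite_biset H G V \<Longrightarrow>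
      biset_iso H G W (biset_union U V) \<Longrightarrow>
      frag_eq H' G' (\<Phi> (frag_of W)) (\<Phi> (frag_of U) + \<Phi> (frag_of V))"
  shows "\<Phi> x \<in> burnside_rels H' G'"
proof -
  have zero: "\<Phi> 0 = 0" using diff[of 0 0] by simp
  have minus: "\<Phi> (- a) = - \<Phi> a" for a using diff[of 0 a] zero by simp
  have add: "\<Phi> (a + b) = \<Phi> a + \<Phi> b" for a b using diff[of a "- b"] minus by simp
  have base: "\<Phi> g \<in> burnside_rels H' G'"
    if "g \<in> {frag_of W - (frag_of U + frag_of V) | W U V.
        W \<in> nat_bisets H G \<and> U \<in> nat_bisets H G \<and> V \<in> nat_bisets H G \<and>
        biset_iso H G W (biset_union U V)}" for g
    using that gen by (auto simp: diff add frag_eq_def in_nat_bisets_iff)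
  \<comment> \<open>The inverse in \<open>free_Abelian_group\<close> is negation on its carrier, so
    the case \<open>inv\<close> below has to know that generators lie there.\<close>
  have keys: "is_frag H G g"
    if "g \<in> {frag_of W - (frag_of U + frag_of V) | W U V.
        W \<in> nat_bisets H G \<and> U \<in> nat_bisets H G \<and> V \<in> nat_bisets H G \<and>
        biset_iso H G W (biset_union U V)}" for g
    using that by (auto dest!: subsetD[OF keys_diff] subsetD[OF keys_add] split: if_splits)
  show ?thesis
    using x[unfolded burnside_rels_def]
  proof (induction rule: generate.induct)
    case one
    then show ?case by (simp add: zero burnside_rels_zero)
  next
    case (incl h)
    then show ?case by (rule base)
  next
    case (inv h)
    then show ?case using burnside_rels_minus[OF base[OF inv]] keys[OF inv] by (simp add: minus)
  next
    case (eng h1 h2)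
    then show ?case by (simp add: add burnside_rels_add)
  qed
qed

section \<open>Composition of fragments: bilinearity, independence of representatives,
  associativity\<close>

definition comp_frag :: "'h monoid \<Rightarrow> ('k, 'h) biset_frag \<Rightarrow> ('h, 'g) biset_frag \<Rightarrow> ('k, 'g) biset_frag" where
  "comp_frag H y x =
     frag_extend (\<lambda>V. frag_extend (\<lambda>U. biset_frag (biset_tensor H V U)) x) y"

lemma comp_frag_of [simp]: "comp_frag H (frag_of V) (frag_of U) = biset_frag (biset_tensor H V U)"
  by (simp add: comp_frag_def)

lemma frag_cmul_diff_distrib2: "frag_cmul c (a - b) = frag_cmul c a - frag_cmul c b"
  using frag_cmul_distrib2[of c a "- b"] by (metis diff_conv_add_uminus frag_cmul_cmul
      frag_cmul_minus_one mult.commute)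

lemma comp_frag_diff_left: "comp_frag H (y - y') x = comp_frag H y x - comp_frag H y' x"
  by (simp add: comp_frag_def frag_extend_diff)

lemma comp_frag_diff_right: "comp_frag H y (x - x') = comp_frag H y x - comp_frag H y x'"
  by (simp add: comp_frag_def frag_extend_diff)
    (simp add: frag_extend_def frag_cmul_diff_distrib2 sum_subtractf)

lemma comp_frag_0_left [simp]: "comp_frag H 0 x = 0"
  by (simp add: comp_frag_def)

lemma comp_frag_0_right [simp]: "comp_frag H y 0 = 0"
  using comp_frag_diff_right[of H y 0 0] by simp

lemma comp_frag_minus_left: "comp_frag H (- y) x = - comp_frag H y x"
  using comp_frag_diff_left[of H 0 y x] by simp

lemma comp_frag_minus_right: "comp_frag H y (- x) = - comp_frag H y x"
  using comp_frag_diff_right[of H y 0 x] by simp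

lemma comp_frag_add_left: "comp_frag H (y + y') x = comp_frag H y x + comp_frag H y' x"
  using comp_frag_diff_left[of H y "- y'" x] by (simp add: comp_frag_minus_left)

lemma comp_frag_add_right: "comp_frag H y (x + x') = comp_frag H y x + comp_frag H y x'"
  using comp_frag_diff_right[of H y x "- x'"] by (simp add: comp_frag_minus_right)

lemma comp_frag_sum_left: "comp_frag H (sum f I) x = (\<Sum>i\<in>I. comp_frag H (f i) x)"
  by (induction I rule: infinite_finite_induct) (auto simp: comp_frag_add_left)

lemma comp_frag_sum_right: "comp_frag H y (sum f I) = (\<Sum>i\<in>I. comp_frag H y (f i))"
  by (induction I rule: infinite_finite_induct) (auto simp: comp_frag_add_right)

lemma comp_frag_cmul_left: "comp_frag H (frag_cmul c y) x = frag_cmul c (comp_frag H y x)"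
  by (simp add: comp_frag_def frag_extend_cmul)

lemma comp_frag_cmul_right: "comp_frag H y (frag_cmul c x) = frag_cmul c (comp_frag H y x)"
proof -
  have nat: "comp_frag H y (frag_cmul (int n) x) = frag_cmul (int n) (comp_frag H y x)" for n
    by (induction n) (auto simp: frag_cmul_distrib comp_frag_add_right)
  show ?thesis
  proof (cases c rule: int_cases2)
    case (nonpos n)
    have "comp_frag H y (- frag_cmul (int n) x) = - frag_cmul (int n) (comp_frag H y x)"
      by (simp only: comp_frag_minus_right nat)
    then show ?thesis using nonpos by simp
  qed (simp add: nat)
qed

lemma comp_frag_keys:
  assumes "is_frag K H y" "is_frag H G x"
    and "group K" "group H" "group G"
  shows "is_frag K G (comp_frag H y x)"
proof -
  have *: "nat_copy (biset_tensor H V U) \<in> nat_bisets K G"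
    if "V \<in> Poly_Mapping.keys y" "U \<in> Poly_Mapping.keys x" for V U
    using that assms by (intro nat_copy_in_nat_bisets finite_biset_biset_tensor)
      (auto simp: in_nat_bisets_iff[symmetric])
  show ?thesis
    unfolding comp_frag_def
    using * by (auto dest!: subsetD[OF keys_frag_extend])
qed

text \<open>The bridge from models to composition: whichever \<open>W\<close> carries a tensor map
  for \<open>V\<close> and \<open>U\<close> computes the product of their classes.\<close>

lemma comp_frag_biset_frag:
  assumes "is_tensor K H G V U W" and V: "finite_biset K H V" and U: "finite_biset H G U"
    and "group K" "group H" "group G"
  shows "frag_eq K G (comp_frag H (biset_frag V) (biset_frag U)) (biset_frag W)"
proof -
  have V': "finite_biset K H (nat_copy V)" and U': "finite_biset H G (nat_copy U)"
    using nat_copy_in_nat_bisets assms by (auto simp: in_nat_bisets_iff)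
  have "biset_iso K G W (biset_tensor H (nat_copy V) (nat_copy U))"
    by (rule is_tensor_unique[OF assms(1) is_tensor_biset_tensor])
      (use assms V' U' biset_iso_nat_copy in \<open>auto simp: finite_biset_def\<close>)
  moreover have "finite_biset K G W" using assms by (auto intro: finite_biset_tensor)
  ultimately show ?thesis
    unfolding comp_frag_of
    by (intro frag_eq_sym[OF frag_eq_iso] finite_biset_biset_tensor V' U' assms)
qed

text \<open>By linearity \<open>y\<close> may be a single biset \<open>V\<close>. Tensoring with
  \<open>V\<close> distributes over disjoint unions, and \<open>is_tensor_unique\<close> transports
  this to the copies on natural numbers. The left-hand version works in the same way.\<close>

lemma comp_frag_rels_right:
  assumes "x \<in> burnside_rels H G" and y: "is_frag K H y"
    and grp: "group K" "group H" "group G"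
  shows "comp_frag H y x \<in> burnside_rels K G"
  using y
proof (induction y rule: frag_induction)
  case (one V)
  show ?case
  proof (rule burnside_rels_hom[OF assms(1)])
    fix W U U' :: "(_, _, nat) biset" assume *: "finite_biset H G W" "finite_biset H G U" "finite_biset H G U'"
      "biset_iso H G W (biset_union U U')"
    have V: "finite_biset K H V" using one by (simp add: in_nat_bisets_iff)
    let ?N = "\<lambda>U. nat_copy (biset_tensor H V U)"
    note N = nat_copy_tensor_finite[OF V _ grp] is_tensor_nat_copy[OF V _ grp]
    have "biset_iso K G (?N W) (biset_union (?N U) (?N U'))"
      by (rule is_tensor_unique[OF N(2)[OF *(1)] is_tensor_union_right[OF N(2)[OF *(2)] N(2)[OF *(3)]]
            _ _ biset_iso_refl *(4)])
        (use * V in \<open>auto simp: finite_biset_def\<close>)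
    then show "frag_eq K G (comp_frag H (frag_of V) (frag_of W))
      (comp_frag H (frag_of V) (frag_of U) + comp_frag H (frag_of V) (frag_of U'))"
      unfolding comp_frag_of by (intro frag_eq_union N *)
  qed (rule comp_frag_diff_right)
next
  case (diff a b)
  then show ?case
    using burnside_rels_add[OF diff.IH(1) burnside_rels_minus[OF diff.IH(2)]]
    by (simp add: comp_frag_diff_left)
qed (simp add: burnside_rels_zero)

lemma comp_frag_rels_left:
  assumes "y \<in> burnside_rels K H" and x: "is_frag H G x"
    and grp: "group K" "group H" "group G"
  shows "comp_frag H y x \<in> burnside_rels K G"
  using x
proof (induction x rule: frag_induction)
  case (one V)
  show ?case
  proof (rule burnside_rels_hom[OF assms(1), where \<Phi> = "\<lambda>y. comp_frag H y (frag_of V)"])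
    fix W U U' :: "(_, _, nat) biset" assume *: "finite_biset K H W" "finite_biset K H U" "finite_biset K H U'"
      "biset_iso K H W (biset_union U U')"
    have V: "finite_biset H G V" using one by (simp add: in_nat_bisets_iff)
    let ?N = "\<lambda>U. nat_copy (biset_tensor H U V)"
    note N = nat_copy_tensor_finite[OF _ V grp] is_tensor_nat_copy[OF _ V grp]
    have "biset_iso K G (?N W) (biset_union (?N U) (?N U'))"
      by (rule is_tensor_unique[OF N(2)[OF *(1)] is_tensor_union_left[OF N(2)[OF *(2)] N(2)[OF *(3)]]
            _ _ *(4) biset_iso_refl])
        (use * V in \<open>auto simp: finite_biset_def\<close>)
    then show "frag_eq K G (comp_frag H (frag_of W) (frag_of V))
      (comp_frag H (frag_of U) (frag_of V) + comp_frag H (frag_of U') (frag_of V))"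
      unfolding comp_frag_of by (intro frag_eq_union N *)
  qed (rule comp_frag_diff_left)
next
  case (diff a b)
  then show ?case
    using burnside_rels_add[OF diff.IH(1) burnside_rels_minus[OF diff.IH(2)]]
    by (simp add: comp_frag_diff_right)
qed (simp add: burnside_rels_zero)

lemma frag_eq_keys: "frag_eq H G x y \<Longrightarrow> is_frag H G y \<Longrightarrow>
    is_frag H G x"
  using burnside_rels_keys[of "x - y" H G] keys_add[of "x - y" y] by (auto simp: frag_eq_def)

text \<open>The factors are exchanged one at a time, through the mixed term
  \<open>comp_frag H y x'\<close>; this is why membership is asked of \<open>y\<close> and of
  \<open>x'\<close>.\<close>

lemma comp_frag_cong:
  assumes "frag_eq K H y y'" "frag_eq H G x x'"
    and "is_frag K H y" "is_frag H G x'"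
    and grp: "group K" "group H" "group G"
  shows "frag_eq K G (comp_frag H y x) (comp_frag H y' x')"
proof -
  have "frag_eq K G (comp_frag H y x) (comp_frag H y x')"
    using comp_frag_rels_right[of "x - x'" H G y K] assms by (simp add: frag_eq_def comp_frag_diff_right)
  also have "frag_eq K G (comp_frag H y x') (comp_frag H y' x')"
    using comp_frag_rels_left[of "y - y'" K H x' G] assms by (simp add: frag_eq_def comp_frag_diff_left)
  finally show ?thesis .
qed

text \<open>Trilinearity reduces the claim to three bisets. The inner products then appear as
  \<open>nat_copy\<close> of a quotient set, which \<open>is_tensor_assoc\<close> accepts because it
  works with any models.\<close>

lemma comp_frag_assoc:
  assumes z: "is_frag L K z" and y: "is_frag K H y"
    and x: "is_frag H G x"
    and grp: "group L" "group K" "group H" "group G"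
  shows "frag_eq L G (comp_frag H (comp_frag K z y) x) (comp_frag K z (comp_frag H y x))"
  using z
proof (induction z rule: frag_induction)
  case (one W)
  show ?case using y
  proof (induction y rule: frag_induction)
    case (one V)
    show ?case using x
    proof (induction x rule: frag_induction)
      case (one U)
      have W: "finite_biset L K W" and V: "finite_biset K H V" and U: "finite_biset H G U"
        using \<open>W \<in> nat_bisets L K\<close> \<open>V \<in> nat_bisets K H\<close> \<open>U \<in> nat_bisets H G\<close>
        by (auto simp: in_nat_bisets_iff)
      have WV: "finite_biset L H (nat_copy (biset_tensor K W V))"
        and VU: "finite_biset K G (nat_copy (biset_tensor H V U))"
        by (intro nat_copy_tensor_finite W V U grp)+
      have iso: "biset_iso L G (biset_tensor H (nat_copy (biset_tensor K W V)) U)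
         (biset_tensor K W (nat_copy (biset_tensor H V U)))"
        by (rule is_tensor_assoc[OF is_tensor_nat_copy[OF W V grp(1-3)] is_tensor_nat_copy[OF V U grp(2-4)]])
          (use W V U WV VU grp in \<open>simp_all add: finite_biset_def is_tensor_biset_tensor\<close>)
      show ?case
        unfolding comp_frag_of
        by (rule frag_eq_iso[OF _ _ iso]; intro finite_biset_biset_tensor WV VU W U grp)
    qed (simp_all add: comp_frag_diff_right frag_eq_diff)
  qed (simp_all add: comp_frag_diff_right comp_frag_diff_left frag_eq_diff)
qed (simp_all add: comp_frag_diff_left frag_eq_diff)

lemma frag_class_eq_iff: "frag_class H G x = frag_class H G y \<longleftrightarrow> frag_eq H G x y"
proof
  assume "frag_class H G x = frag_class H G y"
  moreover have "x \<in> frag_class H G x"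
    using burnside_rels_zero[of H G] by (auto simp: frag_class_def r_coset_def intro!: bexI[of _ 0])
  ultimately have "x \<in> frag_class H G y" by simp
  then show "frag_eq H G x y" by (auto simp: frag_class_def r_coset_def frag_eq_def)
next
  have *: "frag_class H G x \<subseteq> frag_class H G y" if "frag_eq H G x y" for x y
  proof
    fix z assume "z \<in> frag_class H G x"
    then obtain r where "r \<in> burnside_rels H G" "z = r + x"
      by (auto simp: frag_class_def r_coset_def)
    then show "z \<in> frag_class H G y"
      using that burnside_rels_add[of r H G "x - y"]
      by (auto simp: frag_class_def r_coset_def frag_eq_def intro!: bexI[of _ "r + (x - y)"])
  qed
  then show "frag_class H G x = frag_class H G y" if "frag_eq H G x y"
    using that frag_eq_sym by blast
qed

lemma in_frag_class_iff: "y \<in> frag_class H G x \<longleftrightarrow> frag_eq H G y x"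
proof -
  have "y \<in> frag_class H G x \<longleftrightarrow> (\<exists>r\<in>burnside_rels H G. y = r + x)"
    by (auto simp: frag_class_def r_coset_def)
  also have "\<dots> \<longleftrightarrow> y - x \<in> burnside_rels H G"
    by (metis add_diff_cancel_right' diff_add_cancel)
  finally show ?thesis by (simp add: frag_eq_def)
qed

section \<open>The Burnside group as the group of classes of fragments\<close>

lemma burnside_carrier:
  "carrier (burnside H G) = frag_class H G ` {x. is_frag H G x}"
  by (simp add: burnside_def carrier_FactGroup frag_class_def free_Abelian_group_def)

lemma frag_class_closed:
  "is_frag H G x \<Longrightarrow> frag_class H G x \<in> carrier (burnside H G)"
  by (auto simp: burnside_carrier)

lemma comm_group_burnside: "comm_group (burnside H G)"
  unfolding burnside_def
  by (rule comm_group.abelian_FactGroup[OF abelian_free_Abelian_group burnside_rels_subgroup])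

lemma frag_class_mult:
  assumes "is_frag H G x" "is_frag H G y"
  shows "frag_class H G x \<otimes>\<^bsub>burnside H G\<^esub> frag_class H G y = frag_class H G (x + y)"
  using normal.rcos_sum[OF burnside_rels_normal, of x H G y] assms
  by (simp add: burnside_def frag_class_def)

lemma frag_class_one: "\<one>\<^bsub>burnside H G\<^esub> = frag_class H G 0"
  by (auto simp: burnside_def frag_class_def r_coset_def)

lemma frag_class_inv:
  assumes "is_frag H G x"
  shows "inv\<^bsub>burnside H G\<^esub> frag_class H G x = frag_class H G (- x)"
proof -
  interpret comm_group "burnside H G" by (rule comm_group_burnside)
  show ?thesis
    by (rule inv_equality) (use assms in \<open>auto simp: frag_class_mult frag_class_one frag_class_closed\<close>)
qed

text \<open>By \<open>comp_frag_cong\<close> all members of the union over representatives are one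
  and the same class, and the union is not empty.\<close>

lemma burnside_comp_frag_class:
  assumes "is_frag K H y" "is_frag H G x"
    and grp: "group K" "group H" "group G"
  shows "burnside_comp K H G (frag_class K H y) (frag_class H G x) = frag_class K G (comp_frag H y x)"
proof -
  have *: "frag_class K G (comp_frag H y' x') = frag_class K G (comp_frag H y x)"
    if "frag_eq K H y' y" "frag_eq H G x' x" for y' x'
    using that assms frag_eq_keys[OF that(1) assms(1)]
    by (auto simp: frag_class_eq_iff intro: comp_frag_cong)
  have ne: "frag_class K H y \<noteq> {}" "frag_class H G x \<noteq> {}"
    using in_frag_class_iff frag_eq_refl by blast+
  have "burnside_comp K H G (frag_class K H y) (frag_class H G x) =
    (\<Union>y' \<in> frag_class K H y. \<Union>x' \<in> frag_class H G x. frag_class K G (comp_frag H y x))"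
    unfolding burnside_comp_def comp_frag_def[symmetric]
    by (intro SUP_cong refl *) (simp_all add: in_frag_class_iff)
  also have "\<dots> = frag_class K G (comp_frag H y x)"
    using ne by simp
  finally show ?thesis .
qed

section \<open>The ideal generated by \<open>\<delta>\<close>\<close>

lemma group_op_group:
  assumes "group G"
  shows "group (op_group G)"
proof -
  interpret group G by fact
  show ?thesis
    by (rule groupI) (auto simp: op_group_def m_assoc intro: l_inv_ex r_inv_ex r_inv)
qed

abbreviation left_group :: "'q monoid \<Rightarrow> 'p monoid \<Rightarrow> ('q \<times> 'p) monoid" where
  "left_group Q P \<equiv> Q \<times>\<times> op_group P"

lemma group_left_group: "group Q \<Longrightarrow> group P \<Longrightarrow> group (left_group Q P)"
  by (intro DirProd_group group_op_group)

lemma group_trivial_grp: "group trivial_grp"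
  by simp

lemma biset_to_left_finite_biset:
  assumes "finite_biset Q P U"
  shows "finite_biset (left_group Q P) trivial_grp (biset_to_left U)"
proof -
  have U: "is_biset Q P U" using assms by (simp add: finite_biset_def)
  have "is_biset (left_group Q P) trivial_grp (biset_to_left U)"
    by (rule is_bisetI)
      (auto simp: biset_to_left_def op_group_def DirProd_def lact_closed[OF U] ract_closed[OF U]
        lact_one[OF U] ract_one[OF U] lact_mult[OF U] ract_mult[OF U] ract_lact[OF U])
  then show ?thesis using assms by (simp add: finite_biset_def biset_to_left_def)
qed

lemma biset_to_left_union:
  assumes W: "is_biset Q P W" and "biset_iso Q P W (biset_union U V)"
  shows "biset_iso (left_group Q P) trivial_grp (biset_to_left W)
           (biset_union (biset_to_left U) (biset_to_left V))"
proof -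
  obtain f where f: "bij_betw f (pts W) (pts (biset_union U V))"
    "\<And>h x. h \<in> carrier Q \<Longrightarrow> x \<in> pts W \<Longrightarrow> f (lact W h x) = lact (biset_union U V) h (f x)"
    "\<And>x g. x \<in> pts W \<Longrightarrow> g \<in> carrier P \<Longrightarrow> f (ract W x g) = ract (biset_union U V) (f x) g"
    using assms(2) unfolding biset_iso_def by blast
  have "map_sum (\<lambda>x. lact U a (ract U x b)) (\<lambda>x. lact V a (ract V x b)) z =
    map_sum (lact U a) (lact V a) (map_sum (\<lambda>x. ract U x b) (\<lambda>x. ract V x b) z)" for a b z
    by (cases z) auto
  then show ?thesis
    unfolding biset_iso_def
    by (intro exI[of _ f])
      (use f in \<open>auto simp: biset_to_left_def op_group_def DirProd_def biset_union_def
        ract_closed[OF W] sum.map_ident\<close>)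
qed

section \<open>From \<open>(Q, P)\<close>-bisets to left sets, and what becomes of
  composition\<close>

definition to_left_frag :: "('q, 'p) biset_frag \<Rightarrow> ('q \<times> 'p, unit) biset_frag" where
  "to_left_frag x = frag_extend (\<lambda>U. frag_of (biset_to_left U)) x"

lemma to_left_frag_diff: "to_left_frag (x - y) = to_left_frag x - to_left_frag y"
  by (simp add: to_left_frag_def frag_extend_diff)

lemma to_left_frag_of [simp]: "to_left_frag (frag_of U) = frag_of (biset_to_left U)"
  by (simp add: to_left_frag_def)

lemma to_left_frag_zero [simp]: "to_left_frag 0 = 0"
  by (simp add: to_left_frag_def)

lemma to_left_frag_cong:
  assumes "frag_eq Q P x y"
  shows "frag_eq (left_group Q P) trivial_grp (to_left_frag x) (to_left_frag y)"
proof -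
  have "to_left_frag (x - y) \<in> burnside_rels (left_group Q P) trivial_grp"
  proof (rule burnside_rels_hom[where \<Phi> = to_left_frag])
    show "x - y \<in> burnside_rels Q P" using assms by (simp add: frag_eq_def)
    fix W U V :: "(_, _, nat) biset"
    assume "finite_biset Q P W" "finite_biset Q P U" "finite_biset Q P V"
      "biset_iso Q P W (biset_union U V)"
    then show "frag_eq (left_group Q P) trivial_grp (to_left_frag (frag_of W))
      (to_left_frag (frag_of U) + to_left_frag (frag_of V))"
      unfolding to_left_frag_of
      by (intro frag_eq_union biset_to_left_finite_biset biset_to_left_union) (simp_all add: finite_biset_def)
  qed (rule to_left_frag_diff)
  then show ?thesis by (simp add: frag_eq_def to_left_frag_diff)
qed

lemma burnside_to_left_frag_class:
  "burnside_to_left Q P (frag_class Q P x) = frag_class (left_group Q P) trivial_grp (to_left_frag x)"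
proof -
  have ne: "frag_class Q P x \<noteq> {}"
    using in_frag_class_iff frag_eq_refl by blast
  have "burnside_to_left Q P (frag_class Q P x) =
    (\<Union>y \<in> frag_class Q P x. frag_class (left_group Q P) trivial_grp (to_left_frag x))"
    unfolding burnside_to_left_def to_left_frag_def[symmetric]
    by (intro SUP_cong refl) (auto simp: in_frag_class_iff frag_class_eq_iff intro: to_left_frag_cong)
  then show ?thesis using ne by simp
qed

text \<open>The bisets \<open>V \<times> P\<^sup>o\<^sup>p\<close> and \<open>Q \<times> U\<^sup>o\<^sup>p\<close>, which act on \<open>B(Q \<times> P\<^sup>o\<^sup>p)\<close> as composition with \<open>V\<close> and
  \<open>U\<close> acts on \<open>B(Q, P)\<close> from either side.\<close>

definition biset_times_op ::
  "('r, 'q, 'x) biset \<Rightarrow> 'p monoid \<Rightarrow> ('r \<times> 'p, 'q \<times> 'p, 'x \<times> 'p) biset" where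
  "biset_times_op V P =
     \<lparr>pts = pts V \<times> carrier P,
      lact = (\<lambda>(r, g) (v, x). (lact V r v, x \<otimes>\<^bsub>P\<^esub> g)),
      ract = (\<lambda>(v, x) (q, g). (ract V v q, g \<otimes>\<^bsub>P\<^esub> x))\<rparr>"

definition times_op_biset ::
  "'q monoid \<Rightarrow> ('p, 's, 'x) biset \<Rightarrow> ('q \<times> 's, 'q \<times> 'p, 'q \<times> 'x) biset" where
  "times_op_biset Q U =
     \<lparr>pts = carrier Q \<times> pts U,
      lact = (\<lambda>(q, s) (x, u). (q \<otimes>\<^bsub>Q\<^esub> x, ract U u s)),
      ract = (\<lambda>(x, u) (q, g). (x \<otimes>\<^bsub>Q\<^esub> q, lact U g u))\<rparr>"

lemma biset_times_op_finite_biset: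
  assumes "finite_biset R Q V" "group P" "finite (carrier P)"
  shows "finite_biset (left_group R P) (left_group Q P) (biset_times_op V P)"
proof -
  interpret P: group P by fact
  have V: "is_biset R Q V" using assms by (simp add: finite_biset_def)
  have "is_biset (left_group R P) (left_group Q P) (biset_times_op V P)"
    by (rule is_bisetI)
      (auto simp: biset_times_op_def op_group_def DirProd_def lact_closed[OF V] ract_closed[OF V]
        lact_one[OF V] ract_one[OF V] lact_mult[OF V] ract_mult[OF V] ract_lact[OF V] P.m_assoc)
  then show ?thesis using assms by (simp add: finite_biset_def biset_times_op_def)
qed

lemma times_op_biset_finite_biset:
  assumes "finite_biset P S U" "group Q" "finite (carrier Q)"
  shows "finite_biset (left_group Q S) (left_group Q P) (times_op_biset Q U)"
proof -
  interpret Q: group Q by fact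
  have U: "is_biset P S U" using assms by (simp add: finite_biset_def)
  have "is_biset (left_group Q S) (left_group Q P) (times_op_biset Q U)"
    by (rule is_bisetI)
      (auto simp: times_op_biset_def op_group_def DirProd_def lact_closed[OF U] ract_closed[OF U]
        lact_one[OF U] ract_one[OF U] lact_mult[OF U] ract_mult[OF U] ract_lact[OF U] Q.m_assoc)
  then show ?thesis using assms by (simp add: finite_biset_def times_op_biset_def)
qed

text \<open>The factor \<open>P\<close> in \<open>V \<times> P\<^sup>o\<^sup>p\<close> can be
  shifted onto \<open>U\<close>: \<open>((v, x), u)\<close> represents the same point as
  \<open>(v, u x)\<close>.\<close>

lemma is_tensor_biset_times_op:
  assumes "is_tensor R Q P V U T" and V: "is_biset R Q V" and U: "is_biset Q P U" and P: "group P"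
  shows "is_tensor (left_group R P) (left_group Q P) trivial_grp
           (biset_times_op V P) (biset_to_left U) (biset_to_left T)"
proof -
  interpret P: group P by fact
  obtain \<phi> where t: "tensor_map R Q P V U T \<phi>"
    using assms(1) by (auto simp: is_tensor_def)
  note [simp] = lact_closed[OF U] ract_closed[OF U] lact_closed[OF V] ract_closed[OF V]
    tensor_map_closed[OF t]
  have "tensor_map (left_group R P) (left_group Q P) trivial_grp
           (biset_times_op V P) (biset_to_left U) (biset_to_left T) (\<lambda>(v, x) u. \<phi> v (ract U u x))"
  proof (rule tensor_mapI, goal_cases)
    case (2 w)
    then obtain v u where "v \<in> pts V" "u \<in> pts U" "w = \<phi> v u"
      by (auto simp: biset_to_left_def dest!: tensor_map_surj[OF t])
    then show ?case
      by (intro bexI[of _ "(v, \<one>\<^bsub>P\<^esub>)"] bexI[of _ u])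
        (auto simp: biset_to_left_def biset_times_op_def ract_one[OF U])
  next
    case (3 k v u)
    then show ?case
      by (auto simp: biset_to_left_def biset_times_op_def DirProd_def op_group_def
          ract_mult[OF U] tensor_map_lact[OF t, symmetric] tensor_map_ract[OF t, symmetric])
  next
    case (5 v u h)
    then show ?case
      by (auto simp: biset_to_left_def biset_times_op_def DirProd_def op_group_def ract_lact[OF U]
          ract_mult[OF U] tensor_map_balanced[OF t V U, symmetric])
  next
    case *: (6 v u v' u')
    obtain w x where v: "v = (w, x)" by (cases v)
    obtain w' x' where v': "v' = (w', x')" by (cases v')
    have mem: "w \<in> pts V" "w' \<in> pts V" "x \<in> carrier P" "x' \<in> carrier P" "u \<in> pts U" "u' \<in> pts U"
      using * v v' by (auto simp: biset_to_left_def biset_times_op_def)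
    obtain h where h: "h \<in> carrier Q" "w' = ract V w h" "ract U u x = lact U h (ract U u' x')"
      using * mem by (auto simp: v v' tensor_map_eq_iff[OF t])
    \<comment> \<open>Solving \<open>u x = h u' x'\<close> for \<open>u\<close> yields the element
      \<open>(h, x' x\<^sup>-\<^sup>1)\<close> that links the two pairs.\<close>
    have "u = ract U (ract U u x) (inv\<^bsub>P\<^esub> x)"
      using mem by (simp add: ract_mult[OF U, symmetric] ract_one[OF U])
    also have "\<dots> = lact U h (ract U u' (x' \<otimes>\<^bsub>P\<^esub> inv\<^bsub>P\<^esub> x))"
      using mem h by (simp add: ract_mult[OF U] ract_lact[OF U])
    finally show ?case
      using h mem v v'
      by (intro bexI[of _ "(h, x' \<otimes>\<^bsub>P\<^esub> inv\<^bsub>P\<^esub> x)"])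
        (auto simp: biset_to_left_def biset_times_op_def DirProd_def op_group_def P.m_assoc)
  qed (auto simp: biset_to_left_def biset_times_op_def)
  then show ?thesis by (auto simp: is_tensor_def)
qed

lemma is_tensor_times_op_biset:
  assumes "is_tensor Q P S V U T" and V: "is_biset Q P V" and U: "is_biset P S U"
    and Q: "group Q" and P: "group P"
  shows "is_tensor (left_group Q S) (left_group Q P) trivial_grp
           (times_op_biset Q U) (biset_to_left V) (biset_to_left T)"
proof -
  interpret Q: group Q by fact
  interpret P: group P by fact
  obtain \<phi> where t: "tensor_map Q P S V U T \<phi>"
    using assms(1) by (auto simp: is_tensor_def)
  note [simp] = lact_closed[OF U] ract_closed[OF U] lact_closed[OF V] ract_closed[OF V]
    tensor_map_closed[OF t]
  have "tensor_map (left_group Q S) (left_group Q P) trivial_grp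
           (times_op_biset Q U) (biset_to_left V) (biset_to_left T) (\<lambda>(x, u) v. \<phi> (lact V x v) u)"
  proof (rule tensor_mapI, goal_cases)
    case (2 w)
    then obtain v u where "v \<in> pts V" "u \<in> pts U" "w = \<phi> v u"
      by (auto simp: biset_to_left_def dest!: tensor_map_surj[OF t])
    then show ?case
      by (intro bexI[of _ "(\<one>\<^bsub>Q\<^esub>, u)"] bexI[of _ v])
        (auto simp: biset_to_left_def times_op_biset_def lact_one[OF V])
  next
    case (3 k v u)
    then show ?case
      by (auto simp: biset_to_left_def times_op_biset_def DirProd_def op_group_def
          lact_mult[OF V] tensor_map_lact[OF t, symmetric] tensor_map_ract[OF t, symmetric])
  next
    case (5 v u h)
    then show ?case
      by (auto simp: biset_to_left_def times_op_biset_def DirProd_def op_group_def ract_lact[OF V]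
          lact_mult[OF V] tensor_map_balanced[OF t V U])
  next
    case *: (6 v u v' u')
    obtain w x where v: "v = (x, w)" by (cases v)
    obtain w' x' where v': "v' = (x', w')" by (cases v')
    have mem: "w \<in> pts U" "w' \<in> pts U" "x \<in> carrier Q" "x' \<in> carrier Q" "u \<in> pts V" "u' \<in> pts V"
      using * v v' by (auto simp: biset_to_left_def times_op_biset_def)
    obtain g where g: "g \<in> carrier P" "lact V x' u' = ract V (lact V x u) g" "w = lact U g w'"
      using * mem by (auto simp: v v' tensor_map_eq_iff[OF t])
    have w': "w' = lact U (inv\<^bsub>P\<^esub> g) w"
      using g mem by (simp add: lact_mult[OF U, symmetric] lact_one[OF U])
    \<comment> \<open>Solving \<open>x' u' = x u g\<close> for \<open>u\<close> yields the witness
      \<open>(x\<^sup>-\<^sup>1 x', g\<^sup>-\<^sup>1)\<close>. Here \<open>g\<close> is inverted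
      because the former right factor now stands on the left of the tensor product.\<close>
    have "u = ract V (lact V (inv\<^bsub>Q\<^esub> x) (ract V (lact V x u) g)) (inv\<^bsub>P\<^esub> g)"
      using mem g(1) by (simp add: ract_lact[OF V] ract_mult[OF V, symmetric] lact_mult[OF V, symmetric]
          ract_one[OF V] lact_one[OF V])
    also have "\<dots> = lact V (inv\<^bsub>Q\<^esub> x \<otimes>\<^bsub>Q\<^esub> x') (ract V u' (inv\<^bsub>P\<^esub> g))"
      using mem g by (simp add: lact_mult[OF V] ract_lact[OF V] flip: g(2))
    finally show ?case
      using g mem v v' w'
      by (intro bexI[of _ "(inv\<^bsub>Q\<^esub> x \<otimes>\<^bsub>Q\<^esub> x', inv\<^bsub>P\<^esub> g)"])
        (auto simp: biset_to_left_def times_op_biset_def DirProd_def op_group_def Q.m_assoc[symmetric])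
  qed (auto simp: biset_to_left_def times_op_biset_def)
  then show ?thesis by (auto simp: is_tensor_def)
qed

lemma frag_eq_biset_frag: "finite_biset H G U \<Longrightarrow> group H \<Longrightarrow> group G \<Longrightarrow> frag_eq H G (frag_of U) (biset_frag U)"
  using nat_copy_in_nat_bisets[of H G U]
  by (intro frag_eq_iso_nat biset_iso_nat_copy) (auto simp: in_nat_bisets_iff finite_biset_def)

text \<open>Inductions over fragments produce bisets that already live on natural numbers, and
  \<open>biset_to_left\<close> keeps the points. Hence this mixed form, in which only the left
  factor is a copy.\<close>

lemma comp_frag_nat:
  assumes "is_tensor K H G V U W" and V: "finite_biset K H V" and U: "finite_biset H G U"
    and "group K" "group H" "group G"
  shows "frag_eq K G (comp_frag H (biset_frag V) (frag_of U)) (frag_of W)"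
proof -
  have W: "finite_biset K G W" using assms by (auto intro: finite_biset_tensor)
  have "frag_eq K G (comp_frag H (biset_frag V) (frag_of U)) (comp_frag H (biset_frag V) (biset_frag U))"
    using assms nat_copy_in_nat_bisets[of H G U] nat_copy_in_nat_bisets[of K H V]
    by (intro comp_frag_cong frag_eq_biset_frag frag_eq_refl) auto
  also have "frag_eq K G \<dots> (biset_frag W)"
    by (rule comp_frag_biset_frag[OF assms])
  also have "frag_eq K G \<dots> (frag_of W)"
    by (rule frag_eq_sym[OF frag_eq_biset_frag[OF W \<open>group K\<close> \<open>group G\<close>]])
  finally show ?thesis .
qed

text \<open>On generators this is \<open>is_tensor_biset_times_op\<close>; both sides are bilinear.
  Finiteness of \<open>P\<close> keeps \<open>V \<times> P\<^sup>o\<^sup>p\<close> finite.\<close>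

lemma to_left_frag_comp_left:
  assumes y: "is_frag R Q y" and x: "is_frag Q P x"
    and grp: "group R" "group Q" "group P" "finite (carrier P)"
  shows "frag_eq (left_group R P) trivial_grp (to_left_frag (comp_frag Q y x))
    (comp_frag (left_group Q P) (frag_extend (\<lambda>V. biset_frag (biset_times_op V P)) y) (to_left_frag x))"
  using y
proof (induction y rule: frag_induction)
  case (one V)
  show ?case using x
  proof (induction x rule: frag_induction)
    case (one U)
    have V: "finite_biset R Q V" and U: "finite_biset Q P U"
      using \<open>V \<in> nat_bisets R Q\<close> \<open>U \<in> nat_bisets Q P\<close> by (auto simp: in_nat_bisets_iff)
    have left: "to_left_frag (comp_frag Q (frag_of V) (frag_of U)) =
      frag_of (biset_to_left (nat_copy (biset_tensor Q V U)))" by simp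
    have "is_tensor R Q P V U (nat_copy (biset_tensor Q V U))"
      by (rule is_tensor_nat_copy[OF V U grp(1-3)])
    then show ?case
      unfolding left frag_extend_of to_left_frag_of
      using V U grp
      by (intro frag_eq_sym[OF comp_frag_nat] is_tensor_biset_times_op biset_times_op_finite_biset
          biset_to_left_finite_biset group_left_group group_trivial_grp) (simp_all add: finite_biset_def)
  qed (simp_all add: comp_frag_diff_right to_left_frag_diff frag_eq_diff)
qed (simp_all add: comp_frag_diff_left to_left_frag_diff frag_extend_diff frag_eq_diff)

text \<open>Composition from the right also becomes composition from the left, with
  \<open>Q \<times> U\<^sup>o\<^sup>p\<close>. Therefore the ideal is closed on both sides for the
  same reason.\<close>

lemma to_left_frag_comp_right:
  assumes y: "is_frag Q P y" and x: "is_frag P S x"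
    and grp: "group Q" "group P" "group S" "finite (carrier Q)"
  shows "frag_eq (left_group Q S) trivial_grp (to_left_frag (comp_frag P y x))
    (comp_frag (left_group Q P) (frag_extend (\<lambda>U. biset_frag (times_op_biset Q U)) x) (to_left_frag y))"
  using y
proof (induction y rule: frag_induction)
  case (one V)
  show ?case using x
  proof (induction x rule: frag_induction)
    case (one U)
    have V: "finite_biset Q P V" and U: "finite_biset P S U"
      using \<open>V \<in> nat_bisets Q P\<close> \<open>U \<in> nat_bisets P S\<close> by (auto simp: in_nat_bisets_iff)
    have left: "to_left_frag (comp_frag P (frag_of V) (frag_of U)) =
      frag_of (biset_to_left (nat_copy (biset_tensor P V U)))" by simp
    have "is_tensor Q P S V U (nat_copy (biset_tensor P V U))"
      by (rule is_tensor_nat_copy[OF V U grp(1-3)])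
    then show ?case
      unfolding left frag_extend_of to_left_frag_of
      using V U grp
      by (intro frag_eq_sym[OF comp_frag_nat] is_tensor_times_op_biset times_op_biset_finite_biset
          biset_to_left_finite_biset group_left_group group_trivial_grp) (simp_all add: finite_biset_def)
  qed (simp_all add: comp_frag_diff_right comp_frag_diff_left to_left_frag_diff frag_extend_diff frag_eq_diff)
qed (simp_all add: comp_frag_diff_left comp_frag_diff_right to_left_frag_diff frag_extend_diff frag_eq_diff)

lemma frag_extend_nat_bisets:
  assumes "is_frag R Q y"
    and "\<And>V. finite_biset R Q V \<Longrightarrow> finite_biset H G (F V)" "group H" "group G"
  shows "is_frag H G (frag_extend (\<lambda>V. biset_frag (F V)) y)"
proof -
  have "nat_copy (F V) \<in> nat_bisets H G" if "V \<in> Poly_Mapping.keys y" for V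
    using that assms by (intro nat_copy_in_nat_bisets) (auto simp: in_nat_bisets_iff[symmetric])
  then show ?thesis by (auto dest!: subsetD[OF keys_frag_extend])
qed

text \<open>What the quotient category takes from the projective plane: a fragment \<open>d\<close>
  that represents \<open>\<delta>\<close>. Its existence is
  \<open>delta_representative_exists\<close>.\<close>

locale delta_representative =
  fixes p :: nat and Xp :: "(vec3 \<Rightarrow> vec3) set set" and d :: "((vec3 \<Rightarrow> vec3) set, unit) biset_frag"
  assumes group_sylow_grp: "group (sylow_grp p Xp)"
    and d_keys: "is_frag (sylow_grp p Xp) trivial_grp d"
    and delta_eq: "delta p Xp = frag_class (sylow_grp p Xp) trivial_grp d"
begin

abbreviation Syl :: "(vec3 \<Rightarrow> vec3) set monoid" where "Syl \<equiv> sylow_grp p Xp"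

text \<open>The preimage of \<open>B_delta2 p Xp Q P\<close> in the free group: fragments that, read
  as left sets, are congruent to some \<open>y \<circ> d\<close>.\<close>

definition delta_ideal :: "'q monoid \<Rightarrow> 'p monoid \<Rightarrow> ('q, 'p) biset_frag set" where
  "delta_ideal Q P = {x. is_frag Q P x \<and>
     (\<exists>y. is_frag (left_group Q P) Syl y \<and>
       frag_eq (left_group Q P) trivial_grp (to_left_frag x) (comp_frag Syl y d))}"

lemma delta_idealI:
  assumes "is_frag Q P x"
    and "is_frag (left_group Q P) Syl y"
    and "frag_eq (left_group Q P) trivial_grp (to_left_frag x) (comp_frag Syl y d)"
  shows "x \<in> delta_ideal Q P"
  using assms by (auto simp: delta_ideal_def)

lemma delta_idealE:
  assumes "x \<in> delta_ideal Q P"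
  obtains y where "is_frag Q P x"
    "is_frag (left_group Q P) Syl y"
    "frag_eq (left_group Q P) trivial_grp (to_left_frag x) (comp_frag Syl y d)"
  using assms by (auto simp: delta_ideal_def)

lemma delta_ideal_keys: "x \<in> delta_ideal Q P \<Longrightarrow> is_frag Q P x"
  by (auto simp: delta_ideal_def)

lemma delta_ideal_zero: "0 \<in> delta_ideal Q P"
  by (rule delta_idealI[of _ _ _ 0]) auto

lemma delta_ideal_diff:
  assumes "x \<in> delta_ideal Q P" "x' \<in> delta_ideal Q P"
  shows "x - x' \<in> delta_ideal Q P"
proof -
  obtain y where y: "is_frag Q P x"
    "is_frag (left_group Q P) Syl y"
    "frag_eq (left_group Q P) trivial_grp (to_left_frag x) (comp_frag Syl y d)"
    using assms(1) by (rule delta_idealE)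
  obtain y' where y': "is_frag Q P x'"
    "is_frag (left_group Q P) Syl y'"
    "frag_eq (left_group Q P) trivial_grp (to_left_frag x') (comp_frag Syl y' d)"
    using assms(2) by (rule delta_idealE)
  show ?thesis
    by (rule delta_idealI[of _ _ _ "y - y'"])
      (use y y' keys_diff[of x x'] keys_diff[of y y'] in
        \<open>auto simp: to_left_frag_diff comp_frag_diff_left intro!: frag_eq_diff\<close>)
qed

lemma delta_ideal_minus: "x \<in> delta_ideal Q P \<Longrightarrow> - x \<in> delta_ideal Q P"
  using delta_ideal_diff[OF delta_ideal_zero, of x] by simp

lemma delta_ideal_add: "x \<in> delta_ideal Q P \<Longrightarrow> x' \<in> delta_ideal Q P \<Longrightarrow> x + x' \<in> delta_ideal Q P"
  using delta_ideal_diff[OF _ delta_ideal_minus, of x Q P x'] by simp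

lemma burnside_rels_delta_ideal:
  assumes "x \<in> burnside_rels Q P"
  shows "x \<in> delta_ideal Q P"
  using to_left_frag_cong[of Q P x 0] assms burnside_rels_keys[OF assms]
  by (intro delta_idealI[of _ _ _ 0]) (auto simp: frag_eq_def)

text \<open>Associativity absorbs the new factor: \<open>(y \<times> P\<^sup>o\<^sup>p) \<circ> (z
  \<circ> d) = ((y \<times> P\<^sup>o\<^sup>p) \<circ> z) \<circ> d\<close>, again of the required
  form.\<close>

lemma delta_ideal_comp_left:
  assumes y: "is_frag R Q y" and x: "x \<in> delta_ideal Q P"
    and grp: "group R" "group Q" "group P" "finite (carrier P)"
  shows "comp_frag Q y x \<in> delta_ideal R P"
proof -
  obtain z where z: "is_frag Q P x"
    "is_frag (left_group Q P) Syl z"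
    "frag_eq (left_group Q P) trivial_grp (to_left_frag x) (comp_frag Syl z d)"
    using x by (rule delta_idealE)
  let ?y = "frag_extend (\<lambda>V. biset_frag (biset_times_op V P)) y"
  note grps = group_left_group grp group_trivial_grp group_sylow_grp
  have y': "is_frag (left_group R P) (left_group Q P) ?y"
    by (rule frag_extend_nat_bisets[OF y]) (auto intro!: grps biset_times_op_finite_biset)
  have "frag_eq (left_group R P) trivial_grp (to_left_frag (comp_frag Q y x))
    (comp_frag (left_group Q P) ?y (to_left_frag x))"
    by (rule to_left_frag_comp_left[OF y z(1) grp])
  also have "frag_eq (left_group R P) trivial_grp \<dots> (comp_frag (left_group Q P) ?y (comp_frag Syl z d))"
    by (intro comp_frag_cong frag_eq_refl z y' grps comp_frag_keys d_keys)
  also have "frag_eq (left_group R P) trivial_grp \<dots> (comp_frag Syl (comp_frag (left_group Q P) ?y z) d)"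
    by (rule frag_eq_sym, intro comp_frag_assoc z y' grps d_keys)
  finally show ?thesis
    by (intro delta_idealI[of _ _ _ "comp_frag (left_group Q P) ?y z"] comp_frag_keys y z y' grps)
qed

lemma delta_ideal_comp_right:
  assumes y: "is_frag P S y" and x: "x \<in> delta_ideal Q P"
    and grp: "group Q" "group P" "group S" "finite (carrier Q)"
  shows "comp_frag P x y \<in> delta_ideal Q S"
proof -
  obtain z where z: "is_frag Q P x"
    "is_frag (left_group Q P) Syl z"
    "frag_eq (left_group Q P) trivial_grp (to_left_frag x) (comp_frag Syl z d)"
    using x by (rule delta_idealE)
  let ?y = "frag_extend (\<lambda>U. biset_frag (times_op_biset Q U)) y"
  note grps = group_left_group grp group_trivial_grp group_sylow_grp
  have y': "is_frag (left_group Q S) (left_group Q P) ?y"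
    by (rule frag_extend_nat_bisets[OF y]) (auto intro!: grps times_op_biset_finite_biset)
  have "frag_eq (left_group Q S) trivial_grp (to_left_frag (comp_frag P x y))
    (comp_frag (left_group Q P) ?y (to_left_frag x))"
    by (rule to_left_frag_comp_right[OF z(1) y grp])
  also have "frag_eq (left_group Q S) trivial_grp \<dots> (comp_frag (left_group Q P) ?y (comp_frag Syl z d))"
    by (intro comp_frag_cong frag_eq_refl z y' grps comp_frag_keys d_keys)
  also have "frag_eq (left_group Q S) trivial_grp \<dots> (comp_frag Syl (comp_frag (left_group Q P) ?y z) d)"
    by (rule frag_eq_sym, intro comp_frag_assoc z y' grps d_keys)
  finally show ?thesis
    by (intro delta_idealI[of _ _ _ "comp_frag (left_group Q P) ?y z"] comp_frag_keys y z y' grps)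
qed

lemma B_delta_eq:
  assumes "group G"
  shows "B_delta p Xp G =
    {frag_class G trivial_grp (comp_frag Syl y d) | y. is_frag G Syl y}"
proof -
  have *: "burnside_comp G Syl trivial_grp (frag_class G Syl y) (frag_class Syl trivial_grp d) =
    frag_class G trivial_grp (comp_frag Syl y d)" if "is_frag G Syl y" for y
    by (intro burnside_comp_frag_class that d_keys assms group_sylow_grp group_trivial_grp)
  have "B_delta p Xp G = (\<lambda>y. burnside_comp G Syl trivial_grp (frag_class G Syl y)
      (frag_class Syl trivial_grp d)) ` {y. is_frag G Syl y}"
    unfolding B_delta_def delta_eq burnside_carrier by blast
  also have "\<dots> = (\<lambda>y. frag_class G trivial_grp (comp_frag Syl y d)) `
      {y. is_frag G Syl y}"
    by (rule image_cong) (simp_all add: *)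
  finally show ?thesis by blast
qed

lemma frag_class_in_B_delta2_iff:
  assumes "is_frag Q P x" "group Q" "group P"
  shows "frag_class Q P x \<in> B_delta2 p Xp Q P \<longleftrightarrow> x \<in> delta_ideal Q P"
  using assms
  by (auto simp: B_delta2_def delta_ideal_def frag_class_closed burnside_to_left_frag_class
      B_delta_eq group_left_group frag_class_eq_iff)

lemma B_delta2_eq:
  assumes "group Q" "group P"
  shows "B_delta2 p Xp Q P = frag_class Q P ` delta_ideal Q P"
proof -
  have "B_delta2 p Xp Q P \<subseteq> frag_class Q P ` {x. is_frag Q P x}"
    by (auto simp: B_delta2_def burnside_carrier)
  then show ?thesis
    using frag_class_in_B_delta2_iff[OF _ assms] frag_class_in_B_delta2_iff[OF delta_ideal_keys assms]
    by blast
qed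

lemma subgroup_B_delta2:
  assumes "group Q" "group P"
  shows "subgroup (B_delta2 p Xp Q P) (burnside Q P)"
proof -
  interpret comm_group "burnside Q P" by (rule comm_group_burnside)
  show ?thesis
    unfolding B_delta2_eq[OF assms]
    by (intro subgroup.intro)
      (auto simp: frag_class_closed[OF delta_ideal_keys] frag_class_mult[OF delta_ideal_keys delta_ideal_keys]
        frag_class_one frag_class_inv[OF delta_ideal_keys]
        intro: imageI delta_ideal_zero delta_ideal_add delta_ideal_minus)
qed

section \<open>Morphisms of the quotient category as classes of fragments\<close>

definition sharp_frag :: "'q monoid \<Rightarrow> 'p monoid \<Rightarrow> ('q, 'p) biset_frag \<Rightarrow> ('q, 'p) sharp" where
  "sharp_frag Q P x = sharp_class p Xp P Q (frag_class Q P x)"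

lemma in_sharp_frag_iff:
  assumes "is_frag Q P x" "group Q" "group P"
  shows "a \<in> sharp_frag Q P x \<longleftrightarrow> (\<exists>i \<in> delta_ideal Q P. a = frag_class Q P (i + x))"
  using assms
  by (auto simp: sharp_frag_def sharp_class_def r_coset_def B_delta2_eq frag_class_mult[OF delta_ideal_keys])

text \<open>A morphism is a coset of cosets. Since the Burnside relations lie in
  \<open>delta_ideal\<close>, the two quotients collapse into one condition.\<close>

lemma sharp_frag_eq_iff:
  assumes x: "is_frag Q P x" and y: "is_frag Q P y"
    and "group Q" "group P"
  shows "sharp_frag Q P x = sharp_frag Q P y \<longleftrightarrow> x - y \<in> delta_ideal Q P"
proof
  assume "sharp_frag Q P x = sharp_frag Q P y"
  moreover have "frag_class Q P x \<in> sharp_frag Q P x"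
    using delta_ideal_zero by (auto simp: in_sharp_frag_iff assms intro!: bexI[of _ 0])
  ultimately obtain i where i: "i \<in> delta_ideal Q P" "frag_eq Q P x (i + y)"
    by (auto simp: in_sharp_frag_iff assms frag_class_eq_iff)
  have "x - (i + y) \<in> delta_ideal Q P"
    using i(2) by (intro burnside_rels_delta_ideal) (simp add: frag_eq_def)
  from delta_ideal_add[OF this i(1)] show "x - y \<in> delta_ideal Q P" by simp
next
  have *: "sharp_frag Q P x \<subseteq> sharp_frag Q P y"
    if xy: "x - y \<in> delta_ideal Q P" "is_frag Q P x"
      "is_frag Q P y" for x y
  proof
    fix a assume "a \<in> sharp_frag Q P x"
    then obtain i where "i \<in> delta_ideal Q P" "a = frag_class Q P (i + x)"
      using in_sharp_frag_iff[OF xy(2) assms(3,4)] by blast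
    then have "i + (x - y) \<in> delta_ideal Q P" "a = frag_class Q P ((i + (x - y)) + y)"
      using that by (auto intro: delta_ideal_add)
    then show "a \<in> sharp_frag Q P y"
      unfolding in_sharp_frag_iff[OF that(3) assms(3,4)] by blast
  qed
  assume "x - y \<in> delta_ideal Q P"
  then show "sharp_frag Q P x = sharp_frag Q P y"
    using *[of x y] *[of y x] delta_ideal_minus[of "x - y" Q P] x y by auto
qed

text \<open>The transfer principle: each congruence proved in the Burnside groups becomes an
  equation between morphisms.\<close>

lemma sharp_frag_cong:
  assumes "frag_eq Q P x y" "is_frag Q P y" "group Q" "group P"
  shows "sharp_frag Q P x = sharp_frag Q P y"
  using assms by (simp add: sharp_frag_def frag_class_eq_iff[THEN iffD2])

lemma sharp_hom_carrier:
  "carrier (sharp_hom p Xp P Q) = sharp_frag Q P ` {x. is_frag Q P x}"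
  by (auto simp: sharp_hom_def carrier_FactGroup burnside_carrier sharp_frag_def sharp_class_def)

lemma comm_group_sharp_hom:
  assumes "group Q" "group P"
  shows "comm_group (sharp_hom p Xp P Q)"
  unfolding sharp_hom_def
  by (rule comm_group.abelian_FactGroup[OF comm_group_burnside subgroup_B_delta2[OF assms]])

lemma sharp_frag_closed:
  "is_frag Q P x \<Longrightarrow> sharp_frag Q P x \<in> carrier (sharp_hom p Xp P Q)"
  by (auto simp: sharp_hom_carrier)

lemma sharp_frag_mult:
  assumes "is_frag Q P x" "is_frag Q P y"
    "group Q" "group P"
  shows "sharp_frag Q P x \<otimes>\<^bsub>sharp_hom p Xp P Q\<^esub> sharp_frag Q P y = sharp_frag Q P (x + y)"
proof -
  interpret normal "B_delta2 p Xp Q P" "burnside Q P"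
    by (intro comm_group.subgroup_imp_normal comm_group_burnside subgroup_B_delta2 assms)
  show ?thesis
    using assms
    by (simp add: sharp_hom_def sharp_frag_def sharp_class_def rcos_sum frag_class_closed frag_class_mult)
qed

lemma sharp_frag_one:
  assumes "group Q" "group P"
  shows "\<one>\<^bsub>sharp_hom p Xp P Q\<^esub> = sharp_frag Q P 0"
proof -
  interpret comm_group "burnside Q P" by (rule comm_group_burnside)
  have "sharp_frag Q P 0 = B_delta2 p Xp Q P"
    using coset_mult_one[OF subgroup.subset[OF subgroup_B_delta2[OF assms]]]
    by (simp add: sharp_frag_def sharp_class_def frag_class_one[symmetric])
  then show ?thesis by (simp add: sharp_hom_def)
qed

lemma sharp_frag_finprod:
  assumes "finite I" "\<And>i. i \<in> I \<Longrightarrow> is_frag Q P (f i)" "group Q" "group P"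
  shows "finprod (sharp_hom p Xp P Q) (\<lambda>i. sharp_frag Q P (f i)) I = sharp_frag Q P (sum f I) \<and>
    is_frag Q P (sum f I)"
proof -
  interpret comm_group "sharp_hom p Xp P Q" by (rule comm_group_sharp_hom[OF assms(3,4)])
  show ?thesis
    using assms(1,2)
  proof (induction I rule: finite_induct)
    case (insert i I)
    then have "is_frag Q P (f i)" "is_frag Q P (sum f I)"
      by simp_all
    then have "is_frag Q P (f i + sum f I)"
      using keys_add[of "f i" "sum f I"] by blast
    moreover have "(\<lambda>i. sharp_frag Q P (f i)) \<in> I \<rightarrow> carrier (sharp_hom p Xp P Q)"
      using insert by (auto intro!: sharp_frag_closed)
    ultimately show ?case
      using insert assms(3,4) by (simp add: sharp_frag_closed sharp_frag_mult)
  qed (simp add: sharp_frag_one assms)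
qed

text \<open>Since \<open>delta_ideal\<close> is a two-sided ideal, all pairs of representatives have
  the same product class, and the union in \<open>sharp_comp\<close> reduces to it. The finiteness
  assumptions are those of the two ideal properties.\<close>

lemma sharp_comp_frag:
  assumes y: "is_frag R Q y" and x: "is_frag Q P x"
    and grp: "group R" "group Q" "group P" and fin: "finite (carrier R)" "finite (carrier P)"
  shows "sharp_comp p Xp P Q R (sharp_frag R Q y) (sharp_frag Q P x) = sharp_frag R P (comp_frag Q y x)"
proof -
  have *: "sharp_class p Xp P R (burnside_comp R Q P b a) = sharp_frag R P (comp_frag Q y x)"
    if ba: "b \<in> sharp_frag R Q y" "a \<in> sharp_frag Q P x" for a b
  proof -
    obtain j where j: "j \<in> delta_ideal R Q" "b = frag_class R Q (j + y)"
      using ba(1) in_sharp_frag_iff[OF y grp(1,2)] by blast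
    obtain i where i: "i \<in> delta_ideal Q P" "a = frag_class Q P (i + x)"
      using ba(2) in_sharp_frag_iff[OF x grp(2,3)] by blast
    have keys: "is_frag R Q (j + y)" "is_frag Q P (i + x)"
      using delta_ideal_keys[OF j(1)] delta_ideal_keys[OF i(1)] x y keys_add[of j y] keys_add[of i x]
      by auto
    \<comment> \<open>Split so that each summand has exactly one factor known to lie in the ideal:
      \<open>j\<close> on the left, \<open>i\<close> on the right.\<close>
    have "comp_frag Q (j + y) (i + x) - comp_frag Q y x = comp_frag Q j (i + x) + comp_frag Q y i"
      by (simp add: comp_frag_add_left comp_frag_add_right)
    also have "\<dots> \<in> delta_ideal R P"
      by (intro delta_ideal_add delta_ideal_comp_left delta_ideal_comp_right i j keys grp fin y)
    finally have "sharp_frag R P (comp_frag Q (j + y) (i + x)) = sharp_frag R P (comp_frag Q y x)"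
      by (subst sharp_frag_eq_iff) (intro comp_frag_keys keys x y grp | simp)+
    then show ?thesis
      using burnside_comp_frag_class[OF keys grp] i j by (simp add: sharp_frag_def)
  qed
  have ne: "sharp_frag R Q y \<noteq> {}" "sharp_frag Q P x \<noteq> {}"
    using in_sharp_frag_iff[OF y grp(1,2)] in_sharp_frag_iff[OF x grp(2,3)] delta_ideal_zero by blast+
  have "sharp_comp p Xp P Q R (sharp_frag R Q y) (sharp_frag Q P x) =
    (\<Union>b \<in> sharp_frag R Q y. \<Union>a \<in> sharp_frag Q P x. sharp_frag R P (comp_frag Q y x))"
    unfolding sharp_comp_def by (intro SUP_cong refl *)
  then show ?thesis using ne by simp
qed

end

section \<open>The action on the projective plane\<close>

context
  fixes p :: nat
  assumes p: "Factorial_Ring.prime p"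
begin

interpretation F: residues_prime p "Fp p"
  using p by unfold_locales simp_all

section \<open>The three-dimensional space over the prime field\<close>

lemma vspace_apply: "v \<in> vspace p \<Longrightarrow> i < 3 \<Longrightarrow> v i \<in> carrier (Fp p)"
  by (auto simp: vspace_def)

lemma vspaceI: "(\<And>i. i < 3 \<Longrightarrow> f i \<in> carrier (Fp p)) \<Longrightarrow> (\<lambda>i\<in>{..<3}. f i) \<in> vspace p"
  by (auto simp: vspace_def)

lemma vspace_eqI: "v \<in> vspace p \<Longrightarrow> w \<in> vspace p \<Longrightarrow> (\<And>i. i < 3 \<Longrightarrow> v i = w i) \<Longrightarrow> v = w"
  unfolding vspace_def by (auto intro: PiE_ext)

lemma finite_vspace: "finite (vspace p)"
  unfolding vspace_def by (intro finite_PiE) (auto simp: F.finite)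

lemma vzero_closed: "vzero p \<in> vspace p"
  unfolding vzero_def by (rule vspaceI) (rule F.zero_closed)

lemma vadd_closed: "v \<in> vspace p \<Longrightarrow> w \<in> vspace p \<Longrightarrow> vadd p v w \<in> vspace p"
  unfolding vadd_def by (rule vspaceI) (simp add: vspace_apply)

lemma vscale_closed: "c \<in> carrier (Fp p) \<Longrightarrow> v \<in> vspace p \<Longrightarrow> vscale p c v \<in> vspace p"
  unfolding vscale_def by (rule vspaceI) (simp add: vspace_apply)

lemma vscale_vscale:
  assumes "c \<in> carrier (Fp p)" "e \<in> carrier (Fp p)" "v \<in> vspace p"
  shows "vscale p c (vscale p e v) = vscale p (c \<otimes>\<^bsub>Fp p\<^esub> e) v"
  using assms by (intro vspace_eqI vscale_closed F.m_closed)
    (auto simp: vscale_def F.m_assoc vspace_apply)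

lemma vscale_one: "v \<in> vspace p \<Longrightarrow> vscale p \<one>\<^bsub>Fp p\<^esub> v = v"
  by (intro vspace_eqI vscale_closed F.one_closed) (auto simp: vscale_def F.l_one vspace_apply)

lemma vscale_zero: "v \<in> vspace p \<Longrightarrow> vscale p \<zero>\<^bsub>Fp p\<^esub> v = vzero p"
  by (intro vspace_eqI vscale_closed vzero_closed F.zero_closed)
    (auto simp: vscale_def vzero_def F.l_null vspace_apply)

lemma vscale_vadd:
  assumes "c \<in> carrier (Fp p)" "v \<in> vspace p" "w \<in> vspace p"
  shows "vscale p c (vadd p v w) = vadd p (vscale p c v) (vscale p c w)"
  using assms by (intro vspace_eqI vscale_closed vadd_closed)
    (auto simp: vscale_def vadd_def F.r_distr vspace_apply)

lemma vscale_inv: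
  assumes "c \<in> carrier (Fp p)" "c \<noteq> \<zero>\<^bsub>Fp p\<^esub>" "v \<in> vspace p"
  shows "inv\<^bsub>Fp p\<^esub> c \<in> carrier (Fp p)" "inv\<^bsub>Fp p\<^esub> c \<noteq> \<zero>\<^bsub>Fp p\<^esub>"
    "vscale p c (vscale p (inv\<^bsub>Fp p\<^esub> c) v) = v" "vscale p (inv\<^bsub>Fp p\<^esub> c) (vscale p c v) = v"
proof -
  have u: "c \<in> Units (Fp p)" using assms by (simp add: F.field_Units)
  show i: "inv\<^bsub>Fp p\<^esub> c \<in> carrier (Fp p)" using u by (rule F.Units_inv_closed)
  show "inv\<^bsub>Fp p\<^esub> c \<noteq> \<zero>\<^bsub>Fp p\<^esub>" using F.Units_inv_Units[OF u] by (simp add: F.field_Units)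
  show "vscale p c (vscale p (inv\<^bsub>Fp p\<^esub> c) v) = v" "vscale p (inv\<^bsub>Fp p\<^esub> c) (vscale p c v) = v"
    using assms i by (simp_all add: vscale_vscale F.Units_r_inv[OF u] F.Units_l_inv[OF u] vscale_one)
qed

section \<open>Linear automorphisms, scalars and the projective group\<close>

lemma GL3_iff:
  "f \<in> carrier (GL3 p) \<longleftrightarrow> f \<in> Bij (vspace p) \<and>
    (\<forall>v \<in> vspace p. \<forall>w \<in> vspace p. f (vadd p v w) = vadd p (f v) (f w)) \<and>
    (\<forall>c \<in> carrier (Fp p). \<forall>v \<in> vspace p. f (vscale p c v) = vscale p c (f v))"
  by (simp add: GL3_def)

lemma GL3_apply: "f \<in> carrier (GL3 p) \<Longrightarrow> v \<in> vspace p \<Longrightarrow> f v \<in> vspace p"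
  using Bij_imp_funcset by (auto simp: GL3_iff)

lemma GL3_inj: "f \<in> carrier (GL3 p) \<Longrightarrow> v \<in> vspace p \<Longrightarrow> w \<in> vspace p \<Longrightarrow> f v = f w \<Longrightarrow> v = w"
  by (auto simp: GL3_iff Bij_def bij_betw_def inj_on_def)

lemma
  assumes "f \<in> carrier (GL3 p)"
  shows GL3_vadd: "v \<in> vspace p \<Longrightarrow> w \<in> vspace p \<Longrightarrow> f (vadd p v w) = vadd p (f v) (f w)"
    and GL3_vscale: "c \<in> carrier (Fp p) \<Longrightarrow> v \<in> vspace p \<Longrightarrow> f (vscale p c v) = vscale p c (f v)"
  using assms by (auto simp: GL3_iff)

lemma GL3_vzero: "f \<in> carrier (GL3 p) \<Longrightarrow> f (vzero p) = vzero p"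
  using GL3_vscale[of f "\<zero>\<^bsub>Fp p\<^esub>" "vzero p"] vscale_zero[OF vzero_closed]
    vscale_zero[OF GL3_apply[OF _ vzero_closed]] F.zero_closed vzero_closed by metis

lemma subgroup_GL3: "subgroup (carrier (GL3 p)) (BijGroup (vspace p))"
proof (rule group.subgroupI[OF group_BijGroup])
  show "carrier (GL3 p) \<subseteq> carrier (BijGroup (vspace p))"
    by (auto simp: GL3_iff BijGroup_def)
  have "(\<lambda>v \<in> vspace p. v) \<in> carrier (GL3 p)"
    by (auto simp: GL3_iff id_Bij vadd_closed vscale_closed)
  then show "carrier (GL3 p) \<noteq> {}" by blast
next
  fix f assume f: "f \<in> carrier (GL3 p)"
  then have fB: "f \<in> Bij (vspace p)" by (simp add: GL3_iff)
  have add: "vadd p \<in> vspace p \<rightarrow> vspace p \<rightarrow> vspace p" by (auto intro: vadd_closed)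
  have sc: "inv_into (vspace p) f (vscale p c v) = vscale p c (inv_into (vspace p) f v)"
    if c: "c \<in> carrier (Fp p)" and v: "v \<in> vspace p" for c v
  proof -
    obtain w where w: "w \<in> vspace p" "v = f w"
      using fB v by (auto simp: Bij_def bij_betw_def)
    then show ?thesis
      using c f fB GL3_vscale[OF f c w(1), symmetric]
      by (simp add: Bij_def bij_betw_def vscale_closed)
  qed
  show "inv\<^bsub>BijGroup (vspace p)\<^esub> f \<in> carrier (GL3 p)"
    unfolding inv_BijGroup[OF fB] GL3_iff
    using Bij_inv_into_lemma[where h = f and g = "vadd p" and S = "vspace p", OF GL3_vadd[OF f] fB add]
      restrict_inv_into_Bij[OF fB] sc
    by (auto simp: vadd_closed vscale_closed)
next
  fix f g assume "f \<in> carrier (GL3 p)" "g \<in> carrier (GL3 p)"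
  then show "f \<otimes>\<^bsub>BijGroup (vspace p)\<^esub> g \<in> carrier (GL3 p)"
    using GL3_apply[of g]
    by (auto simp: GL3_iff BijGroup_def compose_Bij compose_eq vadd_closed vscale_closed)
qed

lemma group_GL3: "group (GL3 p)"
  using subgroup.subgroup_is_group[OF subgroup_GL3 group_BijGroup] by (simp add: GL3_def)

lemma GL3_mult: "f \<in> carrier (GL3 p) \<Longrightarrow> g \<in> carrier (GL3 p) \<Longrightarrow>
    f \<otimes>\<^bsub>GL3 p\<^esub> g = compose (vspace p) f g"
  by (auto simp: GL3_def BijGroup_def)

lemma GL3_one: "\<one>\<^bsub>GL3 p\<^esub> = (\<lambda>v \<in> vspace p. v)"
  by (simp add: GL3_def BijGroup_def)

lemma scalars3_GL3:
  assumes "s \<in> scalars3 p"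
  shows "s \<in> carrier (GL3 p)"
proof -
  obtain c where c: "c \<in> carrier (Fp p)" "c \<noteq> \<zero>\<^bsub>Fp p\<^esub>" "s = (\<lambda>v \<in> vspace p. vscale p c v)"
    using assms by (auto simp: scalars3_def)
  have "bij_betw s (vspace p) (vspace p)"
    by (rule bij_betw_byWitness[where f' = "vscale p (inv\<^bsub>Fp p\<^esub> c)"])
      (use c vscale_inv[OF c(1,2)] in \<open>auto simp: vscale_closed\<close>)
  moreover have "vscale p c (vscale p e v) = vscale p e (vscale p c v)"
    if "e \<in> carrier (Fp p)" "v \<in> vspace p" for e v
    using that c by (simp add: vscale_vscale F.m_comm)
  ultimately show ?thesis
    using c by (auto simp: GL3_iff Bij_def vadd_closed vscale_closed vscale_vadd)
qed

text \<open>Linear maps commute with multiplication by a scalar, so the left and right cosets of the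
  scalars coincide.\<close>

lemma normal_scalars3: "scalars3 p \<lhd> GL3 p"
proof -
  interpret G: group "GL3 p" by (rule group_GL3)
  have comm: "f \<otimes>\<^bsub>GL3 p\<^esub> s = s \<otimes>\<^bsub>GL3 p\<^esub> f" if fs: "f \<in> carrier (GL3 p)" "s \<in> scalars3 p" for f s
  proof -
    obtain c where c: "c \<in> carrier (Fp p)" "c \<noteq> \<zero>\<^bsub>Fp p\<^esub>" "s = (\<lambda>v \<in> vspace p. vscale p c v)"
      using fs by (auto simp: scalars3_def)
    then show ?thesis
      using fs scalars3_GL3[OF fs(2)]
      by (auto simp: GL3_mult compose_def GL3_vscale GL3_apply intro!: restrict_ext)
  qed
  have sub: "subgroup (scalars3 p) (GL3 p)"
  proof (rule G.subgroupI)
    show "scalars3 p \<subseteq> carrier (GL3 p)" using scalars3_GL3 by blast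
    show "scalars3 p \<noteq> {}" using F.one_closed F.one_not_zero by (auto simp: scalars3_def)
  next
    fix s assume s: "s \<in> scalars3 p"
    then obtain c where c: "c \<in> carrier (Fp p)" "c \<noteq> \<zero>\<^bsub>Fp p\<^esub>" "s = (\<lambda>v \<in> vspace p. vscale p c v)"
      by (auto simp: scalars3_def)
    have ic: "inv\<^bsub>Fp p\<^esub> c \<in> carrier (Fp p)" "inv\<^bsub>Fp p\<^esub> c \<noteq> \<zero>\<^bsub>Fp p\<^esub>"
      using vscale_inv[OF c(1,2) vzero_closed] by auto
    let ?t = "\<lambda>v \<in> vspace p. vscale p (inv\<^bsub>Fp p\<^esub> c) v"
    have t: "?t \<in> scalars3 p" using ic by (auto simp: scalars3_def)
    have "inv\<^bsub>GL3 p\<^esub> s = ?t"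
      using s t scalars3_GL3 vscale_inv[OF c(1,2)] ic c
      by (intro G.inv_equality) (auto simp: GL3_mult GL3_one compose_def vscale_closed intro!: restrict_ext)
    then show "inv\<^bsub>GL3 p\<^esub> s \<in> scalars3 p" using t by simp
  next
    fix s t assume st: "s \<in> scalars3 p" "t \<in> scalars3 p"
    then obtain c e where c: "c \<in> carrier (Fp p)" "c \<noteq> \<zero>\<^bsub>Fp p\<^esub>" "s = (\<lambda>v \<in> vspace p. vscale p c v)"
      and e: "e \<in> carrier (Fp p)" "e \<noteq> \<zero>\<^bsub>Fp p\<^esub>" "t = (\<lambda>v \<in> vspace p. vscale p e v)"
      by (auto simp: scalars3_def)
    have "s \<otimes>\<^bsub>GL3 p\<^esub> t = (\<lambda>v \<in> vspace p. vscale p (c \<otimes>\<^bsub>Fp p\<^esub> e) v)"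
      using st scalars3_GL3 c e by (auto simp: GL3_mult compose_def vscale_vscale vscale_closed intro!: restrict_ext)
    moreover have "c \<otimes>\<^bsub>Fp p\<^esub> e \<noteq> \<zero>\<^bsub>Fp p\<^esub>" using c e F.integral by blast
    ultimately show "s \<otimes>\<^bsub>GL3 p\<^esub> t \<in> scalars3 p"
      using c e by (auto simp: scalars3_def)
  qed
  show ?thesis
    by (rule G.normalI[OF sub], unfold r_coset_def l_coset_def, intro ballI SUP_cong refl)
      (metis comm)
qed

lemma group_PGL3: "group (PGL3 p)"
  unfolding PGL3_def by (rule normal.factorgroup_is_group[OF normal_scalars3])

text \<open>The part of being a subspace that lets every nonzero scalar map \<open>W\<close> onto
  itself, and hence lets a class of linear maps act on \<open>W\<close>.\<close>

definition scalar_closed :: "vec3 set \<Rightarrow> bool" where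
  "scalar_closed W \<longleftrightarrow> W \<subseteq> vspace p \<and> (\<forall>c \<in> carrier (Fp p). \<forall>w \<in> W. vscale p c w \<in> W)"

lemma scalars3_image:
  assumes "scalar_closed W" "s \<in> scalars3 p"
  shows "s ` W = W"
proof -
  obtain c where c: "c \<in> carrier (Fp p)" "c \<noteq> \<zero>\<^bsub>Fp p\<^esub>" "s = (\<lambda>v \<in> vspace p. vscale p c v)"
    using assms(2) by (auto simp: scalars3_def)
  have W: "W \<subseteq> vspace p" "\<And>c w. c \<in> carrier (Fp p) \<Longrightarrow> w \<in> W \<Longrightarrow> vscale p c w \<in> W"
    using assms(1) by (auto simp: scalar_closed_def)
  have "w \<in> s ` W" if "w \<in> W" for w
    using that W c vscale_inv[OF c(1,2), of w]
    by (intro image_eqI[of _ _ "vscale p (inv\<^bsub>Fp p\<^esub> c) w"]) auto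
  moreover have "s w \<in> W" if "w \<in> W" for w
    using that W c by auto
  ultimately show ?thesis by blast
qed

lemma scalar_closed_image:
  assumes "scalar_closed W" "f \<in> carrier (GL3 p)"
  shows "scalar_closed (f ` W)"
  using assms GL3_apply[OF assms(2)] GL3_vscale[OF assms(2), symmetric]
  by (auto simp: scalar_closed_def subset_iff)

text \<open>The members of the coset of \<open>f\<close> differ from \<open>f\<close> by a nonzero
  scalar on the left, which maps the image of \<open>W\<close> onto itself. So the union in
  \<open>proj_set\<close> is a union of equal sets.\<close>

lemma PGL3_image:
  assumes "scalar_closed W" "f \<in> carrier (GL3 p)"
  shows "(\<Union>g \<in> scalars3 p #>\<^bsub>GL3 p\<^esub> f. g ` W) = f ` W"
proof -
  have "(s \<otimes>\<^bsub>GL3 p\<^esub> f) ` W = f ` W" if "s \<in> scalars3 p" for s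
  proof -
    have "(s \<otimes>\<^bsub>GL3 p\<^esub> f) ` W = s ` f ` W"
      using assms that scalars3_GL3[OF that]
      by (auto simp: GL3_mult compose_def scalar_closed_def image_image subset_iff intro!: image_cong)
    then show ?thesis
      using scalars3_image[OF scalar_closed_image[OF assms] that] by simp
  qed
  moreover have "scalars3 p \<noteq> {}"
    using normal_imp_subgroup[OF normal_scalars3] subgroup.one_closed by blast
  ultimately show ?thesis by (auto simp: r_coset_def)
qed

lemma is_biset_proj_set:
  assumes S: "\<And>W. W \<in> S \<Longrightarrow> scalar_closed W"
    and cl: "\<And>f W. f \<in> carrier (GL3 p) \<Longrightarrow> W \<in> S \<Longrightarrow> f ` W \<in> S"
  shows "is_biset (PGL3 p) trivial_grp (proj_set S)"
proof (rule is_bisetI)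
  interpret G: group "GL3 p" by (rule group_GL3)
  interpret N: normal "scalars3 p" "GL3 p" by (rule normal_scalars3)
  have car: "carrier (PGL3 p) = (\<lambda>f. scalars3 p #>\<^bsub>GL3 p\<^esub> f) ` carrier (GL3 p)"
    by (simp add: PGL3_def carrier_FactGroup)
  note act = PGL3_image[OF S]
  {
    fix A W assume "A \<in> carrier (PGL3 p)" "W \<in> pts (proj_set S)"
    then show "lact (proj_set S) A W \<in> pts (proj_set S)"
      by (auto simp: car proj_set_def act cl)
  next
    fix W assume W: "W \<in> pts (proj_set S)"
    then have "W \<subseteq> vspace p" using S by (auto simp: proj_set_def scalar_closed_def)
    then have "\<one>\<^bsub>GL3 p\<^esub> ` W = W" by (force simp: GL3_one)
    moreover have "\<one>\<^bsub>PGL3 p\<^esub> = scalars3 p #>\<^bsub>GL3 p\<^esub> \<one>\<^bsub>GL3 p\<^esub>"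
      by (simp add: PGL3_def N.subset)
    ultimately show "lact (proj_set S) \<one>\<^bsub>PGL3 p\<^esub> W = W"
      using W act[of W "\<one>\<^bsub>GL3 p\<^esub>"] by (simp add: proj_set_def)
  next
    fix A B W assume AB: "A \<in> carrier (PGL3 p)" "B \<in> carrier (PGL3 p)" and W: "W \<in> pts (proj_set S)"
    obtain f g where f: "f \<in> carrier (GL3 p)" "A = scalars3 p #>\<^bsub>GL3 p\<^esub> f"
      and g: "g \<in> carrier (GL3 p)" "B = scalars3 p #>\<^bsub>GL3 p\<^esub> g"
      using AB by (auto simp: car)
    have "(f \<otimes>\<^bsub>GL3 p\<^esub> g) ` W = f ` g ` W"
      using f g W S by (auto simp: GL3_mult compose_def proj_set_def scalar_closed_def image_image
          subset_iff intro!: image_cong)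
    moreover have "A \<otimes>\<^bsub>PGL3 p\<^esub> B = scalars3 p #>\<^bsub>GL3 p\<^esub> (f \<otimes>\<^bsub>GL3 p\<^esub> g)"
      using f g by (simp add: PGL3_def N.rcos_sum)
    ultimately show "lact (proj_set S) (A \<otimes>\<^bsub>PGL3 p\<^esub> B) W = lact (proj_set S) A (lact (proj_set S) B W)"
      using f g W by (simp add: proj_set_def act cl)
  }
qed (auto simp: proj_set_def)

section \<open>Points and lines are permuted by the linear automorphisms\<close>

lemma proj_points_image:
  assumes f: "f \<in> carrier (GL3 p)" and "W \<in> proj_points p"
  shows "f ` W \<in> proj_points p"
proof -
  obtain v where v: "W = {vscale p a v | a. a \<in> carrier (Fp p)}" "v \<in> vspace p" "v \<noteq> vzero p"
    using assms(2) by (auto simp: proj_points_def)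
  have "f ` W = {vscale p a (f v) | a. a \<in> carrier (Fp p)}"
    using v by (auto simp: GL3_vscale[OF f] image_iff) (metis GL3_vscale[OF f])
  moreover have "f v \<noteq> vzero p"
    using v GL3_vzero[OF f] GL3_inj[OF f v(2) vzero_closed] by auto
  ultimately show ?thesis
    using GL3_apply[OF f v(2)] by (auto simp: proj_points_def)
qed

lemma proj_lines_image:
  assumes f: "f \<in> carrier (GL3 p)" and "W \<in> proj_lines p"
  shows "f ` W \<in> proj_lines p"
proof -
  let ?R = "carrier (Fp p)"
  obtain v w where W: "W = {vadd p (vscale p a v) (vscale p b w) | a b. a \<in> ?R \<and> b \<in> ?R}"
    and v: "v \<in> vspace p" and w: "w \<in> vspace p"
    and ind: "\<forall>a \<in> ?R. \<forall>b \<in> ?R. vadd p (vscale p a v) (vscale p b w) = vzero p \<longrightarrow>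
      a = \<zero>\<^bsub>Fp p\<^esub> \<and> b = \<zero>\<^bsub>Fp p\<^esub>"
    using assms(2) by (auto simp: proj_lines_def)
  have fc: "f (vadd p (vscale p a v) (vscale p b w)) = vadd p (vscale p a (f v)) (vscale p b (f w))"
    if "a \<in> ?R" "b \<in> ?R" for a b
    using that v w by (simp add: GL3_vadd[OF f] GL3_vscale[OF f] vscale_closed)
  have "f ` W = {f (vadd p (vscale p a v) (vscale p b w)) | a b. a \<in> ?R \<and> b \<in> ?R}"
    unfolding W by blast
  also have "\<dots> = {vadd p (vscale p a (f v)) (vscale p b (f w)) | a b. a \<in> ?R \<and> b \<in> ?R}"
    by (rule Collect_cong) (metis fc)
  finally have 1: "f ` W = \<dots>" .
  have 2: "a = \<zero>\<^bsub>Fp p\<^esub> \<and> b = \<zero>\<^bsub>Fp p\<^esub>"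
    if "a \<in> ?R" "b \<in> ?R" "vadd p (vscale p a (f v)) (vscale p b (f w)) = vzero p" for a b
  proof -
    have "f (vadd p (vscale p a v) (vscale p b w)) = f (vzero p)"
      using that by (simp add: fc GL3_vzero[OF f])
    then have "vadd p (vscale p a v) (vscale p b w) = vzero p"
      by (rule GL3_inj[OF f, rotated -1]) (intro vadd_closed vscale_closed that v w vzero_closed)+
    then show ?thesis using ind that by blast
  qed
  show ?thesis
    unfolding proj_lines_def
    using 1 2 GL3_apply[OF f v] GL3_apply[OF f w] by blast
qed

lemma proj_points_scalar_closed:
  assumes "W \<in> proj_points p"
  shows "scalar_closed W"
proof -
  obtain v where v: "W = {vscale p a v | a. a \<in> carrier (Fp p)}" "v \<in> vspace p" "v \<noteq> vzero p"
    using assms by (auto simp: proj_points_def)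
  then show ?thesis
    by (auto simp: scalar_closed_def vscale_closed vscale_vscale)
qed

lemma proj_lines_scalar_closed:
  assumes "W \<in> proj_lines p"
  shows "scalar_closed W"
proof -
  obtain v w where W: "W = {vadd p (vscale p a v) (vscale p b w) | a b.
      a \<in> carrier (Fp p) \<and> b \<in> carrier (Fp p)}" and v: "v \<in> vspace p" and w: "w \<in> vspace p"
    using assms by (auto simp: proj_lines_def)
  have "vscale p c (vadd p (vscale p a v) (vscale p b w)) =
      vadd p (vscale p (c \<otimes>\<^bsub>Fp p\<^esub> a) v) (vscale p (c \<otimes>\<^bsub>Fp p\<^esub> b) w)"
    if "a \<in> carrier (Fp p)" "b \<in> carrier (Fp p)" "c \<in> carrier (Fp p)" for a b c
    using that v w by (simp add: vscale_vadd vscale_vscale vscale_closed)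
  moreover have "W \<subseteq> vspace p"
    using v w by (auto simp: W vscale_closed vadd_closed)
  ultimately show ?thesis
    unfolding scalar_closed_def W using F.m_closed by blast
qed

lemma is_biset_sylow_grp:
  assumes "is_biset (PGL3 p) trivial_grp U" "Xp \<subseteq> carrier (PGL3 p)"
  shows "is_biset (sylow_grp p Xp) trivial_grp U"
  using assms unfolding is_biset_def sylow_grp_def by (auto simp: subset_iff)

lemma finite_biset_proj_set:
  assumes "Xp \<subseteq> carrier (PGL3 p)"
  shows "finite_biset (sylow_grp p Xp) trivial_grp (proj_set (proj_points p))"
    "finite_biset (sylow_grp p Xp) trivial_grp (proj_set (proj_lines p))"
proof -
  have "proj_points p \<subseteq> Pow (vspace p)" "proj_lines p \<subseteq> Pow (vspace p)"
    using proj_points_scalar_closed proj_lines_scalar_closed by (auto simp: scalar_closed_def)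
  then have "finite (proj_points p)" "finite (proj_lines p)"
    using finite_vspace by (auto intro: finite_subset)
  moreover have "is_biset (PGL3 p) trivial_grp (proj_set (proj_points p))"
    by (intro is_biset_proj_set proj_points_scalar_closed proj_points_image)
  moreover have "is_biset (PGL3 p) trivial_grp (proj_set (proj_lines p))"
    by (intro is_biset_proj_set proj_lines_scalar_closed proj_lines_image)
  ultimately show "finite_biset (sylow_grp p Xp) trivial_grp (proj_set (proj_points p))"
    "finite_biset (sylow_grp p Xp) trivial_grp (proj_set (proj_lines p))"
    using is_biset_sylow_grp[OF _ assms] by (simp_all add: finite_biset_def) (simp_all add: proj_set_def)
qed

text \<open>The fragment is \<open>\<L> - \<P>\<close> with the sets of lines and of points. What
  has to be known is that both are finite sets with an action of the subgroup, so that their copies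
  are generators of the Burnside group.\<close>

lemma delta_representative_exists:
  assumes "subgroup Xp (PGL3 p)"
  shows "\<exists>d. delta_representative p Xp d"
proof -
  have G: "group (sylow_grp p Xp)"
    unfolding sylow_grp_def by (rule subgroup.subgroup_is_group[OF assms group_PGL3])
  let ?L = "biset_frag (proj_set (proj_lines p)) :: ((vec3 \<Rightarrow> vec3) set, unit) biset_frag"
  let ?P = "biset_frag (proj_set (proj_points p)) :: ((vec3 \<Rightarrow> vec3) set, unit) biset_frag"
  have L: "is_frag (sylow_grp p Xp) trivial_grp ?L"
    and P: "is_frag (sylow_grp p Xp) trivial_grp ?P"
    using finite_biset_proj_set[OF subgroup.subset[OF assms]] G
    by (simp_all add: nat_copy_in_nat_bisets)
  have "delta_representative p Xp (?L + - ?P)"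
  proof (rule delta_representative.intro)
    show "group (sylow_grp p Xp)" by (rule G)
    show "is_frag (sylow_grp p Xp) trivial_grp (?L + - ?P)"
      using L P keys_add[of ?L "- ?P"] by auto
    show "delta p Xp = frag_class (sylow_grp p Xp) trivial_grp (?L + - ?P)"
      unfolding delta_def biset_class_def frag_class_inv[OF P]
      using L P by (intro frag_class_mult) auto
  qed
  then show ?thesis ..
qed

end

section \<open>Moebius inversion for normal subgroups\<close>

text \<open>The defining recursion, with the term for \<open>C = B\<close> moved to the other
  side.\<close>

lemma moebius_sum_upper:
  assumes "A \<in> S" "B \<in> S" "A \<subseteq> B" "finite B"
  shows "(\<Sum>C \<in> {C \<in> S. A \<subseteq> C \<and> C \<subseteq> B}. moebius S A C) = (if A = B then 1 else 0)"
proof (cases "A = B")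
  case True
  then have "{C \<in> S. A \<subseteq> C \<and> C \<subseteq> B} = {B}" using assms by auto
  then show ?thesis using True by (simp add: moebius.simps[of S B B])
next
  case False
  have fin: "finite {C \<in> S. A \<subseteq> C \<and> C \<subset> B}"
    by (rule finite_subset[of _ "Pow B"]) (use assms in auto)
  have "{C \<in> S. A \<subseteq> C \<and> C \<subseteq> B} = insert B {C \<in> S. A \<subseteq> C \<and> C \<subset> B}"
    using assms by auto
  then have "(\<Sum>C \<in> {C \<in> S. A \<subseteq> C \<and> C \<subseteq> B}. moebius S A C) =
    moebius S A B + (\<Sum>C \<in> {C \<in> S. A \<subseteq> C \<and> C \<subset> B}. moebius S A C)"
    using fin by simp
  then show ?thesis
    using assms False by (simp add: moebius.simps[of S A B] psubset_eq)
qed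

text \<open>A right inverse of the zeta function of a finite poset is also a left inverse.\<close>

lemma moebius_sum_lower:
  fixes \<nu> :: "'b set \<Rightarrow> 'b set \<Rightarrow> int"
  assumes S: "finite S" "\<And>A. A \<in> S \<Longrightarrow> finite A"
    and \<nu>: "\<And>A B. A \<in> S \<Longrightarrow> B \<in> S \<Longrightarrow> A \<subseteq> B \<Longrightarrow>
      (\<Sum>C \<in> {C \<in> S. A \<subseteq> C \<and> C \<subseteq> B}. \<nu> A C) = (if A = B then 1 else 0)"
    and A: "A \<in> S" and B: "B \<in> S" and "A \<subseteq> B"
  shows "(\<Sum>C \<in> {C \<in> S. A \<subseteq> C \<and> C \<subseteq> B}. \<nu> C B) = (if A = B then 1 else 0)"
  using A \<open>A \<subseteq> B\<close>
proof (induction "card (B - A)" arbitrary: A rule: less_induct)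
  case less
  define g where "g A = (\<Sum>C \<in> {C \<in> S. A \<subseteq> C \<and> C \<subseteq> B}. \<nu> C B)" for A
  have \<nu>1: "\<nu> A A = 1" if "A \<in> S" for A
  proof -
    have "{C \<in> S. A \<subseteq> C \<and> C \<subseteq> A} = {A}" using that by auto
    then show ?thesis using \<nu>[OF that that] by simp
  qed
  have gC: "g C = (if C = B then 1 else 0)" if "C \<in> S" "A \<subset> C" "C \<subseteq> B" for C
  proof -
    have "B - C \<subset> B - A" using that by blast
    then have "card (B - C) < card (B - A)" using S(2)[OF B] by (intro psubset_card_mono) auto
    from less(1)[OF this that(1,3)] show ?thesis by (simp add: g_def)
  qed
  let ?I = "{C \<in> S. A \<subseteq> C \<and> C \<subseteq> B}"
  have I: "finite ?I" using S by simp
  \<comment> \<open>The sum of \<open>\<nu> A C * g C\<close> is evaluated twice. Exchanging the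
    order of summation and using the hypothesis on \<open>\<nu>\<close> gives
    \<open>\<nu> A B\<close>. By induction \<open>g\<close> is known for all \<open>C\<close>
    properly above \<open>A\<close>, which gives \<open>g A\<close>, plus \<open>\<nu> A B\<close>
    if \<open>A \<noteq> B\<close>. Comparison determines \<open>g A\<close>.\<close>
  have "(\<Sum>C\<in>?I. \<nu> A C * g C) = (\<Sum>C\<in>?I. \<Sum>D\<in>{D \<in> S. C \<subseteq> D \<and> D \<subseteq> B}. \<nu> A C * \<nu> D B)"
    by (simp add: g_def sum_distrib_left)
  also have "\<dots> = (\<Sum>C\<in>?I. \<Sum>D\<in>{D \<in> ?I. C \<subseteq> D}. \<nu> A C * \<nu> D B)"
    by (intro sum.cong refl) auto
  also have "\<dots> = (\<Sum>D\<in>?I. \<Sum>C\<in>{C \<in> ?I. C \<subseteq> D}. \<nu> A C * \<nu> D B)"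
    by (rule sum.swap_restrict[OF I I])
  also have "\<dots> = (\<Sum>D\<in>?I. (\<Sum>C\<in>{C \<in> S. A \<subseteq> C \<and> C \<subseteq> D}. \<nu> A C) * \<nu> D B)"
    unfolding sum_distrib_right by (intro sum.cong refl) auto
  also have "\<dots> = (\<Sum>D\<in>?I. (if A = D then 1 else 0) * \<nu> D B)"
    using less.prems by (intro sum.cong refl arg_cong2[of _ _ _ _ "(*)"] \<nu>) auto
  also have "\<dots> = (\<Sum>D\<in>?I. if A = D then \<nu> D B else 0)"
    by (intro sum.cong) auto
  also have "\<dots> = \<nu> A B"
    using less.prems I by (simp add: sum.delta)
  finally have *: "(\<Sum>C\<in>?I. \<nu> A C * g C) = \<nu> A B" .
  have "?I = insert A {C \<in> S. A \<subset> C \<and> C \<subseteq> B}" using less.prems by auto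
  moreover have "finite {C \<in> S. A \<subset> C \<and> C \<subseteq> B}" using S by simp
  ultimately have "(\<Sum>C\<in>?I. \<nu> A C * g C) = \<nu> A A * g A + (\<Sum>C\<in>{C \<in> S. A \<subset> C \<and> C \<subseteq> B}. \<nu> A C * g C)"
    by simp
  also have "(\<Sum>C\<in>{C \<in> S. A \<subset> C \<and> C \<subseteq> B}. \<nu> A C * g C) =
    (\<Sum>C\<in>{C \<in> S. A \<subset> C \<and> C \<subseteq> B}. if C = B then \<nu> A C else 0)"
    by (intro sum.cong) (auto simp: gC)
  also have "\<dots> = (if A = B then 0 else \<nu> A B)"
    using \<open>finite {C \<in> S. A \<subset> C \<and> C \<subseteq> B}\<close> B less.prems by (auto simp: sum.delta)
  finally have "g A = (if A = B then 1 else 0)"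
    using * \<nu>1[OF less.prems(1)] by (auto split: if_splits)
  then show ?case by (simp add: g_def)
qed

section \<open>The lattice of normal subgroups, with joins given by products\<close>

lemma normal_subset: "N \<lhd> G \<Longrightarrow> N \<subseteq> carrier G"
  by (simp add: normal_imp_subgroup subgroup.subset)

lemma normal_one: "N \<lhd> G \<Longrightarrow> \<one>\<^bsub>G\<^esub> \<in> N"
  by (simp add: normal_imp_subgroup subgroup.one_closed)

lemma normal_closed_mult: "N \<lhd> G \<Longrightarrow> x \<in> N \<Longrightarrow> y \<in> N \<Longrightarrow> x \<otimes>\<^bsub>G\<^esub> y \<in> N"
  by (simp add: normal_imp_subgroup subgroup.m_closed)

lemma finite_normal: "finite (carrier G) \<Longrightarrow> N \<lhd> G \<Longrightarrow> finite N"
  using normal_subset finite_subset by metis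

lemma finite_normals: "finite (carrier G) \<Longrightarrow> finite {N. N \<lhd> G}"
  by (rule finite_subset[of _ "Pow (carrier G)"]) (auto dest: normal_subset)

lemma normal_set_mult: "K \<lhd> G \<Longrightarrow> M \<lhd> G \<Longrightarrow> K <#>\<^bsub>G\<^esub> M \<lhd> G"
  using group.normal_subgroup_set_mult_closed normal.axioms(2) by blast

lemma in_set_mult_iff: "x \<in> K <#>\<^bsub>G\<^esub> M \<longleftrightarrow> (\<exists>k\<in>K. \<exists>m\<in>M. x = k \<otimes>\<^bsub>G\<^esub> m)"
  by (auto simp: set_mult_def)

lemma normal_set_mult_upper:
  assumes "K \<lhd> G" "M \<lhd> G"
  shows "K \<subseteq> K <#>\<^bsub>G\<^esub> M" "M \<subseteq> K <#>\<^bsub>G\<^esub> M"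
proof -
  interpret group G using assms normal.axioms(2) by blast
  have "k = k \<otimes>\<^bsub>G\<^esub> \<one>\<^bsub>G\<^esub>" "k = \<one>\<^bsub>G\<^esub> \<otimes>\<^bsub>G\<^esub> k" if "k \<in> carrier G" for k using that by auto
  then show "K \<subseteq> K <#>\<^bsub>G\<^esub> M" "M \<subseteq> K <#>\<^bsub>G\<^esub> M"
    using normal_subset[OF assms(1)] normal_subset[OF assms(2)] normal_one[OF assms(1)]
      normal_one[OF assms(2)] unfolding in_set_mult_iff subset_iff by blast+
qed

lemma normal_set_mult_least:
  assumes "L \<lhd> G" "K \<subseteq> L" "M \<subseteq> L"
  shows "K <#>\<^bsub>G\<^esub> M \<subseteq> L"
  using assms normal_closed_mult[OF assms(1)] by (auto simp: in_set_mult_iff subset_iff)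

text \<open>Weisner's theorem.\<close>

lemma moebius_sum_set_mult_eq_0:
  assumes fin: "finite (carrier G)" and M: "M \<lhd> G" "M \<noteq> {\<one>\<^bsub>G\<^esub>}" and L: "L \<lhd> G"
  shows "(\<Sum>K \<in> {K. K \<lhd> G \<and> K <#>\<^bsub>G\<^esub> M = L}. moebius {N. N \<lhd> G} {\<one>\<^bsub>G\<^esub>} K) = 0"
  using L
proof (induction "card L" arbitrary: L rule: less_induct)
  case less
  interpret group G using M(1) normal.axioms(2) by blast
  let ?S = "{N. N \<lhd> G}"
  let ?\<mu> = "moebius ?S {\<one>\<^bsub>G\<^esub>}"
  show ?case
  proof (cases "M \<subseteq> L")
    case False
    then have empty: "{K. K \<lhd> G \<and> K <#>\<^bsub>G\<^esub> M = L} = {}"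
      using normal_set_mult_upper(2)[OF _ M(1)] by auto
    show ?thesis unfolding empty by simp
  next
    case True
    have "L \<noteq> {\<one>\<^bsub>G\<^esub>}" using True M normal_one[OF M(1)] by auto
    have finL: "finite L" by (rule finite_normal[OF fin less.prems])
    let ?A = "{K \<in> ?S. {\<one>\<^bsub>G\<^esub>} \<subseteq> K \<and> K \<subseteq> L}"
    let ?T = "{L' \<in> ?S. L' \<subseteq> L}"
    have finA: "finite ?A" "finite ?T" using finite_normals[OF fin] by (auto intro: finite_subset)
    \<comment> \<open>As \<open>L\<close> contains the nontrivial \<open>M\<close>, the sum of \<mu>
      over all \<open>K \<subseteq> L\<close> vanishes. It is sorted by the product
      \<open>L' = KM\<close>, again contained in \<open>L\<close>. The groups with \<open>L'\<close>
      properly inside \<open>L\<close> vanish by induction, so the one for \<open>L\<close> vanishes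
      too.\<close>
    have "0 = (\<Sum>K\<in>?A. ?\<mu> K)"
      using \<open>L \<noteq> {\<one>\<^bsub>G\<^esub>}\<close> one_is_normal less.prems normal_one[OF less.prems] finL
      by (subst moebius_sum_upper) auto
    also have "\<dots> = (\<Sum>L'\<in>?T. \<Sum>K\<in>{K \<in> ?A. K <#>\<^bsub>G\<^esub> M = L'}. ?\<mu> K)"
      using normal_set_mult[OF _ M(1)] normal_set_mult_least[OF less.prems _ True]
      by (intro sum.group[symmetric] finA) auto
    also have "\<dots> = (\<Sum>L'\<in>?T. \<Sum>K\<in>{K. K \<lhd> G \<and> K <#>\<^bsub>G\<^esub> M = L'}. ?\<mu> K)"
      using normal_set_mult_upper(1)[OF _ M(1)] normal_one
      by (intro sum.cong refl Collect_cong) blast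
    also have "\<dots> = (\<Sum>L'\<in>?T. if L' = L then (\<Sum>K\<in>{K. K \<lhd> G \<and> K <#>\<^bsub>G\<^esub> M = L}. ?\<mu> K) else 0)"
    proof (intro sum.cong refl)
      fix L' assume "L' \<in> ?T"
      moreover have "card L' < card L" if "L' \<noteq> L"
        using that \<open>L' \<in> ?T\<close> finL by (intro psubset_card_mono) auto
      ultimately show "(\<Sum>K\<in>{K. K \<lhd> G \<and> K <#>\<^bsub>G\<^esub> M = L'}. ?\<mu> K) =
        (if L' = L then (\<Sum>K\<in>{K. K \<lhd> G \<and> K <#>\<^bsub>G\<^esub> M = L}. ?\<mu> K) else 0)"
        using less.hyps[of L'] by auto
    qed
    also have "\<dots> = (\<Sum>K\<in>{K. K \<lhd> G \<and> K <#>\<^bsub>G\<^esub> M = L}. ?\<mu> K)"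
      using finA less.prems by (simp add: sum.delta)
    finally show ?thesis by simp
  qed
qed

section \<open>Normal subgroups of quotient groups\<close>

lemma FactGroup_hom: "N \<lhd> G \<Longrightarrow> (\<lambda>x. N #>\<^bsub>G\<^esub> x) \<in> hom G (G Mod N)"
  by (rule normal.r_coset_hom_Mod)

lemma group_FactGroup: "N \<lhd> G \<Longrightarrow> group (G Mod N)"
  by (rule normal.factorgroup_is_group)

lemma r_coset_eq_iff:
  assumes "N \<lhd> G" "x \<in> carrier G" "y \<in> carrier G"
  shows "N #>\<^bsub>G\<^esub> x = N #>\<^bsub>G\<^esub> y \<longleftrightarrow> x \<otimes>\<^bsub>G\<^esub> inv\<^bsub>G\<^esub> y \<in> N"
proof -
  interpret normal N G by fact
  show ?thesis
    using rcos_module[OF group_axioms assms(3,2)] repr_independence[of x N y] rcos_self[of x N] assms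
      is_subgroup by metis
qed

lemma r_coset_in_image_iff:
  assumes N: "N \<lhd> G" and K: "K \<lhd> G" and "N \<subseteq> K" "x \<in> carrier G"
  shows "N #>\<^bsub>G\<^esub> x \<in> (\<lambda>x. N #>\<^bsub>G\<^esub> x) ` K \<longleftrightarrow> x \<in> K"
proof
  assume "N #>\<^bsub>G\<^esub> x \<in> (\<lambda>x. N #>\<^bsub>G\<^esub> x) ` K"
  then obtain k where k: "k \<in> K" "N #>\<^bsub>G\<^esub> x = N #>\<^bsub>G\<^esub> k" by blast
  interpret normal N G by fact
  have kG: "k \<in> carrier G" using k normal_subset[OF K] by blast
  have "x \<otimes>\<^bsub>G\<^esub> inv\<^bsub>G\<^esub> k \<in> K" using r_coset_eq_iff[OF N assms(4) kG] k assms(3) by blast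
  then have "x \<otimes>\<^bsub>G\<^esub> inv\<^bsub>G\<^esub> k \<otimes>\<^bsub>G\<^esub> k \<in> K" using normal_closed_mult[OF K] k by blast
  then show "x \<in> K" using kG assms(4) by (simp add: m_assoc)
qed blast

lemma normal_FactGroup_image:
  assumes "N \<lhd> G" "K \<lhd> G"
  shows "(\<lambda>x. N #>\<^bsub>G\<^esub> x) ` K \<lhd> G Mod N"
proof -
  have "group_hom G (G Mod N) (\<lambda>x. N #>\<^bsub>G\<^esub> x)"
    using assms FactGroup_hom group_FactGroup normal.axioms(2)
    by (auto simp: group_hom_def group_hom_axioms_def)
  then show ?thesis
    by (rule normal.surj_hom_normal_subgroup[OF assms(2)]) (simp add: carrier_FactGroup)
qed

text \<open>The correspondence theorem, with preimages under the quotient map as inverse. It serves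
  to compare Moebius sums in \<open>G\<close> and \<open>G/N\<close>, and to reindex the sum that
  defines the edge of \<open>G/N\<close>.\<close>

lemma bij_betw_FactGroup_normal:
  assumes N: "N \<lhd> G"
  shows "bij_betw (\<lambda>K. (\<lambda>x. N #>\<^bsub>G\<^esub> x) ` K) {K. K \<lhd> G \<and> N \<subseteq> K} {M. M \<lhd> G Mod N}"
proof (rule bij_betw_byWitness[where f' = "\<lambda>M. {x \<in> carrier G. N #>\<^bsub>G\<^esub> x \<in> M}"])
  interpret normal N G by fact
  show "\<forall>K\<in>{K. K \<lhd> G \<and> N \<subseteq> K}. {x \<in> carrier G. N #>\<^bsub>G\<^esub> x \<in> (\<lambda>x. N #>\<^bsub>G\<^esub> x) ` K} = K"
  proof
    fix K assume "K \<in> {K. K \<lhd> G \<and> N \<subseteq> K}"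
    then have K: "K \<lhd> G" "N \<subseteq> K" by auto
    show "{x \<in> carrier G. N #>\<^bsub>G\<^esub> x \<in> (\<lambda>x. N #>\<^bsub>G\<^esub> x) ` K} = K"
      using r_coset_in_image_iff[OF N K] normal_subset[OF K(1)] by blast
  qed
  show "\<forall>M\<in>{M. M \<lhd> G Mod N}. (\<lambda>x. N #>\<^bsub>G\<^esub> x) ` {x \<in> carrier G. N #>\<^bsub>G\<^esub> x \<in> M} = M"
  proof safe
    fix M y assume M: "M \<lhd> G Mod N" and y: "y \<in> M"
    have "y \<in> carrier (G Mod N)" using normal_subset[OF M] y by blast
    then obtain x where "x \<in> carrier G" "y = N #>\<^bsub>G\<^esub> x" by (auto simp: carrier_FactGroup)
    then show "y \<in> (\<lambda>x. N #>\<^bsub>G\<^esub> x) ` {x \<in> carrier G. N #>\<^bsub>G\<^esub> x \<in> M}"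
      using y by blast
  qed
  show "(\<lambda>K. (\<lambda>x. N #>\<^bsub>G\<^esub> x) ` K) ` {K. K \<lhd> G \<and> N \<subseteq> K} \<subseteq> {M. M \<lhd> G Mod N}"
    using normal_FactGroup_image[OF N] by blast
  show "(\<lambda>M. {x \<in> carrier G. N #>\<^bsub>G\<^esub> x \<in> M}) ` {M. M \<lhd> G Mod N} \<subseteq> {K. K \<lhd> G \<and> N \<subseteq> K}"
  proof safe
    fix M assume M: "M \<lhd> G Mod N"
    show "{x \<in> carrier G. N #>\<^bsub>G\<^esub> x \<in> M} \<lhd> G"
      using factgroup_subgroup_union_normal[OF M] factgroup_subgroup_union_char[OF normal_imp_subgroup[OF M]]
      by simp
    fix x assume "x \<in> N"
    then show "N #>\<^bsub>G\<^esub> x \<in> M" "x \<in> carrier G"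
      using normal_one[OF M] by (auto simp: coset_join2 is_subgroup)
  qed
qed

lemma FactGroup_image_subset_iff:
  assumes "N \<lhd> G" "K \<lhd> G" "L \<lhd> G" "N \<subseteq> L"
  shows "(\<lambda>x. N #>\<^bsub>G\<^esub> x) ` K \<subseteq> (\<lambda>x. N #>\<^bsub>G\<^esub> x) ` L \<longleftrightarrow> K \<subseteq> L"
  using r_coset_in_image_iff[OF assms(1,3,4)] normal_subset[OF assms(2)] by blast

text \<open>The coefficient of \<open>[P/K]\<close> in the \<open>N\<close>-th summand is \<open>\<mu>(\<one>, K/N)\<close>, computed in \<open>P/N\<close>.\<close>

lemma moebius_FactGroup_sum:
  assumes fin: "finite (carrier G)" and K: "K \<lhd> G"
  shows "(\<Sum>N \<in> {N. N \<lhd> G \<and> N \<subseteq> K}. moebius {M. M \<lhd> G Mod N} {\<one>\<^bsub>G Mod N\<^esub>}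
      ((\<lambda>x. N #>\<^bsub>G\<^esub> x) ` K)) = (if K = {\<one>\<^bsub>G\<^esub>} then 1 else 0)"
proof -
  interpret group G using K normal.axioms(2) by blast
  let ?q = "\<lambda>N. (\<lambda>x. N #>\<^bsub>G\<^esub> x)"
  define \<nu> where "\<nu> N K = moebius {M. M \<lhd> G Mod N} {\<one>\<^bsub>G Mod N\<^esub>} (?q N ` K)" for N K
  have one: "{\<one>\<^bsub>G Mod N\<^esub>} = ?q N ` N" if "N \<lhd> G" for N
    using normal_one[OF that] normal_imp_subgroup[OF that] normal_subset[OF that]
    by (auto simp: coset_join2 image_iff subset_iff intro!: bexI[of _ "\<one>\<^bsub>G\<^esub>"])
  \<comment> \<open>\<open>\<nu>\<close> is a right inverse of the zeta function: for fixed
    \<open>A\<close> all its values come from the single group \<open>G/A\<close>, and the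
    correspondence theorem turns the interval from \<open>A\<close> to \<open>B\<close> into the one
    from the trivial subgroup to \<open>B/A\<close>.\<close>
  have \<nu>: "(\<Sum>C \<in> {C \<in> {N. N \<lhd> G}. A \<subseteq> C \<and> C \<subseteq> B}. \<nu> A C) = (if A = B then 1 else 0)"
    if A: "A \<in> {N. N \<lhd> G}" and B: "B \<in> {N. N \<lhd> G}" and "A \<subseteq> B" for A B
  proof -
    have A': "A \<lhd> G" and B': "B \<lhd> G" using A B by auto
    have "finite (carrier (G Mod A))" by (simp add: carrier_FactGroup fin)
    then have finB: "finite (?q A ` B)" using finite_normal[OF fin B'] by simp
    note iff = FactGroup_image_subset_iff[OF A']
    have "(\<Sum>C \<in> {C \<in> {N. N \<lhd> G}. A \<subseteq> C \<and> C \<subseteq> B}. \<nu> A C) =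
      (\<Sum>M \<in> {M \<in> {M. M \<lhd> G Mod A}. {\<one>\<^bsub>G Mod A\<^esub>} \<subseteq> M \<and> M \<subseteq> ?q A ` B}.
        moebius {M. M \<lhd> G Mod A} {\<one>\<^bsub>G Mod A\<^esub>} M)"
      unfolding \<nu>_def
    proof (rule sum.reindex_bij_betw)
      show "bij_betw (\<lambda>K. ?q A ` K) {C \<in> {N. N \<lhd> G}. A \<subseteq> C \<and> C \<subseteq> B}
        {M \<in> {M. M \<lhd> G Mod A}. {\<one>\<^bsub>G Mod A\<^esub>} \<subseteq> M \<and> M \<subseteq> ?q A ` B}"
      proof (rule bij_betw_subset[OF bij_betw_FactGroup_normal[OF A']])
        show "(\<lambda>K. ?q A ` K) ` {C \<in> {N. N \<lhd> G}. A \<subseteq> C \<and> C \<subseteq> B} =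
          {M \<in> {M. M \<lhd> G Mod A}. {\<one>\<^bsub>G Mod A\<^esub>} \<subseteq> M \<and> M \<subseteq> ?q A ` B}"
        proof (intro equalityI subsetI)
          fix M assume "M \<in> (\<lambda>K. ?q A ` K) ` {C \<in> {N. N \<lhd> G}. A \<subseteq> C \<and> C \<subseteq> B}"
          then obtain C where C: "C \<lhd> G" "A \<subseteq> C" "C \<subseteq> B" "M = ?q A ` C" by blast
          then have "M \<lhd> G Mod A" using normal_FactGroup_image[OF A'] by simp
          moreover have "{\<one>\<^bsub>G Mod A\<^esub>} \<subseteq> M" using normal_one[OF \<open>M \<lhd> G Mod A\<close>] by simp
          moreover have "M \<subseteq> ?q A ` B" using C by blast
          ultimately show "M \<in> {M \<in> {M. M \<lhd> G Mod A}. {\<one>\<^bsub>G Mod A\<^esub>} \<subseteq> M \<and> M \<subseteq> ?q A ` B}"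
            by blast
        next
          fix M assume M: "M \<in> {M \<in> {M. M \<lhd> G Mod A}. {\<one>\<^bsub>G Mod A\<^esub>} \<subseteq> M \<and> M \<subseteq> ?q A ` B}"
          then have "M \<in> (\<lambda>K. ?q A ` K) ` {K. K \<lhd> G \<and> A \<subseteq> K}"
            using bij_betw_FactGroup_normal[OF A'] by (simp add: bij_betw_def)
          then obtain C where C: "C \<lhd> G" "A \<subseteq> C" "M = ?q A ` C" by blast
          moreover have "?q A ` C \<subseteq> ?q A ` B" using C(3) M by simp
          then have "C \<subseteq> B" using iff[OF C(1) B' \<open>A \<subseteq> B\<close>] by simp
          ultimately show "M \<in> (\<lambda>K. ?q A ` K) ` {C \<in> {N. N \<lhd> G}. A \<subseteq> C \<and> C \<subseteq> B}"
            by blast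
        qed
      qed blast
    qed
    also have "\<dots> = (if {\<one>\<^bsub>G Mod A\<^esub>} = ?q A ` B then 1 else 0)"
    proof (rule moebius_sum_upper)
      show "{\<one>\<^bsub>G Mod A\<^esub>} \<in> {M. M \<lhd> G Mod A}"
        using group.one_is_normal[OF group_FactGroup[OF A']] by simp
      show B: "?q A ` B \<in> {M. M \<lhd> G Mod A}" using normal_FactGroup_image[OF A' B'] by simp
      show "{\<one>\<^bsub>G Mod A\<^esub>} \<subseteq> ?q A ` B" using normal_one B by blast
    qed (rule finB)
    also have "{\<one>\<^bsub>G Mod A\<^esub>} = ?q A ` B \<longleftrightarrow> A = B"
    proof
      assume "{\<one>\<^bsub>G Mod A\<^esub>} = ?q A ` B"
      then have "?q A ` B \<subseteq> ?q A ` A" using one[OF A'] by simp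
      then show "A = B" using iff[OF B' A'] \<open>A \<subseteq> B\<close> by simp
    qed (use one[OF A'] in simp)
    finally show ?thesis .
  qed
  \<comment> \<open>Now the lower argument varies, and with it the quotient group in which the
    Moebius function is taken.\<close>
  have "(\<Sum>N \<in> {N \<in> {N. N \<lhd> G}. {\<one>\<^bsub>G\<^esub>} \<subseteq> N \<and> N \<subseteq> K}. \<nu> N K) =
    (if {\<one>\<^bsub>G\<^esub>} = K then 1 else 0)"
    by (rule moebius_sum_lower[OF finite_normals[OF fin] _ \<nu>])
      (use finite_normal[OF fin] K one_is_normal normal_one in auto)
  moreover have "{N \<in> {N. N \<lhd> G}. {\<one>\<^bsub>G\<^esub>} \<subseteq> N \<and> N \<subseteq> K} = {N. N \<lhd> G \<and> N \<subseteq> K}"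
    using normal_one by auto
  ultimately show ?thesis by (auto simp: \<nu>_def)
qed

section \<open>Inflation, deflation and the idempotents\<close>

text \<open>One shape for the identity, inflation, deflation and \<open>[P/M]\<close>: a group
  \<open>D\<close> acted on by translations through homomorphisms \<open>f\<close> and
  \<open>g\<close>. Composites of such bisets have this shape again whenever
  \<open>is_tensor_hom_biset\<close> applies.\<close>

definition hom_biset :: "'d monoid \<Rightarrow> ('a \<Rightarrow> 'd) \<Rightarrow> ('b \<Rightarrow> 'd) \<Rightarrow> ('a, 'b, 'd) biset" where
  "hom_biset D f g = \<lparr>pts = carrier D, lact = (\<lambda>h x. f h \<otimes>\<^bsub>D\<^esub> x), ract = (\<lambda>x k. x \<otimes>\<^bsub>D\<^esub> g k)\<rparr>"

lemma hom_biset_finite_biset: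
  assumes "f \<in> hom A D" "g \<in> hom B D" "group A" "group B" "group D" "finite (carrier D)"
  shows "finite_biset A B (hom_biset D f g)"
proof -
  interpret D: group D by fact
  interpret f: group_hom A D f using assms by (simp add: group_hom_def group_hom_axioms_def)
  interpret g: group_hom B D g using assms by (simp add: group_hom_def group_hom_axioms_def)
  have "is_biset A B (hom_biset D f g)"
    by (rule is_bisetI) (auto simp: hom_biset_def D.m_assoc)
  then show ?thesis using assms by (simp add: finite_biset_def hom_biset_def)
qed

text \<open>\<open>D\<close> and \<open>E\<close> are the quotients of \<open>B\<close> by the
  kernels of \<open>b\<close> and \<open>c\<close>, so \<open>D \<times>\<^sub>B E\<close> is the
  quotient of \<open>B\<close> by the product of the two kernels. The assumptions \<open>kb\<close>,
  \<open>kc\<close> and \<open>kz\<close> say that this product is the kernel of \<open>z\<close>,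
  which identifies the quotient with \<open>F\<close>. The maps \<open>s\<close> and
  \<open>t\<close> are \<open>f\<close> and \<open>g\<close> followed by the maps from
  \<open>D\<close> and \<open>E\<close> to \<open>F\<close> that \<open>z\<close> induces.\<close>

lemma is_tensor_hom_biset:
  assumes grp: "group A" "group B" "group C" "group D" "group E" "group F"
    and f: "f \<in> hom A D" and b: "b \<in> hom B D" "b ` carrier B = carrier D"
    and c: "c \<in> hom B E" "c ` carrier B = carrier E" and g: "g \<in> hom C E"
    and z: "z \<in> hom B F" "z ` carrier B = carrier F"
    and s: "\<And>x y. x \<in> carrier A \<Longrightarrow> y \<in> carrier B \<Longrightarrow> f x = b y \<Longrightarrow> s x = z y"
    and t: "\<And>x y. x \<in> carrier C \<Longrightarrow> y \<in> carrier B \<Longrightarrow> g x = c y \<Longrightarrow> t x = z y"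
    and kb: "\<And>y. y \<in> carrier B \<Longrightarrow> b y = \<one>\<^bsub>D\<^esub> \<Longrightarrow> z y = \<one>\<^bsub>F\<^esub>"
    and kc: "\<And>y. y \<in> carrier B \<Longrightarrow> c y = \<one>\<^bsub>E\<^esub> \<Longrightarrow> z y = \<one>\<^bsub>F\<^esub>"
    and kz: "\<And>y. y \<in> carrier B \<Longrightarrow> z y = \<one>\<^bsub>F\<^esub> \<Longrightarrow> \<exists>k \<in> carrier B. \<exists>l \<in> carrier B.
      b k = \<one>\<^bsub>D\<^esub> \<and> c l = \<one>\<^bsub>E\<^esub> \<and> y = k \<otimes>\<^bsub>B\<^esub> l"
  shows "is_tensor A B C (hom_biset D f b) (hom_biset E c g) (hom_biset F s t)"
proof -
  interpret A: group A by fact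
  interpret B: group B by fact
  interpret C: group C by fact
  interpret D: group D by fact
  interpret E: group E by fact
  interpret F: group F by fact
  interpret f: group_hom A D f using f by unfold_locales
  interpret g: group_hom C E g using g by unfold_locales
  interpret b: group_hom B D b using b by unfold_locales
  interpret c: group_hom B E c using c by unfold_locales
  interpret z: group_hom B F z using z by unfold_locales
  \<comment> \<open>Arbitrary preimages are chosen here. Since the kernels of \<open>b\<close> and
    \<open>c\<close> lie in that of \<open>z\<close>, the choice disappears, and only the rule
    \<open>\<phi> (b x) (c y) = z x \<otimes> z y\<close> derived below is used.\<close>
  define \<phi> where "\<phi> v u = z (inv_into (carrier B) b v \<otimes>\<^bsub>B\<^esub> inv_into (carrier B) c u)" for v u
  have bz: "z x = z y" if "x \<in> carrier B" "y \<in> carrier B" "b x = b y" for x y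
    using kb[of "x \<otimes>\<^bsub>B\<^esub> inv\<^bsub>B\<^esub> y"] that by (simp add: F.inv_solve_right')
  have cz: "z x = z y" if "x \<in> carrier B" "y \<in> carrier B" "c x = c y" for x y
    using kc[of "x \<otimes>\<^bsub>B\<^esub> inv\<^bsub>B\<^esub> y"] that by (simp add: F.inv_solve_right')
  have ib: "inv_into (carrier B) b (b x) \<in> carrier B" "b (inv_into (carrier B) b (b x)) = b x"
    if "x \<in> carrier B" for x
    using that by (auto intro: inv_into_into f_inv_into_f)
  have ic: "inv_into (carrier B) c (c x) \<in> carrier B" "c (inv_into (carrier B) c (c x)) = c x"
    if "x \<in> carrier B" for x
    using that by (auto intro: inv_into_into f_inv_into_f)
  have \<phi>: "\<phi> (b x) (c y) = z x \<otimes>\<^bsub>F\<^esub> z y" if "x \<in> carrier B" "y \<in> carrier B" for x y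
    using bz[OF ib(1)[OF that(1)] that(1) ib(2)[OF that(1)]]
      cz[OF ic(1)[OF that(2)] that(2) ic(2)[OF that(2)]] ib(1)[OF that(1)] ic(1)[OF that(2)]
    by (simp add: \<phi>_def)
  have D: "\<exists>x \<in> carrier B. v = b x" if "v \<in> carrier D" for v using that b(2) by (metis imageE)
  have E: "\<exists>x \<in> carrier B. v = c x" if "v \<in> carrier E" for v using that c(2) by (metis imageE)
  have F: "\<exists>x \<in> carrier B. v = z x" if "v \<in> carrier F" for v using that z(2) by (metis imageE)
  have "tensor_map A B C (hom_biset D f b) (hom_biset E c g) (hom_biset F s t) \<phi>"
  proof (rule tensor_mapI; unfold hom_biset_def; simp)
    fix v u assume "v \<in> carrier D" "u \<in> carrier E"
    with D E show "\<phi> v u \<in> carrier F" using \<phi> by fastforce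
  next
    fix w assume "w \<in> carrier F"
    then obtain x where x: "x \<in> carrier B" "w = z x" using F by blast
    then have "w = \<phi> (b x) (c \<one>\<^bsub>B\<^esub>)" by (subst \<phi>) auto
    then show "\<exists>v\<in>carrier D. \<exists>u\<in>carrier E. w = \<phi> v u"
      using x by (intro bexI[of _ "b x"] bexI[of _ "c \<one>\<^bsub>B\<^esub>"]) auto
  next
    fix k v u assume "k \<in> carrier A" "v \<in> carrier D" "u \<in> carrier E"
    moreover obtain k' where k': "k' \<in> carrier B" "f k = b k'" using D f.hom_closed calculation(1) by blast
    moreover obtain x where x: "x \<in> carrier B" "v = b x" using D calculation(2) by blast
    moreover obtain y where y: "y \<in> carrier B" "u = c y" using E calculation(3) by blast
    ultimately have "\<phi> (f k \<otimes>\<^bsub>D\<^esub> v) u = \<phi> (b (k' \<otimes>\<^bsub>B\<^esub> x)) (c y)" "s k = z k'"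
      using s by auto
    then show "\<phi> (f k \<otimes>\<^bsub>D\<^esub> v) u = s k \<otimes>\<^bsub>F\<^esub> \<phi> v u"
      using x y k' by (simp add: \<phi> F.m_assoc del: b.hom_mult)
  next
    fix k v u assume "v \<in> carrier D" "u \<in> carrier E" "k \<in> carrier C"
    moreover obtain k' where k': "k' \<in> carrier B" "g k = c k'" using E g.hom_closed calculation(3) by blast
    moreover obtain x where x: "x \<in> carrier B" "v = b x" using D calculation(1) by blast
    moreover obtain y where y: "y \<in> carrier B" "u = c y" using E calculation(2) by blast
    ultimately have "\<phi> v (u \<otimes>\<^bsub>E\<^esub> g k) = \<phi> (b x) (c (y \<otimes>\<^bsub>B\<^esub> k'))" "t k = z k'"
      using t by auto
    then show "\<phi> v (u \<otimes>\<^bsub>E\<^esub> g k) = \<phi> v u \<otimes>\<^bsub>F\<^esub> t k"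
      using x y k' by (simp add: \<phi> F.m_assoc del: c.hom_mult)
  next
    fix v u h assume "v \<in> carrier D" "u \<in> carrier E" and h: "h \<in> carrier B"
    moreover obtain x where x: "x \<in> carrier B" "v = b x" using D calculation(1) by blast
    moreover obtain y where y: "y \<in> carrier B" "u = c y" using E calculation(2) by blast
    ultimately have "\<phi> v (c h \<otimes>\<^bsub>E\<^esub> u) = \<phi> (b x) (c (h \<otimes>\<^bsub>B\<^esub> y))"
      "\<phi> (v \<otimes>\<^bsub>D\<^esub> b h) u = \<phi> (b (x \<otimes>\<^bsub>B\<^esub> h)) (c y)" by auto
    then show "\<phi> v (c h \<otimes>\<^bsub>E\<^esub> u) = \<phi> (v \<otimes>\<^bsub>D\<^esub> b h) u"
      using x y h by (simp add: \<phi> F.m_assoc del: b.hom_mult c.hom_mult)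
  next
    fix v u v' u' assume "v \<in> carrier D" "u \<in> carrier E" "v' \<in> carrier D" "u' \<in> carrier E"
      and eq: "\<phi> v u = \<phi> v' u'"
    then obtain x y x' y' where x: "x \<in> carrier B" "v = b x" and y: "y \<in> carrier B" "u = c y"
      and x': "x' \<in> carrier B" "v' = b x'" and y': "y' \<in> carrier B" "u' = c y'"
      using D E by metis
    let ?w = "inv\<^bsub>B\<^esub> x' \<otimes>\<^bsub>B\<^esub> (x \<otimes>\<^bsub>B\<^esub> y) \<otimes>\<^bsub>B\<^esub> inv\<^bsub>B\<^esub> y'"
    have "z x \<otimes>\<^bsub>F\<^esub> z y = z x' \<otimes>\<^bsub>F\<^esub> z y'" using eq x y x' y' by (simp add: \<phi>)
    then have "z ?w = \<one>\<^bsub>F\<^esub>" using x y x' y' by (simp add: F.m_assoc F.inv_solve_left')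
    then obtain k l where k: "k \<in> carrier B" "b k = \<one>\<^bsub>D\<^esub>" and l: "l \<in> carrier B" "c l = \<one>\<^bsub>E\<^esub>"
      and w: "?w = k \<otimes>\<^bsub>B\<^esub> l"
      using kz[of ?w] x y x' y' by auto
    \<comment> \<open>The factor \<open>k\<close> is invisible to \<open>b\<close>, so
      \<open>x ?h\<close> has the image of \<open>x'\<close>. Moreover
      \<open>?h l = y y'\<^sup>-\<^sup>1\<close>, where \<open>l\<close> is invisible to
      \<open>c\<close>.\<close>
    let ?h = "inv\<^bsub>B\<^esub> x \<otimes>\<^bsub>B\<^esub> x' \<otimes>\<^bsub>B\<^esub> k"
    have "?h \<otimes>\<^bsub>B\<^esub> l = inv\<^bsub>B\<^esub> x \<otimes>\<^bsub>B\<^esub> x' \<otimes>\<^bsub>B\<^esub> ?w"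
      using x x' k l by (simp add: w B.m_assoc)
    also have "\<dots> = y \<otimes>\<^bsub>B\<^esub> inv\<^bsub>B\<^esub> y'"
      using x x' y y' by (simp add: B.m_assoc B.inv_solve_left' flip: B.m_assoc[of "inv\<^bsub>B\<^esub> x" x] B.m_assoc[of x' "inv\<^bsub>B\<^esub> x'"])
    finally have "c (?h \<otimes>\<^bsub>B\<^esub> l) = c (y \<otimes>\<^bsub>B\<^esub> inv\<^bsub>B\<^esub> y')" by simp
    then have "c ?h = c y \<otimes>\<^bsub>E\<^esub> inv\<^bsub>E\<^esub> c y'"
      using x x' k l y y' by simp
    then have "u = c ?h \<otimes>\<^bsub>E\<^esub> u'"
      using y y' by (simp add: E.m_assoc)
    moreover have "v' = v \<otimes>\<^bsub>D\<^esub> b ?h"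
      using x x' k by (simp add: D.m_assoc[symmetric])
    ultimately show "\<exists>h\<in>carrier B. v' = v \<otimes>\<^bsub>D\<^esub> b h \<and> u = c h \<otimes>\<^bsub>E\<^esub> u'"
      using x x' k by (intro bexI[of _ ?h]) auto
  qed
  then show ?thesis by (auto simp: is_tensor_def)
qed

definition inf_biset :: "'a monoid \<Rightarrow> 'a set \<Rightarrow> ('a, 'a set, 'a set) biset" where
  "inf_biset G N = hom_biset (G Mod N) (\<lambda>x. N #>\<^bsub>G\<^esub> x) (\<lambda>x. x)"

definition def_biset :: "'a monoid \<Rightarrow> 'a set \<Rightarrow> ('a set, 'a, 'a set) biset" where
  "def_biset G N = hom_biset (G Mod N) (\<lambda>x. x) (\<lambda>x. N #>\<^bsub>G\<^esub> x)"

text \<open>\<open>quotient_biset G N\<close> brought into the shape \<open>hom_biset\<close>: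
  translating cosets by \<open>x\<close> is multiplying them by the coset of \<open>x\<close> in
  \<open>G/N\<close>.\<close>

definition quo_biset :: "'a monoid \<Rightarrow> 'a set \<Rightarrow> ('a, 'a, 'a set) biset" where
  "quo_biset G N = hom_biset (G Mod N) (\<lambda>x. N #>\<^bsub>G\<^esub> x) (\<lambda>x. N #>\<^bsub>G\<^esub> x)"

abbreviation "id_frag G \<equiv> biset_frag (identity_biset G)"
abbreviation "quotient_frag G N \<equiv> biset_frag (quotient_biset G N)"
abbreviation "quo_frag G N \<equiv> biset_frag (quo_biset G N)"
abbreviation "inf_frag G N \<equiv> biset_frag (inf_biset G N)"
abbreviation "def_frag G N \<equiv> biset_frag (def_biset G N)"

lemma identity_biset_eq: "identity_biset G = hom_biset G (\<lambda>x. x) (\<lambda>x. x)"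
  by (simp add: identity_biset_def hom_biset_def)

lemma hom_ident: "(\<lambda>x. x) \<in> hom G G"
  by (simp add: hom_def)

lemma r_coset_eq_one_iff:
  assumes "N \<lhd> G" "x \<in> carrier G"
  shows "N #>\<^bsub>G\<^esub> x = \<one>\<^bsub>G Mod N\<^esub> \<longleftrightarrow> x \<in> N"
proof -
  interpret normal N G by fact
  show ?thesis using assms coset_join1[of N x] coset_join2[of x N] is_subgroup subset by auto
qed

lemma r_coset_image_carrier: "(\<lambda>x. N #>\<^bsub>G\<^esub> x) ` carrier G = carrier (G Mod N)"
  by (simp add: carrier_FactGroup)

lemma finite_FactGroup: "finite (carrier G) \<Longrightarrow> finite (carrier (G Mod N))"
  by (simp add: carrier_FactGroup)

lemma
  assumes N: "N \<lhd> G" and fin: "finite (carrier G)"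
  shows inf_biset_finite: "finite_biset G (G Mod N) (inf_biset G N)"
    and def_biset_finite: "finite_biset (G Mod N) G (def_biset G N)"
    and quo_biset_finite: "finite_biset G G (quo_biset G N)"
  using N normal.axioms(2)[OF N]
  unfolding inf_biset_def def_biset_def quo_biset_def
  by (auto intro!: hom_biset_finite_biset FactGroup_hom group_FactGroup finite_FactGroup fin hom_ident)

lemma identity_biset_finite: "group G \<Longrightarrow> finite (carrier G) \<Longrightarrow> finite_biset G G (identity_biset G)"
  unfolding identity_biset_eq by (intro hom_biset_finite_biset hom_ident)

lemma quotient_biset_iso:
  fixes G :: "'a monoid" (structure)
  assumes N: "N \<lhd> G"
  shows "biset_iso G G (quo_biset G N) (quotient_biset G N)"
proof -
  interpret normal N G by fact
  have "(N #> h) <#> (N #> x) = h <# (N #> x)" if "h \<in> carrier G" "x \<in> carrier G" for h x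
  proof -
    have "(N #> h) <#> (N #> x) = N #> (h \<otimes> x)" using that by (rule rcos_sum)
    also have "\<dots> = (N #> h) #> x" using that by (simp add: coset_mult_assoc subset)
    also have "\<dots> = (h <# N) #> x" using that coset_eq by simp
    also have "\<dots> = h <# (N #> x)" using that by (simp add: coset_assoc subset)
    finally show ?thesis .
  qed
  moreover have "(N #> x) <#> (N #> h) = (N #> x) #> h" if "h \<in> carrier G" "x \<in> carrier G" for h x
    using that by (simp add: rcos_sum coset_mult_assoc subset)
  ultimately show ?thesis
    unfolding biset_iso_def
    by (intro exI[of _ "\<lambda>x. x"])
      (auto simp: quo_biset_def hom_biset_def quotient_biset_def FactGroup_def RCOSETS_def bij_betw_def)
qed

lemma quotient_biset_finite:
  assumes N: "N \<lhd> G" and fin: "finite (carrier G)"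
  shows "finite_biset G G (quotient_biset G N)"
  using N normal.axioms(2)[OF N]
  by (auto intro: finite_biset_iso[OF quo_biset_finite[OF N fin] quotient_biset_iso[OF N]])

lemma quotient_biset_one_iso:
  fixes G :: "'a monoid" (structure)
  assumes "group G"
  shows "biset_iso G G (identity_biset G) (quotient_biset G {\<one>\<^bsub>G\<^esub>})"
proof -
  interpret group G by fact
  have 1: "{\<one>} #> x = {x}" if "x \<in> carrier G" for x using that by (simp add: r_coset_def)
  show ?thesis
    unfolding biset_iso_def
    by (intro exI[of _ "\<lambda>x. {x}"])
      (auto simp: identity_biset_def quotient_biset_def RCOSETS_def bij_betw_def 1 l_coset_def r_coset_def)
qed

lemma is_tensor_identity_left:
  fixes H :: "'a monoid" (structure)
  assumes H: "group H" and U: "is_biset H G U"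
  shows "is_tensor H H G (identity_biset H) U U"
proof -
  interpret group H by fact
  have "tensor_map H H G (identity_biset H) U U (lact U)"
  proof (rule tensor_mapI; (simp add: identity_biset_def lact_closed[OF U] lact_mult[OF U] ract_lact[OF U])?)
    fix w assume "w \<in> pts U"
    then show "\<exists>v\<in>carrier H. \<exists>u\<in>pts U. w = lact U v u"
      by (intro bexI[of _ "\<one>\<^bsub>H\<^esub>"] bexI[of _ w]) (auto simp: lact_one[OF U])
  next
    fix v u v' u' assume m: "v \<in> carrier H" "u \<in> pts U" "v' \<in> carrier H" "u' \<in> pts U"
      and eq: "lact U v u = lact U v' u'"
    have "u = lact U (inv v) (lact U v u)"
      using m by (simp add: lact_mult[OF U, symmetric] lact_one[OF U])
    also have "\<dots> = lact U (inv v \<otimes> v') u'"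
      using m by (simp add: eq lact_mult[OF U])
    finally show "\<exists>h\<in>carrier H. v' = v \<otimes> h \<and> u = lact U h u'"
      using m by (intro bexI[of _ "inv v \<otimes> v'"]) (auto simp flip: m_assoc)
  qed
  then show ?thesis by (auto simp: is_tensor_def)
qed

lemma is_tensor_identity_right:
  fixes G :: "'a monoid" (structure)
  assumes G: "group G" and U: "is_biset H G U"
  shows "is_tensor H G G U (identity_biset G) U"
proof -
  interpret group G by fact
  have "tensor_map H G G U (identity_biset G) U (ract U)"
  proof (rule tensor_mapI; (simp add: identity_biset_def ract_closed[OF U] ract_mult[OF U] ract_lact[OF U])?)
    fix w assume "w \<in> pts U"
    then show "\<exists>v\<in>pts U. \<exists>u\<in>carrier G. w = ract U v u"
      by (intro bexI[of _ "\<one>\<^bsub>G\<^esub>"] bexI[of _ w]) (auto simp: ract_one[OF U])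
  next
    fix v u v' u' assume m: "v \<in> pts U" "u \<in> carrier G" "v' \<in> pts U" "u' \<in> carrier G"
      and eq: "ract U v u = ract U v' u'"
    have "v' = ract U (ract U v' u') (inv u')"
      using m by (simp add: ract_mult[OF U, symmetric] ract_one[OF U])
    also have "\<dots> = ract U v (u \<otimes> inv u')"
      using m by (simp add: eq[symmetric] ract_mult[OF U])
    finally show "\<exists>h\<in>carrier G. v' = ract U v h \<and> u = h \<otimes> u'"
      using m by (intro bexI[of _ "u \<otimes> inv u'"]) (auto simp: m_assoc)
  qed
  then show ?thesis by (auto simp: is_tensor_def)
qed

lemma comp_frag_id_left:
  assumes x: "is_frag H G x" and "group H" "group G" "finite (carrier H)"
  shows "frag_eq H G (comp_frag H (id_frag H) x) x"
  using x
proof (induction x rule: frag_induction)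
  case (one U)
  then show ?case
    using assms by (intro comp_frag_nat is_tensor_identity_left identity_biset_finite)
      (auto simp: in_nat_bisets_iff finite_biset_def)
qed (simp_all add: comp_frag_diff_right frag_eq_diff)

lemma comp_frag_id_right:
  assumes x: "is_frag H G x" and grp: "group H" "group G" "finite (carrier G)"
  shows "frag_eq H G (comp_frag G x (id_frag G)) x"
  using x
proof (induction x rule: frag_induction)
  case (one U)
  then have U: "finite_biset H G U" by (simp add: in_nat_bisets_iff)
  have keys: "is_frag G G (id_frag G)"
    using nat_copy_in_nat_bisets[OF identity_biset_finite] grp by simp
  have "frag_eq H G (comp_frag G (frag_of U) (id_frag G))
    (comp_frag G (biset_frag U) (id_frag G))"
    using one by (intro comp_frag_cong frag_eq_biset_frag frag_eq_refl U keys grp) simp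
  also have "frag_eq H G \<dots> (biset_frag U)"
    using U by (intro comp_frag_biset_frag is_tensor_identity_right identity_biset_finite grp U)
      (simp add: finite_biset_def)
  also have "frag_eq H G \<dots> (frag_of U)"
    by (rule frag_eq_sym[OF frag_eq_biset_frag[OF U grp(1,2)]])
  finally show ?case .
qed (simp_all add: comp_frag_diff_left frag_eq_diff)

lemma frag_eq_quotient_biset:
  assumes N: "N \<lhd> G" and fin: "finite (carrier G)"
  shows "frag_eq G G (quotient_frag G N) (quo_frag G N)"
  using normal.axioms(2)[OF N] assms
  by (intro frag_eq_sym[OF frag_eq_iso] quotient_biset_finite quo_biset_finite quotient_biset_iso)

lemma biset_frag_keys:
  "finite_biset H G U \<Longrightarrow> group H \<Longrightarrow> group G \<Longrightarrow> is_frag H G (biset_frag U)"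
  using nat_copy_in_nat_bisets by auto

text \<open>The kernel criterion with \<open>z\<close> the quotient map by \<open>KM\<close>: its
  kernel is by definition the product of the kernels \<open>K\<close> and \<open>M\<close>.\<close>

lemma quotient_biset_comp:
  fixes G :: "'a monoid" (structure)
  assumes K: "K \<lhd> G" and M: "M \<lhd> G" and fin: "finite (carrier G)"
  shows "frag_eq G G (comp_frag G (quotient_frag G K) (quotient_frag G M))
    (quotient_frag G (K <#>\<^bsub>G\<^esub> M))"
proof -
  interpret group G by (rule normal.axioms(2)[OF K])
  have G: "group G" ..
  have KM: "K <#> M \<lhd> G" by (rule normal_set_mult[OF K M])
  note up = normal_set_mult_upper[OF K M]
  have le: "(K <#> M) #> x = (K <#> M) #> y"
    if "L \<lhd> G" "L \<subseteq> K <#> M" "x \<in> carrier G" "y \<in> carrier G" "L #> x = L #> y" for L x y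
    using that r_coset_eq_iff[OF that(1,3,4)] r_coset_eq_iff[OF KM that(3,4)] by blast
  have "frag_eq G G (comp_frag G (quotient_frag G K) (quotient_frag G M))
    (comp_frag G (quo_frag G K) (quo_frag G M))"
    by (intro comp_frag_cong frag_eq_quotient_biset biset_frag_keys quo_biset_finite quotient_biset_finite
        K M fin G)
  also have "frag_eq G G \<dots> (quo_frag G (K <#> M))"
  proof (rule comp_frag_biset_frag)
    show "is_tensor G G G (quo_biset G K) (quo_biset G M) (quo_biset G (K <#> M))"
      unfolding quo_biset_def
    proof (rule is_tensor_hom_biset[where z = "\<lambda>x. (K <#> M) #> x"])
      show "\<exists>k\<in>carrier G. \<exists>l\<in>carrier G. K #> k = \<one>\<^bsub>G Mod K\<^esub> \<and> M #> l = \<one>\<^bsub>G Mod M\<^esub> \<and> y = k \<otimes> l"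
        if "y \<in> carrier G" "(K <#> M) #> y = \<one>\<^bsub>G Mod (K <#> M)\<^esub>" for y
      proof -
        have "y \<in> K <#> M" using r_coset_eq_one_iff[OF KM that(1)] that(2) by blast
        then obtain k l where "k \<in> K" "l \<in> M" "y = k \<otimes> l" by (auto simp: in_set_mult_iff)
        moreover then have "k \<in> carrier G" "l \<in> carrier G"
          using normal_subset K M by blast+
        ultimately show ?thesis
          using r_coset_eq_one_iff[OF K] r_coset_eq_one_iff[OF M] by blast
      qed
      show "(K <#> M) #> y = \<one>\<^bsub>G Mod (K <#> M)\<^esub>"
        if "y \<in> carrier G" "K #> y = \<one>\<^bsub>G Mod K\<^esub>" for y
        using that up r_coset_eq_one_iff[OF KM that(1)] r_coset_eq_one_iff[OF K that(1)] by blast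
      show "(K <#> M) #> y = \<one>\<^bsub>G Mod (K <#> M)\<^esub>"
        if "y \<in> carrier G" "M #> y = \<one>\<^bsub>G Mod M\<^esub>" for y
        using that up r_coset_eq_one_iff[OF KM that(1)] r_coset_eq_one_iff[OF M that(1)] by blast
    qed (intro G group_FactGroup FactGroup_hom r_coset_image_carrier K M KM le[OF K up(1)] le[OF M up(2)]; assumption)+
  qed (intro quo_biset_finite K M fin G)+
  also have "frag_eq G G \<dots> (quotient_frag G (K <#> M))"
    by (rule frag_eq_sym[OF frag_eq_quotient_biset[OF KM fin]])
  finally show ?thesis .
qed

lemma quotient_biset_one:
  assumes "group G" "finite (carrier G)"
  shows "frag_eq G G (quotient_frag G {\<one>\<^bsub>G\<^esub>}) (id_frag G)"
  using assms group.one_is_normal[OF assms(1)]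
  by (intro frag_eq_sym[OF frag_eq_iso] quotient_biset_finite identity_biset_finite quotient_biset_one_iso)

text \<open>Both composites are the group \<open>(G/N)/J\<close>, with \<open>G/N\<close> acting
  through its quotient map and \<open>G\<close> through both quotient maps in succession. Here
  \<open>J\<close> is \<open>KN/N\<close> for any normal \<open>K\<close>; the orthogonality of
  distinct edges calls for a \<open>K\<close> that is not contained in \<open>N\<close>.\<close>

lemma
  fixes G :: "'a monoid" (structure)
  assumes N: "N \<lhd> G" and K: "K \<lhd> G" and fin: "finite (carrier G)"
  defines "J \<equiv> (\<lambda>x. N #>\<^bsub>G\<^esub> x) ` K"
  shows inf_quotient: "frag_eq G (G Mod N)
      (comp_frag (G Mod N) (inf_frag G N) (quotient_frag (G Mod N) J))
      (comp_frag G (quotient_frag G K) (inf_frag G N))" (is "frag_eq _ _ ?il ?ir")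
    and def_quotient: "frag_eq (G Mod N) G
      (comp_frag (G Mod N) (quotient_frag (G Mod N) J) (def_frag G N))
      (comp_frag G (def_frag G N) (quotient_frag G K))" (is "frag_eq _ _ ?dl ?dr")
proof -
  interpret group G by (rule normal.axioms(2)[OF K])
  have G: "group G" ..
  let ?Q = "G Mod N"
  let ?R = "?Q Mod J"
  let ?q = "\<lambda>x. N #> x"
  let ?r = "\<lambda>x. J #>\<^bsub>?Q\<^esub> x"
  have J: "J \<lhd> ?Q" unfolding J_def by (rule normal_FactGroup_image[OF N K])
  have Q: "group ?Q" and R: "group ?R" and GK: "group (G Mod K)"
    using group_FactGroup N J K by auto
  have finQ: "finite (carrier ?Q)" using fin by (rule finite_FactGroup)
  interpret q: group_hom G ?Q ?q
    using G Q FactGroup_hom[OF N] by (simp add: group_hom_def group_hom_axioms_def)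
  interpret r: group_hom ?Q ?R ?r
    using Q R FactGroup_hom[OF J] by (simp add: group_hom_def group_hom_axioms_def)
  have z: "(\<lambda>x. ?r (?q x)) \<in> hom G ?R"
    using Group.hom_compose[OF FactGroup_hom[OF N] FactGroup_hom[OF J]] by (simp add: comp_def)
  have zsurj: "(\<lambda>x. ?r (?q x)) ` carrier G = carrier ?R"
    using r_coset_image_carrier[of G N] r_coset_image_carrier[of ?Q J] by (metis image_image)
  have qJ: "?q x \<in> J" if "x \<in> K" for x using that by (simp add: J_def)
  have zK: "?r (?q x) = ?r (?q y)" if "x \<in> carrier G" "y \<in> carrier G" "K #> x = K #> y" for x y
  proof -
    have "x \<otimes> inv y \<in> K" using that r_coset_eq_iff[OF K] by simp
    then have "?q (x \<otimes> inv y) \<in> J" by (rule qJ)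
    then have "?q x \<otimes>\<^bsub>?Q\<^esub> inv\<^bsub>?Q\<^esub> ?q y \<in> J"
      using that q.hom_mult[of x "inv y"] q.hom_inv[of y] by simp
    then show ?thesis using r_coset_eq_iff[OF J] that q.hom_closed by blast
  qed
  have zK1: "?r (?q y) = \<one>\<^bsub>?R\<^esub>" if "y \<in> carrier G" "K #> y = \<one>\<^bsub>G Mod K\<^esub>" for y
    using that r_coset_eq_one_iff[OF K that(1)] r_coset_eq_one_iff[OF J q.hom_closed[OF that(1)]] qJ by blast
  have zN1: "?r (?q y) = \<one>\<^bsub>?R\<^esub>" if "y \<in> carrier G" "?q y = \<one>\<^bsub>?Q\<^esub>" for y
    unfolding that(2) by (rule r.hom_one)
  have r1: "?r y = \<one>\<^bsub>?R\<^esub>" if "y = \<one>\<^bsub>?Q\<^esub>" for y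
    unfolding that by (rule r.hom_one)
  \<comment> \<open>An element killed by both quotient maps agrees modulo \<open>N\<close> with some
    \<open>k\<close> in \<open>K\<close>, so it is a product of \<open>k\<close> and an element of
    \<open>N\<close>. This is the factorisation that the kernel criterion asks for.\<close>
  have zker: "\<exists>k\<in>K. ?q y = ?q k" if "y \<in> carrier G" "?r (?q y) = \<one>\<^bsub>?R\<^esub>" for y
    using that r_coset_eq_one_iff[OF J q.hom_closed[OF that(1)]] by (auto simp: J_def)
  have KG: "x \<in> carrier G" if "x \<in> K" for x using that normal_subset[OF K] by blast
  have k1: "K #> k = \<one>\<^bsub>G Mod K\<^esub>" if "k \<in> K" for k
    using that r_coset_eq_one_iff[OF K KG[OF that]] by blast
  have keys: "is_frag G ?Q (inf_frag G N)"
    "is_frag ?Q G (def_frag G N)"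
    "is_frag G G (quotient_frag G K)"
    "is_frag ?Q ?Q (quotient_frag ?Q J)"
    "is_frag G G (quo_frag G K)"
    "is_frag ?Q ?Q (quo_frag ?Q J)"
    by (intro biset_frag_keys inf_biset_finite def_biset_finite quotient_biset_finite quo_biset_finite
        G Q N K J fin finQ)+
  note base = G Q R GK N J K FactGroup_hom[OF N] FactGroup_hom[OF K] FactGroup_hom[OF J]
    hom_ident z zsurj r_coset_image_carrier image_ident
  \<comment> \<open>The common value of the two composites with inflation; \<open>?D\<close> below
    is its mirror image for deflation.\<close>
  let ?I = "hom_biset ?R (\<lambda>x. ?r (?q x)) ?r"
  have i1: "is_tensor G G ?Q (quo_biset G K) (inf_biset G N) ?I"
    unfolding quo_biset_def inf_biset_def
  proof (rule is_tensor_hom_biset[where z = "\<lambda>x. ?r (?q x)"])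
    fix y assume y: "y \<in> carrier G" "?r (?q y) = \<one>\<^bsub>?R\<^esub>"
    obtain k where k: "k \<in> K" "?q y = ?q k" using zker[OF y] by blast
    show "\<exists>k\<in>carrier G. \<exists>l\<in>carrier G. K #> k = \<one>\<^bsub>G Mod K\<^esub> \<and> ?q l = \<one>\<^bsub>?Q\<^esub> \<and> y = k \<otimes> l"
      using y k KG[OF k(1)] k1[OF k(1)] q.hom_mult[of "inv k" y] q.hom_inv[of k]
      by (intro bexI[of _ k] bexI[of _ "inv k \<otimes> y"])
        (simp_all add: m_assoc[symmetric] del: q.hom_mult one_FactGroup mult_FactGroup)
  qed (rule base | assumption | (rule zK; assumption) | (rule zK1; assumption)
      | (rule zN1; assumption) | erule arg_cong)+
  have i2: "is_tensor G ?Q ?Q (inf_biset G N) (quo_biset ?Q J) ?I"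
    unfolding quo_biset_def inf_biset_def
  proof (rule is_tensor_hom_biset[where z = ?r])
    fix y assume y: "y \<in> carrier ?Q" "?r y = \<one>\<^bsub>?R\<^esub>"
    then show "\<exists>k\<in>carrier ?Q. \<exists>l\<in>carrier ?Q. k = \<one>\<^bsub>?Q\<^esub> \<and> ?r l = \<one>\<^bsub>?R\<^esub> \<and> y = k \<otimes>\<^bsub>?Q\<^esub> l"
      by (intro bexI[of _ "\<one>\<^bsub>?Q\<^esub>"] bexI[of _ y]) (simp_all del: one_FactGroup mult_FactGroup)
  qed (rule base | assumption | (rule r1; assumption) | erule arg_cong)+
  let ?D = "hom_biset ?R ?r (\<lambda>x. ?r (?q x))"
  have d1: "is_tensor ?Q G G (def_biset G N) (quo_biset G K) ?D"
    unfolding quo_biset_def def_biset_def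
  proof (rule is_tensor_hom_biset[where z = "\<lambda>x. ?r (?q x)"])
    fix y assume y: "y \<in> carrier G" "?r (?q y) = \<one>\<^bsub>?R\<^esub>"
    obtain k where k: "k \<in> K" "?q y = ?q k" using zker[OF y] by blast
    show "\<exists>l\<in>carrier G. \<exists>k\<in>carrier G. ?q l = \<one>\<^bsub>?Q\<^esub> \<and> K #> k = \<one>\<^bsub>G Mod K\<^esub> \<and> y = l \<otimes> k"
      using y k KG[OF k(1)] k1[OF k(1)] q.hom_mult[of y "inv k"] q.hom_inv[of k]
      by (intro bexI[of _ k] bexI[of _ "y \<otimes> inv k"])
        (simp_all add: m_assoc del: q.hom_mult one_FactGroup mult_FactGroup)
  qed (rule base | assumption | (rule zK; assumption) | (rule zK1; assumption)
      | (rule zN1; assumption) | erule arg_cong)+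
  have d2: "is_tensor ?Q ?Q G (quo_biset ?Q J) (def_biset G N) ?D"
    unfolding quo_biset_def def_biset_def
  proof (rule is_tensor_hom_biset[where z = ?r])
    fix y assume y: "y \<in> carrier ?Q" "?r y = \<one>\<^bsub>?R\<^esub>"
    then show "\<exists>k\<in>carrier ?Q. \<exists>l\<in>carrier ?Q. ?r k = \<one>\<^bsub>?R\<^esub> \<and> l = \<one>\<^bsub>?Q\<^esub> \<and> y = k \<otimes>\<^bsub>?Q\<^esub> l"
      by (intro bexI[of _ "\<one>\<^bsub>?Q\<^esub>"] bexI[of _ y]) (simp_all del: one_FactGroup mult_FactGroup)
  qed (rule base | assumption | (rule r1; assumption) | erule arg_cong)+
  have "frag_eq G ?Q ?il
    (comp_frag ?Q (inf_frag G N) (quo_frag ?Q J))"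
    by (intro comp_frag_cong frag_eq_refl frag_eq_quotient_biset keys J finQ G Q)
  also have "frag_eq G ?Q \<dots> (biset_frag ?I)"
    by (intro comp_frag_biset_frag i2 inf_biset_finite quo_biset_finite N J fin finQ G Q)
  also have "frag_eq G ?Q \<dots> (comp_frag G (quo_frag G K) (inf_frag G N))"
    by (rule frag_eq_sym, intro comp_frag_biset_frag i1 inf_biset_finite quo_biset_finite N K fin G Q)
  also have "frag_eq G ?Q \<dots> ?ir"
    by (intro comp_frag_cong frag_eq_refl frag_eq_sym[OF frag_eq_quotient_biset] keys K fin G Q)
  finally show "frag_eq G ?Q ?il ?ir" .
  have "frag_eq ?Q G ?dl
    (comp_frag ?Q (quo_frag ?Q J) (def_frag G N))"
    by (intro comp_frag_cong frag_eq_refl frag_eq_quotient_biset keys J finQ G Q)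
  also have "frag_eq ?Q G \<dots> (biset_frag ?D)"
    by (intro comp_frag_biset_frag d2 def_biset_finite quo_biset_finite N J fin finQ G Q)
  also have "frag_eq ?Q G \<dots> (comp_frag G (def_frag G N) (quo_frag G K))"
    by (rule frag_eq_sym, intro comp_frag_biset_frag d1 def_biset_finite quo_biset_finite N K fin G Q)
  also have "frag_eq ?Q G \<dots> ?dr"
    by (intro comp_frag_cong frag_eq_refl frag_eq_sym[OF frag_eq_quotient_biset] keys K fin G Q)
  finally show "frag_eq ?Q G ?dl ?dr" .
qed

text \<open>In the first composite the middle group \<open>G\<close> acts on both factors through
  \<open>G/N\<close>, with kernel \<open>N\<close> twice, and \<open>G/N\<close> with its own
  translations remains. In the second the middle group \<open>G/N\<close> acts with trivial kernels,
  and \<open>G\<close> is left acting on \<open>G/N\<close> from both sides.\<close>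

lemma
  fixes G :: "'a monoid" (structure)
  assumes N: "N \<lhd> G" and fin: "finite (carrier G)"
  shows deflation_inflation: "frag_eq (G Mod N) (G Mod N)
      (comp_frag G (def_frag G N) (inf_frag G N))
      (id_frag (G Mod N))"
    and inflation_deflation: "frag_eq G G
      (comp_frag (G Mod N) (inf_frag G N) (def_frag G N))
      (quotient_frag G N)"
proof -
  interpret group G by (rule normal.axioms(2)[OF N])
  have G: "group G" ..
  let ?Q = "G Mod N"
  let ?q = "\<lambda>x. N #> x"
  have Q: "group ?Q" by (rule group_FactGroup[OF N])
  interpret q: group_hom G ?Q ?q
    using G Q FactGroup_hom[OF N] by (simp add: group_hom_def group_hom_axioms_def)
  interpret Q: group ?Q by fact
  have 1: "is_tensor ?Q G ?Q (def_biset G N) (inf_biset G N) (identity_biset ?Q)"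
    unfolding def_biset_def inf_biset_def identity_biset_eq
  proof (rule is_tensor_hom_biset[where z = ?q])
    fix y assume "y \<in> carrier G" "?q y = \<one>\<^bsub>?Q\<^esub>"
    then show "\<exists>k\<in>carrier G. \<exists>l\<in>carrier G. ?q k = \<one>\<^bsub>?Q\<^esub> \<and> ?q l = \<one>\<^bsub>?Q\<^esub> \<and> y = k \<otimes> l"
      using q.hom_one by (intro bexI[of _ \<one>] bexI[of _ y]) (simp_all del: one_FactGroup)
  qed (rule G Q FactGroup_hom[OF N] hom_ident r_coset_image_carrier | assumption | simp only:)+
  have 2: "is_tensor G ?Q G (inf_biset G N) (def_biset G N) (quo_biset G N)"
    unfolding def_biset_def inf_biset_def quo_biset_def
  proof (rule is_tensor_hom_biset[where z = "\<lambda>x. x"])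
    fix y assume "y \<in> carrier ?Q" "y = \<one>\<^bsub>?Q\<^esub>"
    then show "\<exists>k\<in>carrier ?Q. \<exists>l\<in>carrier ?Q. k = \<one>\<^bsub>?Q\<^esub> \<and> l = \<one>\<^bsub>?Q\<^esub> \<and> y = k \<otimes>\<^bsub>?Q\<^esub> l"
      by (intro bexI[of _ "\<one>\<^bsub>?Q\<^esub>"]) (simp_all del: one_FactGroup mult_FactGroup)
  qed (rule G Q FactGroup_hom[OF N] hom_ident r_coset_image_carrier image_ident | assumption)+
  show "frag_eq ?Q ?Q (comp_frag G (def_frag G N) (inf_frag G N))
      (id_frag ?Q)"
    by (intro comp_frag_biset_frag 1 def_biset_finite inf_biset_finite N fin G Q)
  have "frag_eq G G (comp_frag ?Q (inf_frag G N) (def_frag G N))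
    (quo_frag G N)"
    by (intro comp_frag_biset_frag 2 def_biset_finite inf_biset_finite N fin G Q)
  also have "frag_eq G G \<dots> (quotient_frag G N)"
    by (rule frag_eq_sym[OF frag_eq_quotient_biset[OF N fin]])
  finally show "frag_eq G G (comp_frag ?Q (inf_frag G N) (def_frag G N))
      (quotient_frag G N)" .
qed

section \<open>The idempotent \<open>f\<^sub>\<one>\<close> on fragments\<close>

definition edge_frag :: "'a monoid \<Rightarrow> ('a, 'a) biset_frag" where
  "edge_frag G = (\<Sum>K \<in> {K. K \<lhd> G}.
     frag_cmul (moebius {N. N \<lhd> G} {\<one>\<^bsub>G\<^esub>} K) (quotient_frag G K))"

lemma frag_cmul_sum_left: "(\<Sum>i\<in>I. frag_cmul (c i) x) = frag_cmul (\<Sum>i\<in>I. c i) x"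
  by (induction I rule: infinite_finite_induct) (auto simp: frag_cmul_distrib)

lemma keys_sum_subset:
  fixes f :: "'i \<Rightarrow> 'b \<Rightarrow>\<^sub>0 int"
  shows "(\<And>i. i \<in> I \<Longrightarrow> Poly_Mapping.keys (f i) \<subseteq> S) \<Longrightarrow> Poly_Mapping.keys (sum f I) \<subseteq> S"
  using sum_closed_free_Abelian_group[of I f S] by simp

lemma keys_frag_cmul_subset: "Poly_Mapping.keys x \<subseteq> S \<Longrightarrow> Poly_Mapping.keys (frag_cmul c x) \<subseteq> S"
  using keys_cmul by blast

lemma quotient_biset_keys:
  "K \<lhd> G \<Longrightarrow> finite (carrier G) \<Longrightarrow> is_frag G G (quotient_frag G K)"
  using biset_frag_keys[OF quotient_biset_finite] normal.axioms(2) by blast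

lemma edge_frag_keys:
  assumes "finite (carrier G)"
  shows "is_frag G G (edge_frag G)"
  unfolding edge_frag_def
  by (intro keys_sum_subset keys_frag_cmul_subset quotient_biset_keys assms) simp

text \<open>After expanding the edge, each term is a multiple of \<open>e\<^sub>K\<^sub>M\<close>.
  The second claim reduces to the first computation because \<open>MK = KM\<close>.\<close>

lemma edge_frag_quotient:
  assumes fin: "finite (carrier G)" and M: "M \<lhd> G" "M \<noteq> {\<one>\<^bsub>G\<^esub>}"
  shows "frag_eq G G (comp_frag G (edge_frag G) (quotient_frag G M)) 0"
    and "frag_eq G G (comp_frag G (quotient_frag G M) (edge_frag G)) 0"
proof -
  interpret group G by (rule normal.axioms(2)[OF M(1)])
  let ?\<mu> = "moebius {N. N \<lhd> G} {\<one>\<^bsub>G\<^esub>}"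
  let ?E = "\<lambda>K. quotient_frag G K"
  \<comment> \<open>Collecting the terms with the same \<open>L = KM\<close> makes the coefficient
    of \<open>e\<^sub>L\<close> exactly the sum in Weisner's theorem.\<close>
  have "(\<Sum>K\<in>{K. K \<lhd> G}. frag_cmul (?\<mu> K) (?E (K <#>\<^bsub>G\<^esub> M))) =
    (\<Sum>L\<in>{K. K \<lhd> G}. \<Sum>K\<in>{K \<in> {K. K \<lhd> G}. K <#>\<^bsub>G\<^esub> M = L}. frag_cmul (?\<mu> K) (?E (K <#>\<^bsub>G\<^esub> M)))"
    using normal_set_mult[OF _ M(1)] by (intro sum.group[symmetric] finite_normals fin) auto
  also have "\<dots> = (\<Sum>L\<in>{K. K \<lhd> G}. \<Sum>K\<in>{K. K \<lhd> G \<and> K <#>\<^bsub>G\<^esub> M = L}. frag_cmul (?\<mu> K) (?E L))"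
    by (intro sum.cong refl) auto
  also have "\<dots> = 0"
    unfolding frag_cmul_sum_left
    by (intro sum.neutral ballI) (simp add: moebius_sum_set_mult_eq_0[OF fin M])
  finally have 0: "(\<Sum>K\<in>{K. K \<lhd> G}. frag_cmul (?\<mu> K) (?E (K <#>\<^bsub>G\<^esub> M))) = 0" .
  show "frag_eq G G (comp_frag G (edge_frag G) (?E M)) 0"
    unfolding edge_frag_def comp_frag_sum_left comp_frag_cmul_left 0[symmetric]
    by (intro frag_eq_sum frag_eq_cmul quotient_biset_comp M fin) simp
  have "frag_eq G G (comp_frag G (?E M) (?E K)) (?E (K <#>\<^bsub>G\<^esub> M))" if "K \<lhd> G" for K
    using quotient_biset_comp[OF M(1) that fin] commut_normal[OF normal_imp_subgroup[OF that] M(1)]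
    by simp
  then show "frag_eq G G (comp_frag G (?E M) (edge_frag G)) 0"
    unfolding edge_frag_def comp_frag_sum_right comp_frag_cmul_right 0[symmetric]
    by (intro frag_eq_sum frag_eq_cmul) simp
qed

lemma identity_biset_keys:
  "group G \<Longrightarrow> finite (carrier G) \<Longrightarrow> is_frag G G (id_frag G)"
  by (intro biset_frag_keys identity_biset_finite)

text \<open>Only the second factor is expanded. All its terms with \<open>K \<noteq> \<one>\<close>
  are annihilated by the first factor, and the remaining term has coefficient 1 and is the
  identity.\<close>

lemma edge_frag_idem:
  assumes G: "group G" and fin: "finite (carrier G)"
  shows "frag_eq G G (comp_frag G (edge_frag G) (edge_frag G)) (edge_frag G)"
proof -
  let ?\<mu> = "moebius {N. N \<lhd> G} {\<one>\<^bsub>G\<^esub>}"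
  let ?E = "\<lambda>K. quotient_frag G K"
  let ?F = "edge_frag G"
  have one: "frag_eq G G (comp_frag G ?F (?E {\<one>\<^bsub>G\<^esub>})) ?F"
  proof -
    have "frag_eq G G (comp_frag G ?F (?E {\<one>\<^bsub>G\<^esub>})) (comp_frag G ?F (id_frag G))"
      by (intro comp_frag_cong frag_eq_refl quotient_biset_one edge_frag_keys identity_biset_keys G fin)
    also have "frag_eq G G \<dots> ?F"
      by (intro comp_frag_id_right edge_frag_keys G fin)
    finally show ?thesis .
  qed
  have "comp_frag G ?F ?F = (\<Sum>K\<in>{K. K \<lhd> G}. frag_cmul (?\<mu> K) (comp_frag G ?F (?E K)))"
    by (subst (2) edge_frag_def) (simp only: comp_frag_sum_right comp_frag_cmul_right)
  also have "frag_eq G G \<dots> (\<Sum>K\<in>{K. K \<lhd> G}. if K = {\<one>\<^bsub>G\<^esub>} then ?F else 0)"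
  proof (rule frag_eq_sum)
    fix K assume K: "K \<in> {K. K \<lhd> G}"
    show "frag_eq G G (frag_cmul (?\<mu> K) (comp_frag G ?F (?E K))) (if K = {\<one>\<^bsub>G\<^esub>} then ?F else 0)"
    proof (cases "K = {\<one>\<^bsub>G\<^esub>}")
      case True
      then show ?thesis using one by (simp add: moebius.simps[of _ "{\<one>\<^bsub>G\<^esub>}" "{\<one>\<^bsub>G\<^esub>}"])
    next
      case False
      then show ?thesis using frag_eq_cmul[OF edge_frag_quotient(1)[OF fin, of K]] K by simp
    qed
  qed
  also have "(\<Sum>K\<in>{K. K \<lhd> G}. if K = {\<one>\<^bsub>G\<^esub>} then ?F else 0) = ?F"
    using group.one_is_normal[OF G] finite_normals[OF fin] by (simp add: sum.delta)
  finally show ?thesis .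
qed

section \<open>Products between the matrix entries \<open>f\<^sub>\<one> \<circ> Def\<close> and
  \<open>Inf \<circ> f\<^sub>\<one>\<close>\<close>

context
  fixes G :: "'a monoid" (structure)
  assumes G: "group G" and fin: "finite (carrier G)"
begin

interpretation group G by (rule G)

abbreviation "F_frag N \<equiv> edge_frag (G Mod N)"
abbreviation "proj_frag N \<equiv> comp_frag (G Mod N) (F_frag N) (def_frag G N)"
abbreviation "incl_frag N \<equiv> comp_frag (G Mod N) (inf_frag G N) (F_frag N)"
abbreviation "EQ_frag N K \<equiv> quotient_frag (G Mod N) ((\<lambda>x. N #> x) ` K)"

lemma I_keys: "N \<lhd> G \<Longrightarrow> is_frag G (G Mod N) (inf_frag G N)"
  by (intro biset_frag_keys inf_biset_finite group_FactGroup G fin)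

lemma D_keys: "N \<lhd> G \<Longrightarrow> is_frag (G Mod N) G (def_frag G N)"
  by (intro biset_frag_keys def_biset_finite group_FactGroup G fin)

lemma F_keys: "N \<lhd> G \<Longrightarrow> is_frag (G Mod N) (G Mod N) (F_frag N)"
  by (intro edge_frag_keys finite_FactGroup fin)

lemma EQ_keys: "N \<lhd> G \<Longrightarrow> K \<lhd> G \<Longrightarrow> is_frag (G Mod N) (G Mod N) (EQ_frag N K)"
  by (intro quotient_biset_keys normal_FactGroup_image finite_FactGroup fin)

lemmas frag_keys = I_keys D_keys F_keys EQ_keys comp_frag_keys quotient_biset_keys[OF _ fin]
  group_FactGroup G
  identity_biset_keys[OF group_FactGroup finite_FactGroup[OF fin]] identity_biset_keys[OF G fin]

lemma EQ_self: "N \<lhd> G \<Longrightarrow> frag_eq (G Mod N) (G Mod N) (EQ_frag N N) (id_frag (G Mod N))"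
proof -
  assume N: "N \<lhd> G"
  have "(\<lambda>x. N #> x) ` N = {\<one>\<^bsub>G Mod N\<^esub>}"
    using r_coset_eq_one_iff[OF N] normal_subset[OF N] normal_one[OF N] by (auto simp: image_iff subset_iff)
  then show ?thesis
    using quotient_biset_one[OF group_FactGroup[OF N] finite_FactGroup[OF fin]] by simp
qed

lemma FactGroup_image_ne_one:
  assumes N: "N \<lhd> G" and K: "K \<lhd> G" and "\<not> K \<subseteq> N"
  shows "(\<lambda>x. N #> x) ` K \<noteq> {\<one>\<^bsub>G Mod N\<^esub>}"
proof -
  obtain x where x: "x \<in> K" "x \<notin> N" using assms by blast
  then have "N #> x \<noteq> \<one>\<^bsub>G Mod N\<^esub>"
    using r_coset_eq_one_iff[OF N] normal_subset[OF K] by blast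
  then show ?thesis using x(1) by blast
qed

text \<open>The case \<open>K = N\<close> of \<open>inf_quotient\<close>, where the image of
  \<open>K\<close> in \<open>G/N\<close> is trivial and its biset is the identity.\<close>

lemma inf_absorb:
  assumes N: "N \<lhd> G"
  shows "frag_eq G (G Mod N) (comp_frag G (quotient_frag G N) (inf_frag G N)) (inf_frag G N)"
proof -
  have "frag_eq G (G Mod N) (comp_frag G (quotient_frag G N) (inf_frag G N)) (comp_frag (G Mod N) (inf_frag G N) (EQ_frag N N))"
    by (rule frag_eq_sym[OF inf_quotient[OF N N fin]])
  also have "frag_eq G (G Mod N) \<dots> (comp_frag (G Mod N) (inf_frag G N) (id_frag (G Mod N)))"
    by (intro comp_frag_cong frag_eq_refl EQ_self frag_keys N)
  also have "frag_eq G (G Mod N) \<dots> (inf_frag G N)"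
    by (intro comp_frag_id_right frag_keys N finite_FactGroup fin)
  finally show ?thesis .
qed

lemma def_absorb:
  assumes N: "N \<lhd> G"
  shows "frag_eq (G Mod N) G (comp_frag G (def_frag G N) (quotient_frag G N)) (def_frag G N)"
proof -
  have "frag_eq (G Mod N) G (comp_frag G (def_frag G N) (quotient_frag G N)) (comp_frag (G Mod N) (EQ_frag N N) (def_frag G N))"
    by (rule frag_eq_sym[OF def_quotient[OF N N fin]])
  also have "frag_eq (G Mod N) G \<dots> (comp_frag (G Mod N) (id_frag (G Mod N)) (def_frag G N))"
    by (intro comp_frag_cong frag_eq_refl EQ_self frag_keys N)
  also have "frag_eq (G Mod N) G \<dots> (def_frag G N)"
    by (intro comp_frag_id_left frag_keys N finite_FactGroup fin)
  finally show ?thesis .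
qed

text \<open>Deflation after inflation is the identity, so the product shrinks to
  \<open>f\<^sub>\<one> \<circ> f\<^sub>\<one>\<close>.\<close>

lemma edge_comp_same:
  assumes N: "N \<lhd> G"
  shows "frag_eq (G Mod N) (G Mod N)
    (comp_frag G (proj_frag N) (incl_frag N))
    (F_frag N)"
proof -
  let ?Q = "G Mod N"
  let ?F = "F_frag N" and ?D = "def_frag G N" and ?I = "inf_frag G N" and ?Id = "id_frag ?Q"
  have "frag_eq ?Q ?Q (comp_frag G (comp_frag ?Q ?F ?D) (comp_frag ?Q ?I ?F))
    (comp_frag ?Q ?F (comp_frag G ?D (comp_frag ?Q ?I ?F)))"
    by (intro comp_frag_assoc frag_keys N)
  also have "frag_eq ?Q ?Q \<dots> (comp_frag ?Q ?F (comp_frag ?Q (comp_frag G ?D ?I) ?F))"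
    by (intro comp_frag_cong frag_eq_refl frag_eq_sym[OF comp_frag_assoc] frag_keys N)
  also have "frag_eq ?Q ?Q \<dots> (comp_frag ?Q ?F (comp_frag ?Q ?Id ?F))"
    by (intro comp_frag_cong frag_eq_refl deflation_inflation frag_keys N fin)
  also have "frag_eq ?Q ?Q \<dots> (comp_frag ?Q ?F ?F)"
    by (intro comp_frag_cong frag_eq_refl comp_frag_id_left frag_keys N finite_FactGroup fin)
  also have "frag_eq ?Q ?Q \<dots> ?F"
    by (intro edge_frag_idem frag_keys N finite_FactGroup fin)
  finally show ?thesis .
qed

lemma edge_comp_distinct:
  assumes N: "N \<lhd> G" and N': "N' \<lhd> G" and "N \<noteq> N'"
  shows "frag_eq (G Mod N') (G Mod N)
    (comp_frag G (proj_frag N') (incl_frag N))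
    0"
proof -
  let ?Q = "G Mod N" and ?Q' = "G Mod N'"
  let ?F = "F_frag N" and ?F' = "F_frag N'" and ?D = "def_frag G N'" and ?I = "inf_frag G N"
  let ?FD = "comp_frag ?Q' ?F' ?D" and ?IF = "comp_frag ?Q ?I ?F"
  have finQ: "finite (carrier ?Q)" "finite (carrier ?Q')" using finite_FactGroup[OF fin] by auto
  note keys = frag_keys N N'
  have zero: "Poly_Mapping.keys 0 \<subseteq> S" for S by simp
  consider "\<not> N' \<subseteq> N" | "\<not> N \<subseteq> N'" using \<open>N \<noteq> N'\<close> by blast
  then show ?thesis
  proof cases
    case 1
    \<comment> \<open>The image of \<open>N'\<close> in \<open>G/N\<close> is nontrivial, hence
      annihilated by the edge of \<open>G/N\<close>. Consequently \<open>e\<^sub>N\<^sub>'\<close>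
      kills \<open>Inf \<circ> f\<^sub>\<one>\<close>.\<close>
    have "frag_eq ?Q ?Q (comp_frag ?Q (EQ_frag N N') ?F) 0"
      by (intro edge_frag_quotient(2) finQ normal_FactGroup_image N N' FactGroup_image_ne_one 1)
    then have "frag_eq G ?Q (comp_frag ?Q ?I (comp_frag ?Q (EQ_frag N N') ?F)) (comp_frag ?Q ?I 0)"
      by (intro comp_frag_cong frag_eq_refl keys zero)
    moreover have "frag_eq G ?Q (comp_frag G (quotient_frag G N') ?IF) (comp_frag ?Q ?I (comp_frag ?Q (EQ_frag N N') ?F))"
    proof -
      have "frag_eq G ?Q (comp_frag G (quotient_frag G N') ?IF) (comp_frag ?Q (comp_frag G (quotient_frag G N') ?I) ?F)"
        by (rule frag_eq_sym, intro comp_frag_assoc keys)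
      also have "frag_eq G ?Q \<dots> (comp_frag ?Q (comp_frag ?Q ?I (EQ_frag N N')) ?F)"
        by (intro comp_frag_cong frag_eq_refl frag_eq_sym[OF inf_quotient] keys fin)
      also have "frag_eq G ?Q \<dots> (comp_frag ?Q ?I (comp_frag ?Q (EQ_frag N N') ?F))"
        by (intro comp_frag_assoc keys)
      finally show ?thesis .
    qed
    ultimately have E0: "frag_eq G ?Q (comp_frag G (quotient_frag G N') ?IF) 0" using frag_eq_trans by fastforce
    have "frag_eq ?Q' ?Q (comp_frag G ?FD ?IF) (comp_frag ?Q' ?F' (comp_frag G ?D ?IF))"
      by (intro comp_frag_assoc keys)
    also have "frag_eq ?Q' ?Q \<dots> (comp_frag ?Q' ?F' (comp_frag G (comp_frag G ?D (quotient_frag G N')) ?IF))"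
      \<comment> \<open>The deflation to \<open>G/N'\<close> releases a factor
        \<open>e\<^sub>N\<^sub>'\<close>, which is then moved over to the inflation.\<close>
      by (intro comp_frag_cong frag_eq_refl frag_eq_sym[OF def_absorb] keys)
    also have "frag_eq ?Q' ?Q \<dots> (comp_frag ?Q' ?F' (comp_frag G ?D (comp_frag G (quotient_frag G N') ?IF)))"
      by (intro comp_frag_cong frag_eq_refl comp_frag_assoc keys)
    also have "frag_eq ?Q' ?Q \<dots> (comp_frag ?Q' ?F' (comp_frag G ?D 0))"
      by (intro comp_frag_cong frag_eq_refl E0 keys zero)
    finally show ?thesis by simp
  next
    case 2
    \<comment> \<open>The mirror case: now the inflation from \<open>G/N\<close> releases
      \<open>e\<^sub>N\<close>, which reaches the edge of \<open>G/N'\<close> through the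
      deflation.\<close>
    have "frag_eq ?Q' ?Q' (comp_frag ?Q' ?F' (EQ_frag N' N)) 0"
      by (intro edge_frag_quotient(1) finQ normal_FactGroup_image N N' FactGroup_image_ne_one 2)
    then have "frag_eq ?Q' G (comp_frag ?Q' (comp_frag ?Q' ?F' (EQ_frag N' N)) ?D) (comp_frag ?Q' 0 ?D)"
      by (intro comp_frag_cong frag_eq_refl keys zero)
    moreover have "frag_eq ?Q' G (comp_frag G ?FD (quotient_frag G N)) (comp_frag ?Q' (comp_frag ?Q' ?F' (EQ_frag N' N)) ?D)"
    proof -
      have "frag_eq ?Q' G (comp_frag G ?FD (quotient_frag G N)) (comp_frag ?Q' ?F' (comp_frag G ?D (quotient_frag G N)))"
        by (intro comp_frag_assoc keys)
      also have "frag_eq ?Q' G \<dots> (comp_frag ?Q' ?F' (comp_frag ?Q' (EQ_frag N' N) ?D))"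
        by (intro comp_frag_cong frag_eq_refl frag_eq_sym[OF def_quotient] keys fin)
      also have "frag_eq ?Q' G \<dots> (comp_frag ?Q' (comp_frag ?Q' ?F' (EQ_frag N' N)) ?D)"
        by (rule frag_eq_sym, intro comp_frag_assoc keys)
      finally show ?thesis .
    qed
    ultimately have E0: "frag_eq ?Q' G (comp_frag G ?FD (quotient_frag G N)) 0" using frag_eq_trans by fastforce
    have "frag_eq ?Q' ?Q (comp_frag G ?FD ?IF) (comp_frag ?Q (comp_frag G ?FD ?I) ?F)"
      by (rule frag_eq_sym, intro comp_frag_assoc keys)
    also have "frag_eq ?Q' ?Q \<dots> (comp_frag ?Q (comp_frag G ?FD (comp_frag G (quotient_frag G N) ?I)) ?F)"
      by (intro comp_frag_cong frag_eq_refl frag_eq_sym[OF inf_absorb] keys)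
    also have "frag_eq ?Q' ?Q \<dots> (comp_frag ?Q (comp_frag G (comp_frag G ?FD (quotient_frag G N)) ?I) ?F)"
      by (intro comp_frag_cong frag_eq_refl frag_eq_sym[OF comp_frag_assoc] keys)
    also have "frag_eq ?Q' ?Q \<dots> (comp_frag ?Q (comp_frag G 0 ?I) ?F)"
      by (intro comp_frag_cong frag_eq_refl E0 keys zero)
    finally show ?thesis by simp
  qed
qed

text \<open>The two edges in the middle merge by idempotence, and the remaining one is expanded over
  the normal subgroups of \<open>G/N\<close>, each of which is \<open>K/N\<close> for a unique
  normal \<open>K\<close> containing \<open>N\<close>.\<close>

lemma edge_comp_factor:
  assumes N: "N \<lhd> G"
  shows "frag_eq G G
    (comp_frag (G Mod N) (incl_frag N) (proj_frag N))
    (\<Sum>K \<in> {K \<in> {K. K \<lhd> G}. N \<subseteq> K}. frag_cmul (moebius {M. M \<lhd> G Mod N} {\<one>\<^bsub>G Mod N\<^esub>} ((\<lambda>x. N #> x) ` K))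
      (quotient_frag G K))"
proof -
  let ?Q = "G Mod N"
  let ?F = "F_frag N" and ?D = "def_frag G N" and ?I = "inf_frag G N"
  let ?\<mu> = "moebius {M. M \<lhd> ?Q} {\<one>\<^bsub>?Q\<^esub>}"
  \<comment> \<open>For \<open>N \<subseteq> K\<close> the factor moves out through the deflation:
    \<open>Inf \<circ> e\<^sub>K\<^sub>/\<^sub>N \<circ> Def = Inf \<circ> Def \<circ> e\<^sub>K =
    e\<^sub>N \<circ> e\<^sub>K = e\<^sub>K\<close>, the last step because
    \<open>NK = K\<close>.\<close>
  have E: "frag_eq G G (comp_frag ?Q ?I (comp_frag ?Q (EQ_frag N K) ?D)) (quotient_frag G K)"
    if K: "K \<lhd> G" "N \<subseteq> K" for K
  proof -
    have "N <#> K = K"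
      using normal_set_mult_upper(2)[OF N K(1)] normal_set_mult_least[OF K(1) K(2)] by blast
    then have NK: "frag_eq G G (comp_frag G (quotient_frag G N) (quotient_frag G K)) (quotient_frag G K)"
      using quotient_biset_comp[OF N K(1) fin] by simp
    have "frag_eq G G (comp_frag ?Q ?I (comp_frag ?Q (EQ_frag N K) ?D)) (comp_frag ?Q ?I (comp_frag G ?D (quotient_frag G K)))"
      by (intro comp_frag_cong frag_eq_refl def_quotient frag_keys N K fin)
    also have "frag_eq G G \<dots> (comp_frag G (comp_frag ?Q ?I ?D) (quotient_frag G K))"
      by (rule frag_eq_sym, intro comp_frag_assoc frag_keys N K)
    also have "frag_eq G G \<dots> (comp_frag G (quotient_frag G N) (quotient_frag G K))"
      by (intro comp_frag_cong frag_eq_refl inflation_deflation frag_keys N K fin)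
    also note NK
    finally show ?thesis .
  qed
  have "frag_eq G G (comp_frag ?Q (comp_frag ?Q ?I ?F) (comp_frag ?Q ?F ?D))
    (comp_frag ?Q ?I (comp_frag ?Q ?F (comp_frag ?Q ?F ?D)))"
    by (intro comp_frag_assoc frag_keys N)
  also have "frag_eq G G \<dots> (comp_frag ?Q ?I (comp_frag ?Q (comp_frag ?Q ?F ?F) ?D))"
    by (intro comp_frag_cong frag_eq_refl frag_eq_sym[OF comp_frag_assoc] frag_keys N)
  also have "frag_eq G G \<dots> (comp_frag ?Q ?I (comp_frag ?Q ?F ?D))"
    by (intro comp_frag_cong frag_eq_refl edge_frag_idem frag_keys N finite_FactGroup fin)
  also have "comp_frag ?Q ?I (comp_frag ?Q ?F ?D) = (\<Sum>J \<in> {M. M \<lhd> ?Q}. frag_cmul (?\<mu> J)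
      (comp_frag ?Q ?I (comp_frag ?Q (quotient_frag ?Q J) ?D)))"
    unfolding edge_frag_def comp_frag_sum_left comp_frag_sum_right comp_frag_cmul_left comp_frag_cmul_right ..
  also have "\<dots> = (\<Sum>K \<in> {K. K \<lhd> G \<and> N \<subseteq> K}. frag_cmul (?\<mu> ((\<lambda>x. N #> x) ` K))
      (comp_frag ?Q ?I (comp_frag ?Q (EQ_frag N K) ?D)))"
    by (rule sum.reindex_bij_betw[OF bij_betw_FactGroup_normal[OF N], symmetric])
  also have "frag_eq G G \<dots> (\<Sum>K \<in> {K. K \<lhd> G \<and> N \<subseteq> K}. frag_cmul (?\<mu> ((\<lambda>x. N #> x) ` K)) (quotient_frag G K))"
    by (intro frag_eq_sum frag_eq_cmul E) auto
  finally show ?thesis by simp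
qed

lemma edge_comp_sum:
  "frag_eq G G (\<Sum>N \<in> {N. N \<lhd> G}.
    comp_frag (G Mod N) (incl_frag N) (proj_frag N))
    (id_frag G)"
proof -
  let ?S = "{N. N \<lhd> G}"
  let ?\<nu> = "\<lambda>N K. moebius {M. M \<lhd> G Mod N} {\<one>\<^bsub>G Mod N\<^esub>} ((\<lambda>x. N #> x) ` K)"
  have "frag_eq G G (\<Sum>N \<in> ?S.
    comp_frag (G Mod N) (incl_frag N) (proj_frag N))
    (\<Sum>N \<in> ?S. \<Sum>K \<in> {K \<in> ?S. N \<subseteq> K}. frag_cmul (?\<nu> N K) (quotient_frag G K))"
    by (intro frag_eq_sum edge_comp_factor) simp
  \<comment> \<open>Exchanging the sums gathers, for each \<open>K\<close>, the coefficients coming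
    from all \<open>N \<subseteq> K\<close>, which is the sum evaluated by
    \<open>moebius_FactGroup_sum\<close>.\<close>
  also have "(\<Sum>N \<in> ?S. \<Sum>K \<in> {K \<in> ?S. N \<subseteq> K}. frag_cmul (?\<nu> N K) (quotient_frag G K)) =
    (\<Sum>K \<in> ?S. \<Sum>N \<in> {N \<in> ?S. N \<subseteq> K}. frag_cmul (?\<nu> N K) (quotient_frag G K))"
    by (intro sum.swap_restrict finite_normals fin)
  also have "\<dots> = (\<Sum>K \<in> ?S. if K = {\<one>} then quotient_frag G K else 0)"
    unfolding frag_cmul_sum_left
    by (intro sum.cong refl) (simp add: moebius_FactGroup_sum[OF fin] del: one_FactGroup)
  also have "\<dots> = quotient_frag G {\<one>}"
    using one_is_normal finite_normals[OF fin] by (simp add: sum.delta)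
  also have "frag_eq G G \<dots> (id_frag G)"
    by (rule quotient_biset_one[OF G fin])
  finally show ?thesis .
qed

end

section \<open>\<open>f_one\<close> as the class of \<open>edge_frag\<close>\<close>

lemma frag_class_int_pow:
  assumes "is_frag H G x"
  shows "frag_class H G x [^]\<^bsub>burnside H G\<^esub> (n :: int) = frag_class H G (frag_cmul n x)"
  using normal.FactGroup_int_pow[OF burnside_rels_normal, of x H G n] assms
  by (simp add: burnside_def frag_class_def)

lemma frag_class_finprod:
  assumes "finite I" "\<And>i. i \<in> I \<Longrightarrow> is_frag H G (f i)"
  shows "finprod (burnside H G) (\<lambda>i. frag_class H G (f i)) I = frag_class H G (sum f I)"
proof -
  interpret comm_group "burnside H G" by (rule comm_group_burnside)
  show ?thesis
    using assms
  proof (induction I rule: finite_induct)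
    case (insert i I)
    have "is_frag H G (sum f I)"
      by (rule keys_sum_subset) (use insert in auto)
    moreover have "(\<lambda>i. frag_class H G (f i)) \<in> I \<rightarrow> carrier (burnside H G)"
      using insert by (auto intro!: frag_class_closed)
    ultimately show ?case
      using insert by (simp add: frag_class_closed frag_class_mult)
  qed (simp add: frag_class_one)
qed

lemma f_one_eq:
  assumes fin: "finite (carrier G)"
  shows "f_one G = frag_class G G (edge_frag G)"
proof -
  let ?\<mu> = "moebius {N. N \<lhd> G} {\<one>\<^bsub>G\<^esub>}"
  interpret comm_group "burnside G G" by (rule comm_group_burnside)
  have keys: "is_frag G G (frag_cmul (?\<mu> M) (quotient_frag G M))"
    if "M \<in> {M. M \<lhd> G}" for M
    using that by (intro keys_frag_cmul_subset quotient_biset_keys fin) simp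
  have "f_one G = finprod (burnside G G)
    (\<lambda>M. frag_class G G (frag_cmul (?\<mu> M) (quotient_frag G M))) {M. M \<lhd> G}"
    unfolding f_one_def biset_class_def
    by (intro finprod_cong' refl Pi_I frag_class_closed keys frag_class_int_pow quotient_biset_keys fin)
      simp_all
  also have "\<dots> = frag_class G G (edge_frag G)"
    unfolding edge_frag_def
    by (intro frag_class_finprod finite_normals fin keys)
  finally show ?thesis .
qed

section \<open>The decomposition in the Roquette category\<close>

lemma finite_p_group_FactGroup:
  assumes "Factorial_Ring.prime p" "finite_p_group p P" "N \<lhd> P"
  shows "finite_p_group p (P Mod N)"
proof -
  interpret normal N P by fact
  obtain n where n: "order P = p ^ n" using assms by (auto simp: finite_p_group_def)
  have "card (rcosets\<^bsub>P\<^esub> N) * card N = order P"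
    using lagrange[OF is_subgroup] .
  then have "order (P Mod N) dvd p ^ n"
    by (metis dvd_triv_left n order_def partial_object.select_convs(1) FactGroup_def)
  then obtain i where "order (P Mod N) = p ^ i"
    using divides_primepow_nat[OF assms(1)] by blast
  then show ?thesis
    using assms factorgroup_is_group finite_FactGroup by (auto simp: finite_p_group_def)
qed

context delta_representative
begin

lemma roquette_decomposition:
  fixes P :: "'a monoid"
  assumes p: "Factorial_Ring.prime p" and P: "finite_p_group p P"
  shows "roquette_iso p Xp (roquette_grp p Xp P)
           (roquette_sum {N. N \<lhd> P} (\<lambda>N. edge p Xp (P Mod N)))"
proof -
  have G: "group P" and fin: "finite (carrier P)" using P by (auto simp: finite_p_group_def)
  let ?A = "roquette_grp p Xp P"
  let ?B = "roquette_sum {N. N \<lhd> P} (\<lambda>N. edge p Xp (P Mod N))"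
  let ?F = "\<lambda>N. edge_frag (P Mod N)"
  let ?D = "\<lambda>N. def_frag P N"
  let ?I = "\<lambda>N. inf_frag P N"
  let ?Id = "id_frag P"
  let ?m = "\<lambda>N. comp_frag (P Mod N) (?F N) (?D N)"
  let ?n = "\<lambda>N. comp_frag (P Mod N) (?I N) (?F N)"
  have grp: "group (P Mod N)" and finN: "finite (carrier (P Mod N))" if "N \<lhd> P" for N
    using that group_FactGroup finite_FactGroup fin by auto
  note keys = frag_keys[OF G fin]
  have A: "idx ?A = {()}" "grp ?A i = P" "idem ?A i = sharp_frag P P ?Id" for i
    by (simp_all add: roquette_grp_def roquette_pair_def sharp_id_def sharp_frag_def biset_class_def)
  \<comment> \<open>Every edge is itself a sum over a one-element index set, so an index of
    \<open>?B\<close> is a pair \<open>(N, ())\<close>, and \<open>fst\<close> recovers the normal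
    subgroup.\<close>
  have idxB: "idx ?B = {N. N \<lhd> P} \<times> {()}" and grpB: "grp ?B j = P Mod fst j" for j
    by (auto simp: roquette_sum_def edge_def roquette_pair_def split: prod.split)
  have idemB: "idem ?B j = sharp_frag (P Mod fst j) (P Mod fst j) (?F (fst j))" for j
    using finite_FactGroup[OF fin, of "fst j"]
    by (auto simp: roquette_sum_def edge_def roquette_pair_def f_one_eq sharp_frag_def split: prod.split)
  have "sharp_comp p Xp P P P (sharp_frag P P ?Id) (sharp_frag P P ?Id) = sharp_frag P P (comp_frag P ?Id ?Id)"
    by (intro sharp_comp_frag keys fin)
  also have "\<dots> = sharp_frag P P ?Id"
    by (intro sharp_frag_cong comp_frag_id_left keys fin)
  finally have objA: "is_roquette_obj p Xp ?A"
    unfolding is_roquette_obj_def A using P sharp_frag_closed[OF identity_biset_keys[OF G fin]] by simp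
  have objB: "is_roquette_obj p Xp ?B"
    unfolding is_roquette_obj_def idxB grpB idemB
  proof (intro conjI ballI)
    fix j assume "j \<in> {N. N \<lhd> P} \<times> {()}"
    then have N: "fst j \<lhd> P" by auto
    let ?Q = "P Mod fst j"
    let ?e = "sharp_frag ?Q ?Q (?F (fst j))"
    show "finite_p_group p ?Q" by (rule finite_p_group_FactGroup[OF p P N])
    show "?e \<in> carrier (sharp_hom p Xp ?Q ?Q)"
      by (intro sharp_frag_closed keys N)
    have "sharp_comp p Xp ?Q ?Q ?Q ?e ?e = sharp_frag ?Q ?Q (comp_frag ?Q (?F (fst j)) (?F (fst j)))"
      by (intro sharp_comp_frag keys N grp finN)
    also have "\<dots> = ?e"
      by (intro sharp_frag_cong edge_frag_idem keys N grp finN)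
    finally show "sharp_comp p Xp ?Q ?Q ?Q ?e ?e = ?e" .
  qed (use finite_normals[OF fin] in simp)
  define M where "M = (\<lambda>(j, i) \<in> idx ?B \<times> idx ?A. sharp_frag (P Mod fst j) P (?m (fst j)))"
  define N where "N = (\<lambda>(i, j) \<in> idx ?A \<times> idx ?B. sharp_frag P (P Mod fst j) (?n (fst j)))"
  \<comment> \<open>An entry of a morphism must be exhibited as target idempotent, arbitrary
    morphism, source idempotent. Here the middle morphism is deflation and the source idempotent is
    the identity.\<close>
  have M_entry: "\<exists>\<phi>. sharp_frag (P Mod N) P (?m N) =
      sharp_comp p Xp P (P Mod N) (P Mod N) (sharp_frag (P Mod N) (P Mod N) (?F N))
        (sharp_comp p Xp P P (P Mod N) \<phi> (sharp_frag P P ?Id)) \<and>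
      \<phi> \<in> carrier (sharp_hom p Xp P (P Mod N))" if N: "N \<lhd> P" for N
  proof (rule exI, rule conjI[OF sym])
    let ?Q = "P Mod N"
    show D: "sharp_frag ?Q P (?D N) \<in> carrier (sharp_hom p Xp P ?Q)"
      by (intro sharp_frag_closed keys N)
    have "sharp_comp p Xp P P ?Q (sharp_frag ?Q P (?D N)) (sharp_frag P P ?Id) =
      sharp_frag ?Q P (comp_frag P (?D N) ?Id)"
      by (intro sharp_comp_frag keys N finN fin)
    also have "sharp_comp p Xp P ?Q ?Q (sharp_frag ?Q ?Q (?F N)) \<dots> =
      sharp_frag ?Q P (comp_frag ?Q (?F N) (comp_frag P (?D N) ?Id))"
      by (intro sharp_comp_frag keys N finN fin)
    also have "\<dots> = sharp_frag ?Q P (?m N)"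
      by (intro sharp_frag_cong comp_frag_cong frag_eq_refl comp_frag_id_right keys N fin)
    finally show "sharp_comp p Xp P ?Q ?Q (sharp_frag ?Q ?Q (?F N))
      (sharp_comp p Xp P P ?Q (sharp_frag ?Q P (?D N)) (sharp_frag P P ?Id)) = sharp_frag ?Q P (?m N)" .
  qed
  \<comment> \<open>Likewise, with inflation in the middle and the identity as target
    idempotent.\<close>
  have N_entry: "\<exists>\<phi>. sharp_frag P (P Mod N) (?n N) =
      sharp_comp p Xp (P Mod N) P P (sharp_frag P P ?Id)
        (sharp_comp p Xp (P Mod N) (P Mod N) P \<phi> (sharp_frag (P Mod N) (P Mod N) (?F N))) \<and>
      \<phi> \<in> carrier (sharp_hom p Xp (P Mod N) P)" if N: "N \<lhd> P" for N
  proof (rule exI, rule conjI[OF sym])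
    let ?Q = "P Mod N"
    show "sharp_frag P ?Q (?I N) \<in> carrier (sharp_hom p Xp ?Q P)"
      by (intro sharp_frag_closed keys N)
    have "sharp_comp p Xp ?Q ?Q P (sharp_frag P ?Q (?I N)) (sharp_frag ?Q ?Q (?F N)) =
      sharp_frag P ?Q (?n N)"
      by (intro sharp_comp_frag keys N finN fin)
    also have "sharp_comp p Xp ?Q P P (sharp_frag P P ?Id) \<dots> = sharp_frag P ?Q (comp_frag P ?Id (?n N))"
      by (intro sharp_comp_frag keys N finN fin)
    also have "\<dots> = sharp_frag P ?Q (?n N)"
      by (intro sharp_frag_cong comp_frag_id_left keys N fin)
    finally show "sharp_comp p Xp ?Q P P (sharp_frag P P ?Id)
      (sharp_comp p Xp ?Q ?Q P (sharp_frag P ?Q (?I N)) (sharp_frag ?Q ?Q (?F N))) = sharp_frag P ?Q (?n N)" .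
  qed
  have "M \<in> roquette_hom p Xp ?A ?B"
    unfolding roquette_hom_def M_def restrict_PiE_iff idxB A grpB idemB
    using M_entry by auto
  moreover have "N \<in> roquette_hom p Xp ?B ?A"
    unfolding roquette_hom_def N_def restrict_PiE_iff idxB A grpB idemB
    using N_entry by auto
  moreover have "roquette_comp p Xp ?A ?B ?A N M = roquette_id p Xp ?A"
  proof -
    let ?c = "\<lambda>N. comp_frag (P Mod N) (?n N) (?m N)"
    let ?H = "sharp_hom p Xp P P"
    interpret H: comm_group ?H by (rule comm_group_sharp_hom[OF G G])
    \<comment> \<open>The composite on \<open>P\<close> is a 1-by-1 matrix. Its entry sums over all
      indices of \<open>?B\<close>, and the sum becomes the identity only as a whole.\<close>
    have "finprod ?H (\<lambda>j. sharp_comp p Xp P (P Mod fst j) P (N ((), j)) (M (j, ()))) (idx ?B) =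
      finprod ?H (\<lambda>j. sharp_frag P P (?c (fst j))) (idx ?B)"
    proof (rule H.finprod_cong')
      fix j assume j: "j \<in> idx ?B"
      then have N: "fst j \<lhd> P" by (auto simp: idxB)
      have "sharp_comp p Xp P (P Mod fst j) P (sharp_frag P (P Mod fst j) (?n (fst j)))
        (sharp_frag (P Mod fst j) P (?m (fst j))) = sharp_frag P P (?c (fst j))"
        by (intro sharp_comp_frag keys N fin)
      then show "sharp_comp p Xp P (P Mod fst j) P (N ((), j)) (M (j, ())) = sharp_frag P P (?c (fst j))"
        using j by (simp add: M_def N_def A)
    next
      show "(\<lambda>j. sharp_frag P P (?c (fst j))) \<in> idx ?B \<rightarrow> carrier ?H"
        by (intro Pi_I sharp_frag_closed keys) (auto simp: idxB)
    qed (rule refl)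
    also have "\<dots> = sharp_frag P P (\<Sum>j\<in>idx ?B. ?c (fst j))"
      unfolding idxB
      by (intro sharp_frag_finprod[THEN conjunct1] keys G finite_cartesian_product finite_normals fin) auto
    also have "(\<Sum>j\<in>idx ?B. ?c (fst j)) = (\<Sum>N\<in>{N. N \<lhd> P}. ?c N)"
      unfolding idxB by (rule sum.reindex_bij_witness[of _ "\<lambda>N. (N, ())" fst]) auto
    also have "sharp_frag P P \<dots> = sharp_frag P P ?Id"
      by (intro sharp_frag_cong edge_comp_sum keys G fin)
    finally show ?thesis
      by (simp add: roquette_comp_def roquette_id_def A grpB)
  qed
  moreover have "roquette_comp p Xp ?B ?A ?B M N = roquette_id p Xp ?B"
  proof -
    \<comment> \<open>In the other order the intermediate object has the single index
      \<open>()\<close>, so each matrix entry is one product, settled by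
      \<open>edge_comp_same\<close> on the diagonal and \<open>edge_comp_distinct\<close> off
      it.\<close>
    have "finprod (sharp_hom p Xp (P Mod fst i) (P Mod fst k))
        (\<lambda>j. sharp_comp p Xp (P Mod fst i) P (P Mod fst k) (M (k, j)) (N (j, i))) {()} =
      (if k = i then sharp_frag (P Mod fst i) (P Mod fst i) (?F (fst i))
       else \<one>\<^bsub>sharp_hom p Xp (P Mod fst i) (P Mod fst k)\<^esub>)" (is "?lhs = ?rhs")
      if i: "i \<in> idx ?B" and k: "k \<in> idx ?B" for i k
    proof -
      let ?Qi = "P Mod fst i" and ?Qk = "P Mod fst k"
      have Ni: "fst i \<lhd> P" and Nk: "fst k \<lhd> P" using i k by (auto simp: idxB)
      let ?c = "comp_frag P (?m (fst k)) (?n (fst i))"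
      interpret H: comm_group "sharp_hom p Xp ?Qi ?Qk"
        by (rule comm_group_sharp_hom[OF grp[OF Nk] grp[OF Ni]])
      have "sharp_comp p Xp ?Qi P ?Qk (sharp_frag ?Qk P (?m (fst k))) (sharp_frag P ?Qi (?n (fst i))) =
        sharp_frag ?Qk ?Qi ?c"
        by (intro sharp_comp_frag keys Ni Nk finN)
      then have "sharp_comp p Xp ?Qi P ?Qk (M (k, ())) (N ((), i)) = sharp_frag ?Qk ?Qi ?c"
        using i k by (simp add: M_def N_def A)
      moreover have "sharp_frag ?Qk ?Qi ?c \<in> carrier (sharp_hom p Xp ?Qi ?Qk)"
        by (intro sharp_frag_closed keys Ni Nk)
      moreover have "sharp_frag ?Qk ?Qi ?c = ?rhs"
      proof (cases "k = i")
        case True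
        have "sharp_frag ?Qi ?Qi (comp_frag P (?m (fst i)) (?n (fst i))) = sharp_frag ?Qi ?Qi (?F (fst i))"
          by (intro sharp_frag_cong edge_comp_same keys Ni G fin)
        then show ?thesis using True by simp
      next
        case False
        then have "fst i \<noteq> fst k" by (auto simp: prod_eq_iff)
        then have "sharp_frag ?Qk ?Qi ?c = sharp_frag ?Qk ?Qi 0"
          by (intro sharp_frag_cong edge_comp_distinct Ni Nk G fin grp) auto
        then show ?thesis using False sharp_frag_one[OF grp[OF Nk] grp[OF Ni]] by simp
      qed
      ultimately show ?thesis by simp
    qed
    then show ?thesis
      unfolding roquette_comp_def roquette_id_def A grpB idemB
      by (intro restrict_ext) auto
  qed
  ultimately show ?thesis
    unfolding roquette_iso_def using objA objB by blast
qed

end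

theorem proposition3p8:
  fixes p :: nat
    and Xp :: "(vec3 \<Rightarrow> vec3) set set"
    and P :: "'a monoid"
  assumes "Factorial_Ring.prime p"
    and "sylow_subgroup p (PGL3 p) Xp"
    and "finite_p_group p P"
  shows "roquette_iso p Xp (roquette_grp p Xp P)
           (roquette_sum {N. N \<lhd> P} (\<lambda>N. edge p Xp (P Mod N)))"
proof -
  have "subgroup Xp (PGL3 p)"
    using assms(2) by (simp add: sylow_subgroup_def)
  then obtain d where "delta_representative p Xp d"
    using delta_representative_exists[OF assms(1)] by blast
  then show ?thesis
    by (rule delta_representative.roquette_decomposition[OF _ assms(1,3)])
qed

end
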